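(* There is an absolute constant $C>0$ such that the following holds. For every integer $k\ge 1$ there exists $n_0(k)$ such that for all integers $n\ge n_0(k)$: (a) if $n$ is even, then $\hat r^k_{\mathrm{ind}}(C_n)\le C k^{102}\, n$ (i.e. $\hat r^k_{\mathrm{ind}}(C_n)=O(k^{102})n$); (b) if $n$ is odd, then $\hat r^k_{\mathrm{ind}}(C_n)\le e^{C k\log k}\, n$ (i.e. $\hat r^k_{\mathrm{ind}}(C_n)=e^{O(k\log k)}n$).
   Context: $C_n$ denotes the cycle on $n$ vertices. For a graph $H$ and an integer $k\ge1$, the induced size-Ramsey number $\hat r^k_{\mathrm{ind}}(H)$ is the smallest number of edges of a graph $G$ such that every colouring of the edges of $G$ with $k$ colours contains a monochromatic copy of $H$ which is an induced subgraph of $G$. Logarithms are to base $e$. The implied constants in the $O(\cdot)$ notation are absolute (independent of $k$ and $n$). *)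

theory Defs
  imports Complex_Main "HOL-Library.FuncSet" "HOL-Library.Extended_Real"
begin

type_synonym 'a graph = "'a set \<times> 'a set set"

abbreviation verts :: "'a graph \<Rightarrow> 'a set" where "verts \<equiv> fst"

abbreviation edges :: "'a graph \<Rightarrow> 'a set set" where "edges \<equiv> snd"

definition simple_graph :: "'a graph \<Rightarrow> bool" where
  "simple_graph G \<longleftrightarrow> finite (verts G) \<and> (\<forall>e\<in>edges G. e \<subseteq> verts G \<and> card e = 2)"

definition induced_subgraph :: "'a graph \<Rightarrow> 'a set \<Rightarrow> 'a graph" where
  "induced_subgraph G S = (S, {e \<in> edges G. e \<subseteq> S})"

definition graph_iso :: "'a graph \<Rightarrow> 'b graph \<Rightarrow> bool" where
  "graph_iso G H \<longleftrightarrow>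
     (\<exists>f. bij_betw f (verts G) (verts H) \<and>
          (\<forall>u\<in>verts G. \<forall>v\<in>verts G. {u, v} \<in> edges G \<longleftrightarrow> {f u, f v} \<in> edges H))"

text \<open>This is the cycle on \<open>n\<close> vertices only for \<open>n \<ge> 3\<close>; smaller values of \<open>n\<close> are degenerate.\<close>

definition cycle_graph :: "nat \<Rightarrow> nat graph" where
  "cycle_graph n = ({..<n}, {{i, Suc i mod n} | i. i < n})"

definition induced_ramsey :: "nat \<Rightarrow> 'a graph \<Rightarrow> 'b graph \<Rightarrow> bool" where
  "induced_ramsey k G H \<longleftrightarrow>
     (\<forall>c \<in> edges G \<rightarrow> {..<k}. \<exists>S \<subseteq> verts G. \<exists>a<k.
        graph_iso (induced_subgraph G S) H \<and>
        (\<forall>e \<in> edges (induced_subgraph G S). c e = a))"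

text \<open>Every finite graph is isomorphic to one with vertices in \<open>nat\<close>, so the minimum may be taken
  over such graphs. It is taken in \<open>enat\<close>, so that it would be \<open>\<infinity>\<close>, and not an arbitrary natural
  number, if no suitable graph existed.\<close>

definition ind_size_ramsey :: "nat \<Rightarrow> 'b graph \<Rightarrow> enat" where
  "ind_size_ramsey k H =
     Inf {enat (card (edges G)) | G :: nat graph. simple_graph G \<and> induced_ramsey k G H}"

end

theory Submission
  imports Defs "HOL-Computational_Algebra.Primes"
begin

text \<open>Take a random sparse uniform hypergraph with linearly many vertices and place on each hyperedge a copy
  of a fixed \<^emph>\<open>gadget\<close>: a graph in which every colouring yields two vertices joined, in one colour, by
  an induced path with 2 edges and by one with \<open>\<delta> + 2\<close> edges. A colouring of the host selects a
  colour for each hyperedge; hyperedges of the most frequent colour, viewed as edges between the two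
  selected vertices, form a dense graph. This graph contains an expander, in which depth-first search
  finds a long path; growing trees from its two ends and joining them through the expander closes it
  to a cycle of slightly flexible length. Local sparsity of the random hypergraph excludes all but few
  extensions that would create an additional connection, so that the cycle is induced in the
  hypergraph. Choosing in every hyperedge of the cycle the shorter or the longer path then gives an
  induced monochromatic cycle with exactly \<open>n\<close> vertices. For even \<open>n\<close> (\<open>\<delta> = 2\<close>) the gadget is the
  point-line incidence graph of an affine plane, which contains a monochromatic hexagon. For odd \<open>n\<close>
  (\<open>\<delta> = 1\<close>) it is a dense pseudorandom graph, in which the colours are eliminated one by
  one by passing to second neighbourhoods, each time at the cost of a factor \<open>32 k\<close>.\<close>

section \<open>Connected, tidy and loose families of hyperedges\<close>

text \<open>The cycle must be induced with respect to hyperedges of all colours, while expansion is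
  available in one colour only. Sparsity connects the two: at linear scale hyperedges and vertices
  span at most 6/5 incidences per object, which allows at most 8 unsuitable extensions per object
  already used, against the 600 hyperedges per vertex that expansion offers. A ratio above 1 is the
  price of linear scale; at bounded scale the few cycles of the incidence graph can be deleted
  altogether. Both regimes are needed, because a suitable extension always ends in a fresh vertex
  and so never closes a cycle. The closing path comes from elsewhere: no hyperedge meets both it and
  the long path, and together with the two tree branches it has bounded length, where no short
  cycles exist. The expander costs a logarithm of the number of vertices divided by the size
  \<open>c1 * x0\<close> of the sets that must expand; this quotient depends on \<open>k\<close> and
  the gadget alone, so the host stays linear in \<open>n\<close>. \<open>G\<close> is the allowance
  for that logarithm. A gadget with \<open>r\<close> vertices enters the result through
  \<open>r ^ 12\<close>, times its number of edges.\<close>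

definition shadow :: "('e \<Rightarrow> 'v set) \<Rightarrow> 'e set \<Rightarrow> 'v set" where
  "shadow inc T = (\<Union>e\<in>T. inc e)"

lemma shadow_simps [simp]:
  "shadow inc {} = {}"
  "shadow inc (insert e T) = inc e \<union> shadow inc T"
  "shadow inc (S \<union> T) = shadow inc S \<union> shadow inc T"
  by (auto simp: shadow_def)

lemma shadow_mono: "S \<subseteq> T \<Longrightarrow> shadow inc S \<subseteq> shadow inc T"
  by (auto simp: shadow_def)

lemma inc_subset_shadow: "e \<in> T \<Longrightarrow> inc e \<subseteq> shadow inc T"
  by (auto simp: shadow_def)

text \<open>Stated through bipartitions and not through walks: no witness has to be rebuilt when
  families are united or a leaf is removed. The empty family counts as connected.\<close>

definition conn :: "('e \<Rightarrow> 'v set) \<Rightarrow> 'e set \<Rightarrow> bool" where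
  "conn inc S \<longleftrightarrow> (\<forall>S1 S2. S1 \<union> S2 = S \<longrightarrow> S1 \<inter> S2 = {} \<longrightarrow> S1 \<noteq> {} \<longrightarrow> S2 \<noteq> {} \<longrightarrow>
     shadow inc S1 \<inter> shadow inc S2 \<noteq> {})"

lemma connD:
  "conn inc S \<Longrightarrow> S1 \<union> S2 = S \<Longrightarrow> S1 \<inter> S2 = {} \<Longrightarrow> S1 \<noteq> {} \<Longrightarrow> S2 \<noteq> {} \<Longrightarrow>
     shadow inc S1 \<inter> shadow inc S2 \<noteq> {}"
  unfolding conn_def by blast

lemma conn_empty [simp]: "conn inc {}"
  unfolding conn_def by auto

lemma conn_singleton [simp]: "conn inc {e}"
  unfolding conn_def
proof (intro allI impI)
  fix S1 S2 assume "S1 \<union> S2 = {e}" "S1 \<inter> S2 = {}" "S1 \<noteq> {}" "S2 \<noteq> {}"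
  then have False by (metis Un_empty Un_singleton_iff insert_not_empty inf.idem)
  then show "shadow inc S1 \<inter> shadow inc S2 \<noteq> {}" ..
qed

lemma conn_union:
  assumes "conn inc S" "conn inc T" "shadow inc S \<inter> shadow inc T \<noteq> {}"
  shows "conn inc (S \<union> T)"
  unfolding conn_def
proof (intro allI impI)
  fix S1 S2 assume p: "S1 \<union> S2 = S \<union> T" "S1 \<inter> S2 = {}" "S1 \<noteq> {}" "S2 \<noteq> {}"
  have part: "shadow inc S1 \<inter> shadow inc S2 \<noteq> {}"
    if c: "conn inc K" and K: "K \<subseteq> S \<union> T" and ne: "S1 \<inter> K \<noteq> {}" "S2 \<inter> K \<noteq> {}" for K
  proof -
    have "shadow inc (S1 \<inter> K) \<inter> shadow inc (S2 \<inter> K) \<noteq> {}"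
      by (rule connD[OF c]) (use p K ne in auto)
    then show ?thesis
      using shadow_mono[of "S1 \<inter> K" S1 inc] shadow_mono[of "S2 \<inter> K" S2 inc] by blast
  qed
  show "shadow inc S1 \<inter> shadow inc S2 \<noteq> {}"
  proof (cases "(S1 \<inter> S \<noteq> {} \<and> S2 \<inter> S \<noteq> {}) \<or> (S1 \<inter> T \<noteq> {} \<and> S2 \<inter> T \<noteq> {})")
    case True
    then show ?thesis using part[OF assms(1)] part[OF assms(2)] by blast
  next
    case False
    then have "(S \<subseteq> S1 \<and> T \<subseteq> S2) \<or> (S \<subseteq> S2 \<and> T \<subseteq> S1)" using p by blast
    then show ?thesis
      using assms(3) shadow_mono[of S S1 inc] shadow_mono[of S S2 inc]
        shadow_mono[of T S1 inc] shadow_mono[of T S2 inc] by blast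
  qed
qed

lemma conn_insert:
  assumes "conn inc S" "inc e \<inter> shadow inc S \<noteq> {}"
  shows "conn inc (insert e S)"
  using conn_union[of inc "{e}" S] assms by simp

text \<open>Put \<open>e\<close> on either side of a splitting of the rest: connectivity of
  \<open>S\<close> makes \<open>e\<close> meet both sides, and both meetings can only be at
  \<open>p\<close>, which is thus a common vertex.\<close>

lemma conn_remove_leaf:
  assumes c: "conn inc S" and e: "e \<in> S" and leaf: "inc e \<inter> shadow inc (S - {e}) \<subseteq> {p}"
  shows "conn inc (S - {e})"
  unfolding conn_def
proof (intro allI impI)
  fix S1 S2 assume p: "S1 \<union> S2 = S - {e}" "S1 \<inter> S2 = {}" "S1 \<noteq> {}" "S2 \<noteq> {}"
  show "shadow inc S1 \<inter> shadow inc S2 \<noteq> {}"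
  proof
    assume disj: "shadow inc S1 \<inter> shadow inc S2 = {}"
    have "shadow inc (insert e S1) \<inter> shadow inc S2 \<noteq> {}"
      by (rule connD[OF c]) (use p e in auto)
    then have 1: "inc e \<inter> shadow inc S2 \<noteq> {}" using disj by auto
    have "shadow inc (insert e S2) \<inter> shadow inc S1 \<noteq> {}"
      by (rule connD[OF c]) (use p e in auto)
    then have 2: "inc e \<inter> shadow inc S1 \<noteq> {}" using disj by auto
    have "shadow inc S1 \<subseteq> shadow inc (S - {e})" "shadow inc S2 \<subseteq> shadow inc (S - {e})"
      using p(1) by (metis shadow_mono Un_upper1, metis shadow_mono Un_upper2)
    then show False using 1 2 leaf disj by blast
  qed
qed

text \<open>Not meeting at all is included; two distinct common vertices are what would create a
  chord.\<close>

definition meets_once :: "('e \<Rightarrow> 'v set) \<Rightarrow> 'e \<Rightarrow> 'e set \<Rightarrow> bool" where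
  "meets_once inc f S \<longleftrightarrow> (\<forall>u\<in>inc f \<inter> shadow inc S. \<forall>w\<in>inc f \<inter> shadow inc S. u = w)"

lemma meets_onceD:
  "meets_once inc f S \<Longrightarrow> u \<in> inc f \<Longrightarrow> u \<in> shadow inc S \<Longrightarrow> w \<in> inc f \<Longrightarrow> w \<in> shadow inc S \<Longrightarrow> u = w"
  unfolding meets_once_def by blast

text \<open>Tidiness is formulated for all connected subfamilies, and not just for \<open>T\<close>, because only a
  part of the search tree ends up in the cycle.\<close>

definition tidy :: "'e set \<Rightarrow> ('e \<Rightarrow> 'v set) \<Rightarrow> 'e set \<Rightarrow> bool" where
  "tidy E inc T \<longleftrightarrow> (\<forall>S\<subseteq>T. conn inc S \<longrightarrow> (\<forall>f\<in>E - S. meets_once inc f S))"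

lemma tidyD: "tidy E inc T \<Longrightarrow> S \<subseteq> T \<Longrightarrow> conn inc S \<Longrightarrow> f \<in> E \<Longrightarrow> f \<notin> S \<Longrightarrow> meets_once inc f S"
  unfolding tidy_def by blast

text \<open>The last condition forbids that \<open>e\<close> becomes connected to \<open>T\<close> a second time, by a path of two hyperedges
  \<open>e\<close>, \<open>f\<close>.\<close>

definition clean :: "'e set \<Rightarrow> ('e \<Rightarrow> 'v set) \<Rightarrow> 'e set \<Rightarrow> 'v \<Rightarrow> 'e \<Rightarrow> bool" where
  "clean E inc T p e \<longleftrightarrow> e \<in> E \<and> e \<notin> T \<and> p \<in> inc e \<and> inc e \<inter> shadow inc T \<subseteq> {p} \<and>
     (\<forall>f\<in>E. f \<noteq> e \<longrightarrow> inc f \<inter> (inc e - {p}) \<noteq> {} \<longrightarrow> inc f \<inter> shadow inc T = {})"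

lemma clean_antimono: "clean E inc T p e \<Longrightarrow> T0 \<subseteq> T \<Longrightarrow> clean E inc T0 p e"
  unfolding clean_def using shadow_mono[of T0 T inc] by blast

definition linear_family :: "'e set \<Rightarrow> ('e \<Rightarrow> 'v set) \<Rightarrow> bool" where
  "linear_family E inc \<longleftrightarrow> (\<forall>e\<in>E. \<forall>f\<in>E. e \<noteq> f \<longrightarrow> (\<forall>u\<in>inc e \<inter> inc f. \<forall>w\<in>inc e \<inter> inc f. u = w))"

lemma tidy_singleton:
  assumes "linear_family E inc" "e \<in> E"
  shows "tidy E inc {e}"
  unfolding tidy_def meets_once_def
proof (intro allI impI ballI)
  fix S f u w
  assume S: "S \<subseteq> {e}" and f: "f \<in> E - S"
    and u: "u \<in> inc f \<inter> shadow inc S" and w: "w \<in> inc f \<inter> shadow inc S"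
  have "S = {e}" using S u by (cases "S = {}") auto
  then show "u = w" using assms f u w unfolding linear_family_def by auto
qed

text \<open>If \<open>S\<close> contains \<open>e\<close>, then \<open>e\<close> is a leaf of
  \<open>S\<close> hanging at \<open>p\<close>, so \<open>S - {e}\<close> is still connected. A
  hyperedge \<open>f\<close> that meets \<open>e\<close> away from \<open>p\<close> avoids
  \<open>T\<close> by cleanness, and linearity bounds its meeting with \<open>e\<close>. Any other
  \<open>f\<close> meets \<open>S\<close> in the same vertices as \<open>S - {e}\<close>, where
  tidiness of \<open>T\<close> applies, unless \<open>S = {e}\<close>, which is linearity
  again.\<close>

lemma tidy_insert:
  assumes lin: "linear_family E inc" and T: "tidy E inc T" and TE: "T \<subseteq> E" and cl: "clean E inc T p e"
  shows "tidy E inc (insert e T)"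
  unfolding tidy_def
proof (intro allI impI ballI)
  fix S f
  assume S: "S \<subseteq> insert e T" and c: "conn inc S" and f: "f \<in> E - S"
  have eT: "e \<notin> T" and eE: "e \<in> E" and sub: "inc e \<inter> shadow inc T \<subseteq> {p}"
    and far: "\<And>f. f \<in> E \<Longrightarrow> f \<noteq> e \<Longrightarrow> inc f \<inter> (inc e - {p}) \<noteq> {} \<Longrightarrow> inc f \<inter> shadow inc T = {}"
    using cl unfolding clean_def by auto
  show "meets_once inc f S"
  proof (cases "e \<in> S")
    case False
    then have "S \<subseteq> T" using S by auto
    then show ?thesis using tidyD[OF T _ c] f by blast
  next
    case True
    have S0: "S - {e} \<subseteq> T" using S by auto
    then have sh: "shadow inc (S - {e}) \<subseteq> shadow inc T" by (rule shadow_mono)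
    have leaf: "inc e \<inter> shadow inc (S - {e}) \<subseteq> {p}" using sub sh by blast
    have c0: "conn inc (S - {e})" by (rule conn_remove_leaf[OF c True leaf])
    have one: "meets_once inc f (S - {e})" using tidyD[OF T S0 c0] f by blast
    have split: "shadow inc S = inc e \<union> shadow inc (S - {e})"
      using True shadow_simps(2)[of inc e "S - {e}"] by (simp add: insert_absorb)
    have fe: "f \<noteq> e" using True f by auto
    have lin1: "u = w" if "u \<in> inc e \<inter> inc f" "w \<in> inc e \<inter> inc f" for u w
      using lin eE f fe that unfolding linear_family_def by blast
    show ?thesis
    proof (cases "inc f \<inter> (inc e - {p}) = {}")
      case False
      then have "inc f \<inter> shadow inc T = {}" using far f fe by blast
      then have "inc f \<inter> shadow inc S = inc f \<inter> inc e" using split sh by blast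
      then show ?thesis using lin1 unfolding meets_once_def by blast
    next
      case True
      note fp = this
      show ?thesis
      proof (cases "S - {e} = {}")
        case True
        then have "shadow inc S = inc e" by (subst split) (simp only: shadow_simps Un_empty_right)
        then show ?thesis using lin1 unfolding meets_once_def by blast
      next
        case False
        \<comment> \<open>Connectivity forces the leaf to be attached, so \<open>p\<close> already
          lies in the rest and \<open>e\<close> adds no common vertex with \<open>f\<close>.\<close>
        have "shadow inc {e} \<inter> shadow inc (S - {e}) \<noteq> {}"
          by (rule connD[OF c]) (use \<open>e \<in> S\<close> False in auto)
        then have "p \<in> shadow inc (S - {e})" using leaf by auto
        then have "inc f \<inter> shadow inc S = inc f \<inter> shadow inc (S - {e})" using split fp by blast
        then show ?thesis using one unfolding meets_once_def by simp
      qed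
    qed
  qed
qed

section \<open>Walks and loose paths\<close>

fun walk :: "('e \<Rightarrow> 'v set) \<Rightarrow> 'v list \<Rightarrow> 'e list \<Rightarrow> bool" where
  "walk en [v] [] = True"
| "walk en (v # w # vs) (e # es) = (en e = {v, w} \<and> walk en (w # vs) es)"
| "walk en _ _ = False"

lemma walk_length: "walk en vs es \<Longrightarrow> length vs = Suc (length es)"
  by (induction en vs es rule: walk.induct) auto

lemma walk_nonempty: "walk en vs es \<Longrightarrow> vs \<noteq> []"
  using walk_length by fastforce

lemma walk_nth: "walk en vs es \<Longrightarrow> i < length es \<Longrightarrow> en (es ! i) = {vs ! i, vs ! Suc i}"
proof (induction en vs es arbitrary: i rule: walk.induct)
  case (2 en v w vs e es)
  then show ?case by (cases i) auto
qed auto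

lemma walk_append:
  "walk en vs1 es1 \<Longrightarrow> walk en vs2 es2 \<Longrightarrow> last vs1 = hd vs2 \<Longrightarrow> walk en (vs1 @ tl vs2) (es1 @ es2)"
proof (induction en vs1 es1 rule: walk.induct)
  case (1 en v)
  then show ?case using walk_nonempty[OF 1(2)] by (cases vs2) auto
qed auto

lemma walk_snoc:
  assumes "walk en vs es" "en e = {last vs, w}"
  shows "walk en (vs @ [w]) (es @ [e])"
  using walk_append[of en vs es "[last vs, w]" "[e]"] assms by simp

lemma walk_rev: "walk en vs es \<Longrightarrow> walk en (rev vs) (rev es)"
proof (induction en vs es rule: walk.induct)
  case (2 en v w vs e es)
  have "walk en (rev (w # vs) @ [v]) (rev es @ [e])"
    by (rule walk_snoc) (use 2 in \<open>auto simp: insert_commute\<close>)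
  then show ?case by simp
qed auto

lemma walk_take: "walk en vs es \<Longrightarrow> k \<le> length es \<Longrightarrow> walk en (take (Suc k) vs) (take k es)"
proof (induction en vs es arbitrary: k rule: walk.induct)
  case (2 en v w vs e es)
  then show ?case by (cases k) auto
qed auto

lemma walk_drop: "walk en vs es \<Longrightarrow> k \<le> length es \<Longrightarrow> walk en (drop k vs) (drop k es)"
proof (induction en vs es arbitrary: k rule: walk.induct)
  case (2 en v w vs e es)
  then show ?case by (cases k) auto
qed auto

lemma walk_ends_subset: "walk en vs es \<Longrightarrow> e \<in> set es \<Longrightarrow> en e \<subseteq> set vs"
  by (induction en vs es rule: walk.induct) auto

lemma walk_verts_subset_shadow:
  "walk en vs es \<Longrightarrow> (\<And>e. e \<in> set es \<Longrightarrow> en e \<subseteq> inc e) \<Longrightarrow> es \<noteq> [] \<Longrightarrow> set vs \<subseteq> shadow inc (set es)"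
proof (induction en vs es rule: walk.induct)
  case (2 en v w vs e es)
  show ?case
  proof (cases "es = []")
    case True
    then show ?thesis using 2 by (cases vs) (auto 4 4)
  next
    case False
    then have "set (w # vs) \<subseteq> shadow inc (set es)" using 2 by auto
    moreover have "v \<in> inc e" using 2(2,3) by auto
    ultimately show ?thesis by auto
  qed
qed auto

lemma walk_conn:
  "walk en vs es \<Longrightarrow> (\<And>e. e \<in> set es \<Longrightarrow> en e \<subseteq> inc e) \<Longrightarrow> conn inc (set es)"
proof (induction en vs es rule: walk.induct)
  case (2 en v w vs e es)
  show ?case
  proof (cases "es = []")
    case False
    have "set (w # vs) \<subseteq> shadow inc (set es)"
      by (rule walk_verts_subset_shadow[of en]) (use 2 False in auto)
    moreover have "w \<in> inc e" using 2(2,3) by auto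
    moreover have "conn inc (set es)" using 2 by auto
    ultimately show ?thesis using conn_insert[of inc "set es" e] by auto
  qed auto
qed auto

lemma walk_split:
  assumes "walk en vs (es1 @ es2)"
  shows "walk en (take (Suc (length es1)) vs) es1" "walk en (drop (length es1) vs) es2"
  using walk_take[OF assms, of "length es1"] walk_drop[OF assms, of "length es1"] by auto

lemma path_distinct_edges:
  assumes "walk en vs es" "distinct vs"
  shows "distinct es"
  using assms
proof (induction en vs es rule: walk.induct)
  case (2 en v w vs e es)
  have "e \<notin> set es"
  proof
    assume "e \<in> set es"
    then have "en e \<subseteq> set (w # vs)" using walk_ends_subset 2 by fastforce
    then show False using 2 by auto
  qed
  then show ?case using 2 by auto
qed auto

text \<open>The segment from \<open>e\<close> to just before \<open>e'\<close> is connected, so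
  \<open>e'\<close> meets it in one vertex, which must be the endpoint where the path enters
  \<open>e'\<close>; the symmetric segment puts the same vertex among the endpoints of
  \<open>e\<close>. The assumption \<open>one\<close> is supplied by tidiness for long paths and by
  the absence of short cycles for bounded ones.\<close>

lemma path_loose:
  assumes w: "walk en vs es" and d: "distinct vs" and inc: "\<And>e. e \<in> set es \<Longrightarrow> en e \<subseteq> inc e"
    and one: "\<And>S f. S \<subseteq> set es \<Longrightarrow> conn inc S \<Longrightarrow> f \<in> set es \<Longrightarrow> f \<notin> S \<Longrightarrow> meets_once inc f S"
    and e: "e \<in> set es" "e' \<in> set es" "e \<noteq> e'"
  shows "inc e \<inter> inc e' \<subseteq> en e \<inter> en e'"
proof -
  have de: "distinct es" by (rule path_distinct_edges[OF w d])
  have main: "inc e \<inter> inc e' \<subseteq> en e \<inter> en e'"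
    if es: "es = es1 @ e # es2 @ e' # es3" for e e' es1 es2 es3
  proof
    fix x assume x: "x \<in> inc e \<inter> inc e'"
    have "walk en vs (es1 @ ((e # es2) @ [e']) @ es3)" using w es by simp
    from walk_split(1)[OF walk_split(2)[OF this]] obtain us where us: "walk en us ((e # es2) @ [e'])"
      by blast
    have 1: "conn inc (set (e # es2))"
      by (rule walk_conn[OF walk_split(1)[OF us]]) (use inc es in auto)
    have 2: "walk en (drop 1 us) (es2 @ [e'])" using walk_split(2)[of en us "[e]" "es2 @ [e']"] us by simp
    have 2: "conn inc (set (es2 @ [e']))" by (rule walk_conn[OF 2]) (use inc es in auto)
    have len: "length us = length es2 + 3" using walk_length[OF us] by simp
    have n0: "en e = {us ! 0, us ! 1}" using walk_nth[OF us, of 0] by simp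
    have n1: "en e' = {us ! (length es2 + 1), us ! (length es2 + 2)}"
      using walk_nth[OF us, of "length es2 + 1"] by (simp add: nth_append)
    have p1: "us ! (length es2 + 1) \<in> shadow inc (set (e # es2))"
    proof -
      have "set (take (Suc (length (e # es2))) us) \<subseteq> shadow inc (set (e # es2))"
        by (rule walk_verts_subset_shadow[OF walk_split(1)[OF us]]) (use inc es in auto)
      moreover have "us ! (length es2 + 1) \<in> set (take (Suc (length (e # es2))) us)"
        using len by (auto simp: in_set_conv_nth intro!: exI[of _ "length es2 + 1"])
      ultimately show ?thesis by blast
    qed
    have p2: "us ! 1 \<in> shadow inc (set (es2 @ [e']))"
    proof -
      have "set (drop 1 us) \<subseteq> shadow inc (set (es2 @ [e']))"
        by (rule walk_verts_subset_shadow[of en])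
          (use inc es walk_split(2)[of en us "[e]" "es2 @ [e']"] us in auto)
      moreover have "us ! 1 \<in> set (drop 1 us)"
        using len by (auto simp: in_set_conv_nth intro!: exI[of _ 0])
      ultimately show ?thesis by blast
    qed
    have m1: "meets_once inc e' (set (e # es2))" by (rule one[OF _ 1]) (use es de in auto)
    have m2: "meets_once inc e (set (es2 @ [e']))" by (rule one[OF _ 2]) (use es de in auto)
    have "x = us ! (length es2 + 1)"
      by (rule meets_onceD[OF m1]) (use x p1 n1 inc[of e'] es in auto)
    moreover have "x = us ! 1"
      by (rule meets_onceD[OF m2]) (use x p2 n0 inc[of e] es in auto)
    ultimately show "x \<in> en e \<inter> en e'" using n0 n1 by auto
  qed
  obtain xs ys where s: "es = xs @ e # ys" using e(1) split_list by metis
  show ?thesis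
  proof (cases "e' \<in> set ys")
    case True
    then obtain us zs where "ys = us @ e' # zs" using split_list by metis
    then show ?thesis using main s by blast
  next
    case False
    then have "e' \<in> set xs" using s e by auto
    then obtain us zs where "xs = us @ e' # zs" using split_list by metis
    then have "es = us @ e' # zs @ e # ys" using s by simp
    from main[OF this] show ?thesis by blast
  qed
qed

section \<open>Counting edges of the bipartite incidence graph\<close>

definition incid :: "('e \<Rightarrow> 'v set) \<Rightarrow> 'e set \<Rightarrow> 'v set \<Rightarrow> nat" where
  "incid inc XE XV = card {(e, v). e \<in> XE \<and> v \<in> XV \<and> v \<in> inc e}"

lemma finite_incid: "finite XE \<Longrightarrow> finite XV \<Longrightarrow> finite {(e, v). e \<in> XE \<and> v \<in> XV \<and> v \<in> inc e}"
  by (rule finite_subset[of _ "XE \<times> XV"]) auto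

lemma incid_ge:
  assumes "finite XE" "finite XV" "P \<subseteq> {(e, v). e \<in> XE \<and> v \<in> XV \<and> v \<in> inc e}"
  shows "card P \<le> incid inc XE XV"
  unfolding incid_def by (rule card_mono[OF finite_incid[OF assms(1,2)] assms(3)])

lemma incid_insert_ge:
  assumes fin: "finite XE" "finite XV" and XE: "XE' \<subseteq> XE" and XV: "XV' \<subseteq> XV"
    and P: "P \<subseteq> {(e, v). e \<in> XE \<and> v \<in> XV \<and> v \<in> inc e}" and new: "\<And>e v. (e, v) \<in> P \<Longrightarrow> e \<notin> XE' \<or> v \<notin> XV'"
  shows "incid inc XE' XV' + card P \<le> incid inc XE XV"
proof -
  let ?Q = "{(e, v). e \<in> XE' \<and> v \<in> XV' \<and> v \<in> inc e}"
  have f: "finite ?Q" "finite P"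
    using finite_subset[OF XE fin(1)] finite_subset[OF XV fin(2)] finite_incid
      finite_subset[OF P finite_incid[OF fin]] by auto
  have "card (?Q \<union> P) = card ?Q + card P"
    by (rule card_Un_disjoint) (use f new in auto)
  moreover have "card (?Q \<union> P) \<le> incid inc XE XV"
    by (rule incid_ge[OF fin]) (use XE XV P in auto)
  ultimately show ?thesis unfolding incid_def by simp
qed

text \<open>A spanning tree of the incidence graph, grown by one hyperedge at a time: attaching it
  at a new vertex adds two objects and two incidences, attaching it at an old vertex adds one of
  each. The deficit of one incidence, present at the start, never increases.\<close>

lemma conn_spanning:
  assumes S: "conn inc S" "finite S" "S \<noteq> {}" and n: "1 \<le> n" "n \<le> card S"
  shows "\<exists>S0 XV. S0 \<subseteq> S \<and> card S0 = n \<and> finite XV \<and> XV \<subseteq> shadow inc S0 \<and> card XV \<le> n \<and>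
           card S0 + card XV \<le> incid inc S0 XV + 1"
  using n
proof (induction n rule: dec_induct)
  case base
  obtain e where "e \<in> S" using S by blast
  then show ?case by (intro exI[of _ "{e}"] exI[of _ "{}"]) auto
next
  case (step n)
  then obtain S0 XV where IH: "S0 \<subseteq> S" "card S0 = n" "finite XV" "XV \<subseteq> shadow inc S0" "card XV \<le> n"
      "card S0 + card XV \<le> incid inc S0 XV + 1" by auto
  have f0: "finite S0" using IH(1) S(2) finite_subset by blast
  have "S0 \<noteq> {}" using IH(2) step by auto
  moreover have "S - S0 \<noteq> {}" using IH(1,2) step by auto
  ultimately have "shadow inc S0 \<inter> shadow inc (S - S0) \<noteq> {}"
    by (intro connD[OF S(1)]) (use IH in auto)
  then obtain e u where e: "e \<in> S" "e \<notin> S0" "u \<in> inc e" "u \<in> shadow inc S0" by (auto simp: shadow_def)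
  obtain e0 where e0: "e0 \<in> S0" "u \<in> inc e0" using e(4) by (auto simp: shadow_def)
  show ?case
  proof (intro exI[of _ "insert e S0"] exI[of _ "insert u XV"] conjI)
    show "card (insert e S0) = Suc n" using e f0 IH by simp
    show "card (insert u XV) \<le> Suc n" using IH by (simp add: card_insert_if)
    show "card (insert e S0) + card (insert u XV) \<le> incid inc (insert e S0) (insert u XV) + 1"
    proof (cases "u \<in> XV")
      case True
      have "incid inc S0 XV + card {(e, u)} \<le> incid inc (insert e S0) (insert u XV)"
        by (rule incid_insert_ge) (use f0 IH e in auto)
      then show ?thesis using True IH e f0 by (simp add: insert_absorb)
    next
      case False
      have "incid inc S0 XV + card {(e, u), (e0, u)} \<le> incid inc (insert e S0) (insert u XV)"
        by (rule incid_insert_ge) (use f0 IH e e0 False in auto)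
      moreover have "card {(e, u), (e0, u)} = 2" using e(2) e0(1) by (cases "e = e0") auto
      ultimately show ?thesis using False IH e f0 by simp
    qed
  qed (use IH e in auto)
qed

text \<open>Two common vertices would close a cycle in the spanning tree together with
  \<open>f\<close>, with at least as many incidences as objects. The configuration has
  \<open>card S + 1\<close> hyperedges and at most \<open>card S + 2\<close> vertices, hence
  \<open>2 * card S + 3\<close>.\<close>

lemma short_meets_once:
  assumes short: "\<And>XE XV. XE \<subseteq> E \<Longrightarrow> finite XV \<Longrightarrow> 0 < card XE + card XV \<Longrightarrow> card XE + card XV \<le> R \<Longrightarrow>
      incid inc XE XV < card XE + card XV"
    and fin: "finite E" and S: "S \<subseteq> E" "conn inc S" and R: "2 * card S + 3 \<le> R" and f: "f \<in> E" "f \<notin> S"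
  shows "meets_once inc f S"
  unfolding meets_once_def
proof (intro ballI, rule ccontr)
  fix u w assume u: "u \<in> inc f \<inter> shadow inc S" and w: "w \<in> inc f \<inter> shadow inc S" and uw: "u \<noteq> w"
  have fS: "finite S" using S fin finite_subset by blast
  have "S \<noteq> {}" using u by auto
  then have "1 \<le> card S" using fS by (simp add: Suc_le_eq card_gt_0_iff)
  from conn_spanning[OF S(2) fS \<open>S \<noteq> {}\<close> this le_refl] obtain S0 XV where
    sp: "S0 \<subseteq> S" "card S0 = card S" "finite XV" "XV \<subseteq> shadow inc S0" "card XV \<le> card S"
      "card S0 + card XV \<le> incid inc S0 XV + 1" by blast
  have S0: "S0 = S" using sp(1,2) fS card_subset_eq by blast
  obtain eu where eu: "eu \<in> S" "u \<in> inc eu" using u by (auto simp: shadow_def)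
  obtain ew where ew: "ew \<in> S" "w \<in> inc ew" using w by (auto simp: shadow_def)
  let ?P = "{(f, u), (f, w)} \<union> (if u \<in> XV then {} else {(eu, u)}) \<union> (if w \<in> XV then {} else {(ew, w)})"
  let ?V = "insert u (insert w XV)"
  have ne: "f \<noteq> eu" "f \<noteq> ew" using f eu ew by auto
  have cP: "card ?P = 2 + (if u \<in> XV then 0 else 1) + (if w \<in> XV then 0 else 1)"
    using ne uw by (auto simp: card_insert_if)
  have cV: "card ?V = card XV + (if u \<in> XV then 0 else 1) + (if w \<in> XV then 0 else 1)"
    using sp(3) uw by (auto simp: card_insert_if)
  have cE: "card (insert f S) = card S + 1" using fS f by simp
  have "incid inc S XV + card ?P \<le> incid inc (insert f S) ?V"
    by (rule incid_insert_ge) (use fS sp(3) u w eu ew f in \<open>auto split: if_splits\<close>)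
  then have ge: "card (insert f S) + card ?V \<le> incid inc (insert f S) ?V"
    using sp(6) S0 cP cV cE by simp
  have "card (insert f S) + card ?V \<le> R" using R cE cV sp(5) by (auto split: if_splits)
  then have "incid inc (insert f S) ?V < card (insert f S) + card ?V"
    by (intro short) (use S f sp(3) cE in auto)
  then show False using ge by simp
qed

section \<open>Long loose cycles in sparse expanding hypergraphs\<close>

text \<open>The hyperedges in \<open>S\<close>, with their two chosen endpoints \<open>en e\<close>, form a graph on \<open>W\<close>.
  The assumptions \<open>touch\<close> and \<open>cut\<close> say that this graph expands; \<open>sparse\<close>, \<open>short\<close> and \<open>deg\<close>
  are properties of the whole hypergraph.\<close>

locale expanding_colour =
  fixes E :: "'e set" and inc en :: "'e \<Rightarrow> 'v set" and S :: "'e set" and W :: "'v set"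
    and r \<Delta> m0 R x0 c1 \<Lambda> :: nat
  assumes finE: "finite E" and fin_inc: "\<And>e. e \<in> E \<Longrightarrow> finite (inc e)"
    and card_inc: "\<And>e. e \<in> E \<Longrightarrow> card (inc e) \<le> r"
    and sparse: "\<And>XE XV. XE \<subseteq> E \<Longrightarrow> finite XV \<Longrightarrow> card XE + card XV \<le> m0 \<Longrightarrow>
        5 * incid inc XE XV \<le> 6 * (card XE + card XV)"
    and short: "\<And>S f. conn inc S \<Longrightarrow> S \<subseteq> E \<Longrightarrow> card S \<le> R \<Longrightarrow> f \<in> E \<Longrightarrow> f \<notin> S \<Longrightarrow> meets_once inc f S"
    and deg: "\<And>v. card {e \<in> E. v \<in> inc e} \<le> \<Delta>"
    and SE: "S \<subseteq> E" and S_nonempty: "S \<noteq> {}"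
    and en: "\<And>e. e \<in> S \<Longrightarrow> en e \<subseteq> inc e" "\<And>e. e \<in> S \<Longrightarrow> card (en e) = 2" "\<And>e. e \<in> S \<Longrightarrow> en e \<subseteq> W"
    and finW: "finite W" and cardW: "card W \<le> \<Lambda> * x0"
    and touch: "\<And>X. X \<subseteq> W \<Longrightarrow> 600 * card X \<le> card {e \<in> S. en e \<inter> X \<noteq> {}}"
    and cut: "\<And>X. X \<subseteq> W \<Longrightarrow> c1 * x0 \<le> card X \<Longrightarrow> c1 * x0 \<le> card (W - X) \<Longrightarrow>
        600 * (c1 * x0) \<le> card {e \<in> S. en e \<inter> X \<noteq> {} \<and> en e \<inter> (W - X) \<noteq> {}}"
    and R_ge: "2 * c1 + \<Lambda> \<le> R" "1 \<le> R"
    and m0_ge: "2000 * (c1 * x0) \<le> m0" and c1_ge: "1 \<le> c1" and x0_ge: "3 \<le> x0"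
    and c1_large: "\<Delta> * r * (\<Delta> * r * (20 * x0)) + \<Delta> * x0 \<le> 600 * (c1 * x0)"
begin

lemma linear: "linear_family E inc"
  unfolding linear_family_def
proof (intro ballI impI)
  fix e f u w
  assume ef: "e \<in> E" "f \<in> E" "e \<noteq> f" and u: "u \<in> inc e \<inter> inc f" and w: "w \<in> inc e \<inter> inc f"
  have "meets_once inc f {e}" by (rule short) (use ef R_ge in auto)
  then show "u = w" by (rule meets_onceD) (use u w in auto)
qed

lemma ends_of:
  assumes "e \<in> S" "p \<in> en e"
  obtains w where "en e = {p, w}" "w \<noteq> p"
proof -
  obtain a b where ab: "en e = {a, b}" "a \<noteq> b" using en(2)[OF assms(1)] by (auto simp: card_2_iff)
  show thesis
  proof (cases "p = a")
    case True then show ?thesis using that[of b] ab by auto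
  next
    case False then show ?thesis using that[of a] ab assms(2) by auto
  qed
qed

lemma finS: "finite S" using SE finE finite_subset by blast

section \<open>Counting hyperedges that are not clean\<close>

context
  fixes T :: "'e set" and Y :: "'v set"
  assumes TE: "T \<subseteq> E" and YT: "Y \<subseteq> shadow inc T" and size: "29 * (card T + card Y) \<le> m0"
begin

lemma finT: "finite T" using TE finE finite_subset by blast

lemma finY: "finite Y"
proof (rule finite_subset[OF YT])
  show "finite (shadow inc T)" unfolding shadow_def using finT TE fin_inc by blast
qed

definition bad_direct :: "'e set" where
  "bad_direct = {e \<in> E - T. \<exists>p\<in>Y. p \<in> inc e \<and> (\<exists>u\<in>inc e \<inter> shadow inc T. u \<noteq> p)}"

definition bad_ear :: "'e set" where
  "bad_ear = {e \<in> E - T. \<exists>p\<in>Y. p \<in> inc e \<and> inc e \<inter> shadow inc T \<subseteq> {p} \<and>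
     (\<exists>f\<in>E. f \<noteq> e \<and> inc f \<inter> (inc e - {p}) \<noteq> {} \<and> inc f \<inter> shadow inc T \<noteq> {})}"

text \<open>Write b for \<open>card T + card Y\<close>. Adding \<open>X\<close> to \<open>T\<close>
  gives two incidences per hyperedge and at most one new vertex, and each new vertex brings one more
  incidence with \<open>T\<close>. With the ratio 6/5 this yields 4|X| <= 6b + |U| <= 6b + |X|. The
  bound on \<open>card X\<close> keeps the configuration within \<open>m0\<close>; the lemma is
  meant for a subset with one element too many.\<close>

lemma card_bad_direct_sub:
  assumes X: "X \<subseteq> bad_direct" and cX: "card X \<le> 2 * (card T + card Y) + 1"
    and b: "1 \<le> card T + card Y"
  shows "card X \<le> 2 * (card T + card Y)"
proof -
  have "\<forall>e\<in>X. \<exists>p u. p \<in> Y \<and> p \<in> inc e \<and> u \<in> inc e \<and> u \<in> shadow inc T \<and> u \<noteq> p"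
    using X unfolding bad_direct_def by blast
  then obtain p u where pu: "\<And>e. e \<in> X \<Longrightarrow> p e \<in> Y \<and> p e \<in> inc e \<and> u e \<in> inc e \<and> u e \<in> shadow inc T \<and> u e \<noteq> p e"
    by metis
  have "\<forall>v\<in>shadow inc T. \<exists>t\<in>T. v \<in> inc t" by (auto simp: shadow_def)
  then obtain t where t: "\<And>v. v \<in> shadow inc T \<Longrightarrow> t v \<in> T \<and> v \<in> inc (t v)" by metis
  have XE: "X \<subseteq> E" "X \<inter> T = {}" using X unfolding bad_direct_def by auto
  have fX: "finite X" using XE(1) finE finite_subset by blast
  let ?U = "u ` X - Y"
  let ?P1 = "(\<lambda>e. (e, p e)) ` X" and ?P2 = "(\<lambda>e. (e, u e)) ` X" and ?P3 = "(\<lambda>v. (t v, v)) ` ?U"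
  have U: "\<And>v. v \<in> ?U \<Longrightarrow> t v \<in> T \<and> v \<in> inc (t v)" using pu t by blast
  have c: "card ?P1 = card X" "card ?P2 = card X" "card ?P3 = card ?U"
    by (auto intro!: card_image inj_onI)
  have d: "?P1 \<inter> ?P2 = {}" using pu by fastforce
  have d2: "(?P1 \<union> ?P2) \<inter> ?P3 = {}" using U XE(2) by auto
  have "card (?P1 \<union> ?P2 \<union> ?P3) = card (?P1 \<union> ?P2) + card ?P3"
    by (rule card_Un_disjoint) (use fX d2 in auto)
  also have "card (?P1 \<union> ?P2) = card ?P1 + card ?P2" by (rule card_Un_disjoint) (use fX d in auto)
  finally have cP: "card (?P1 \<union> ?P2 \<union> ?P3) = 2 * card X + card ?U" using c by simp
  have "card (?P1 \<union> ?P2 \<union> ?P3) \<le> incid inc (T \<union> X) (Y \<union> ?U)"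
  proof (rule incid_ge)
    show "finite (T \<union> X)" "finite (Y \<union> ?U)" using finT fX finY by auto
    show "?P1 \<union> ?P2 \<union> ?P3 \<subseteq> {(e, v). e \<in> T \<union> X \<and> v \<in> Y \<union> ?U \<and> v \<in> inc e}"
    proof -
      have "?P1 \<subseteq> {(e, v). e \<in> T \<union> X \<and> v \<in> Y \<union> ?U \<and> v \<in> inc e}" using pu by auto
      moreover have "?P2 \<subseteq> {(e, v). e \<in> T \<union> X \<and> v \<in> Y \<union> ?U \<and> v \<in> inc e}" using pu by auto
      moreover have "?P3 \<subseteq> {(e, v). e \<in> T \<union> X \<and> v \<in> Y \<union> ?U \<and> v \<in> inc e}" using U by auto
      ultimately show ?thesis by (intro Un_least)
    qed
  qed
  moreover have cE: "card (T \<union> X) = card T + card X" by (rule card_Un_disjoint) (use finT fX XE in auto)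
  moreover have cV: "card (Y \<union> ?U) = card Y + card ?U" by (rule card_Un_disjoint) (use finY fX in auto)
  moreover have U1: "card ?U \<le> card X"
  proof -
    have "card ?U \<le> card (u ` X)" by (rule card_mono) (use fX in auto)
    then show ?thesis using card_image_le[OF fX, of u] by linarith
  qed
  moreover have "5 * incid inc (T \<union> X) (Y \<union> ?U) \<le> 6 * (card (T \<union> X) + card (Y \<union> ?U))"
  proof (rule sparse)
    show "T \<union> X \<subseteq> E" using TE XE by simp
    show "finite (Y \<union> ?U)" using finY fX by simp
    show "card (T \<union> X) + card (Y \<union> ?U) \<le> m0"
      unfolding cE cV using U1 cX b size unfolding add_mult_distrib2 by linarith
  qed
  ultimately show ?thesis using cP unfolding add_mult_distrib2 by linarith
qed

text \<open>Each bad hyperedge \<open>e\<close> comes with an \<open>f\<close> that leads back to \<open>T\<close>. Adding all of them to \<open>T\<close> raises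
  the number of incidences by more than 6/5 of the number of added objects, against sparsity.\<close>

lemma card_bad_ear_sub:
  assumes X: "X \<subseteq> bad_ear" and cX: "card X \<le> 6 * (card T + card Y) + 1"
    and b: "1 \<le> card T + card Y"
  shows "card X \<le> 6 * (card T + card Y)"
proof -
  have "\<forall>e\<in>X. \<exists>p f w u. p \<in> Y \<and> p \<in> inc e \<and> f \<in> E \<and> f \<noteq> e \<and> w \<in> inc f \<and> w \<in> inc e \<and>
      w \<notin> shadow inc T \<and> u \<in> inc f \<and> u \<in> shadow inc T"
    using X unfolding bad_ear_def by blast
  then obtain p f w u0 where pf: "\<And>e. e \<in> X \<Longrightarrow> p e \<in> Y \<and> p e \<in> inc e \<and> f e \<in> E \<and> f e \<noteq> e \<and> w e \<in> inc (f e) \<and>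
      w e \<in> inc e \<and> w e \<notin> shadow inc T \<and> u0 e \<in> inc (f e) \<and> u0 e \<in> shadow inc T"
    by metis
  \<comment> \<open>Return hyperedges that belong to \<open>X\<close> are counted there, and several
    members of \<open>X\<close> may share one.\<close>
  define F where "F = f ` X - X"
  have "\<forall>g\<in>F. \<exists>u. u \<in> inc g \<and> u \<in> shadow inc T" unfolding F_def using pf by blast
  then obtain u where u: "\<And>g. g \<in> F \<Longrightarrow> u g \<in> inc g \<and> u g \<in> shadow inc T" by metis
  have "\<forall>v\<in>shadow inc T. \<exists>t\<in>T. v \<in> inc t" by (auto simp: shadow_def)
  then obtain t where t: "\<And>v. v \<in> shadow inc T \<Longrightarrow> t v \<in> T \<and> v \<in> inc (t v)" by metis
  have XE: "X \<subseteq> E" "X \<inter> T = {}" using X unfolding bad_ear_def by auto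
  have fX: "finite X" using XE(1) finE finite_subset by blast
  have fF: "finite F" unfolding F_def using fX by auto
  have FT: "F \<inter> T = {}"
  proof -
    have "f e \<notin> T" if "e \<in> X" for e using pf[OF that] inc_subset_shadow[of "f e" T inc] by blast
    then show ?thesis unfolding F_def by auto
  qed
  have FE: "F \<subseteq> E" unfolding F_def using pf by auto
  have FX: "F \<inter> X = {}" unfolding F_def by auto
  define Q where "Q = u ` F - Y"
  define V where "V = w ` X"
  have fQ: "finite Q" and fV: "finite V" unfolding Q_def V_def using fF fX by auto
  have QT: "Q \<subseteq> shadow inc T" unfolding Q_def using u by auto
  have VT: "V \<inter> shadow inc T = {}" unfolding V_def using pf by auto
  have cQ: "card Q \<le> card F"
  proof -
    have "card Q \<le> card (u ` F)" unfolding Q_def by (rule card_mono) (use fF in auto)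
    then show ?thesis using card_image_le[OF fF, of u] by linarith
  qed
  have cF: "card F \<le> card X"
  proof -
    have "card F \<le> card (f ` X)" unfolding F_def by (rule card_mono) (use fX in auto)
    then show ?thesis using card_image_le[OF fX, of f] by linarith
  qed
  have cV: "card V \<le> card X" unfolding V_def by (rule card_image_le[OF fX])
  define I where "I = (\<lambda>e. (e, w e)) ` X \<union> (\<lambda>e. (f e, w e)) ` X"
  have fI: "finite I" unfolding I_def using fX by auto
  \<comment> \<open>Two lower bounds for the incidences at the new vertices \<open>V\<close>: every
    member of \<open>X\<close> and of \<open>F\<close> has one, and every vertex of \<open>V\<close>
    lies on two different hyperedges.\<close>
  have I1: "card X + card F \<le> card I"
  proof -
    have "X \<union> F \<subseteq> fst ` I" unfolding I_def F_def by force
    then have "card (X \<union> F) \<le> card I" using surj_card_le[OF fI] by blast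
    moreover have "card (X \<union> F) = card X + card F" by (rule card_Un_disjoint) (use fX fF FX in auto)
    ultimately show ?thesis by simp
  qed
  have I2: "2 * card V \<le> card I"
  proof -
    define h where "h v = (SOME e. e \<in> X \<and> w e = v)" for v
    have h: "h v \<in> X \<and> w (h v) = v" if "v \<in> V" for v
      unfolding h_def by (rule someI_ex) (use that in \<open>auto simp: V_def\<close>)
    let ?A = "(\<lambda>v. (h v, v)) ` V" and ?B = "(\<lambda>v. (f (h v), v)) ` V"
    have "card (?A \<union> ?B) = card ?A + card ?B"
    proof (rule card_Un_disjoint)
      show "finite ?A" "finite ?B" using fV by auto
      show "?A \<inter> ?B = {}"
      proof (rule equals0I)
        fix z assume "z \<in> ?A \<inter> ?B"
        then obtain v where v: "v \<in> V" "f (h v) = h v" by auto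
        then show False using h[OF v(1)] pf[of "h v"] by simp
      qed
    qed
    moreover have "card ?A = card V" "card ?B = card V" by (auto intro!: card_image inj_onI)
    moreover have "?A \<union> ?B \<subseteq> I"
    proof -
      have "?A \<subseteq> I" unfolding I_def using h by force
      moreover have "?B \<subseteq> I" unfolding I_def using h by force
      ultimately show ?thesis by (intro Un_least)
    qed
    ultimately show ?thesis using card_mono[OF fI, of "?A \<union> ?B"] by simp
  qed
  let ?P1 = "(\<lambda>e. (e, p e)) ` X" and ?P2 = "(\<lambda>g. (g, u g)) ` F" and ?P3 = "(\<lambda>v. (t v, v)) ` Q"
  have c: "card ?P1 = card X" "card ?P2 = card F" "card ?P3 = card Q"
    by (auto intro!: card_image inj_onI)
  have Qt: "\<And>v. v \<in> Q \<Longrightarrow> t v \<in> T \<and> v \<in> inc (t v)" using QT t by blast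
  have d1: "?P1 \<inter> ?P2 = {}" using FX by auto
  have d2: "(?P1 \<union> ?P2) \<inter> ?P3 = {}" using Qt XE(2) FT by auto
  have d3: "(?P1 \<union> ?P2 \<union> ?P3) \<inter> I = {}"
  proof -
    have 1: "snd z \<in> shadow inc T" if "z \<in> ?P1 \<union> ?P2 \<union> ?P3" for z
      using that
    proof (elim UnE)
      assume "z \<in> ?P1"
      then obtain e where "e \<in> X" "z = (e, p e)" by blast
      then show ?thesis using pf[of e] YT by auto
    next
      assume "z \<in> ?P2"
      then show ?thesis using u by auto
    next
      assume "z \<in> ?P3"
      then show ?thesis using QT by auto
    qed
    have 2: "snd z \<in> V" if "z \<in> I" for z
      using that unfolding I_def V_def by auto
    show ?thesis
    proof (rule equals0I)
      fix z assume "z \<in> (?P1 \<union> ?P2 \<union> ?P3) \<inter> I"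
      then have "snd z \<in> shadow inc T" "snd z \<in> V" using 1 2 by blast+
      then show False using VT by blast
    qed
  qed
  have "card (?P1 \<union> ?P2 \<union> ?P3 \<union> I) = card (?P1 \<union> ?P2 \<union> ?P3) + card I"
    by (rule card_Un_disjoint) (use fX fF fQ fI d3 in auto)
  also have "card (?P1 \<union> ?P2 \<union> ?P3) = card (?P1 \<union> ?P2) + card ?P3"
    by (rule card_Un_disjoint) (use fX fF fQ d2 in auto)
  also have "card (?P1 \<union> ?P2) = card ?P1 + card ?P2" by (rule card_Un_disjoint) (use fX fF d1 in auto)
  finally have cP: "card (?P1 \<union> ?P2 \<union> ?P3 \<union> I) = card X + card F + card Q + card I" using c by simp
  let ?XE = "T \<union> X \<union> F" and ?XV = "Y \<union> Q \<union> V"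
  let ?R = "{(e, v). e \<in> ?XE \<and> v \<in> ?XV \<and> v \<in> inc e}"
  have "card (?P1 \<union> ?P2 \<union> ?P3 \<union> I) \<le> incid inc ?XE ?XV"
  proof (rule incid_ge)
    show "finite ?XE" "finite ?XV" using finT fX fF finY fQ fV by auto
    have "?P1 \<subseteq> ?R" using pf by auto
    moreover have "?P2 \<subseteq> ?R" using u by (auto simp: Q_def)
    moreover have "?P3 \<subseteq> ?R" using Qt by auto
    moreover have "I \<subseteq> ?R" using pf by (auto simp: I_def F_def V_def)
    ultimately show "?P1 \<union> ?P2 \<union> ?P3 \<union> I \<subseteq> ?R" by (intro Un_least)
  qed
  moreover have cE: "card ?XE = card T + card X + card F"
  proof -
    have "card ?XE = card (T \<union> X) + card F" by (rule card_Un_disjoint) (use finT fX fF FT FX in auto)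
    moreover have "card (T \<union> X) = card T + card X" by (rule card_Un_disjoint) (use finT fX XE in auto)
    ultimately show ?thesis by simp
  qed
  moreover have cVV: "card ?XV = card Y + card Q + card V"
  proof -
    have "card ?XV = card (Y \<union> Q) + card V" by (rule card_Un_disjoint) (use finY fQ fV VT YT QT in auto)
    moreover have "card (Y \<union> Q) = card Y + card Q" by (rule card_Un_disjoint) (use finY fQ in \<open>auto simp: Q_def\<close>)
    ultimately show ?thesis by simp
  qed
  moreover have "5 * incid inc ?XE ?XV \<le> 6 * (card ?XE + card ?XV)"
  proof (rule sparse)
    show "?XE \<subseteq> E" using TE XE FE by simp
    show "finite ?XV" using finY fQ fV by simp
    show "card ?XE + card ?XV \<le> m0"
      unfolding cE cVV using cQ cF cV cX b size unfolding add_mult_distrib2 by linarith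
  qed
  \<comment> \<open>Write b for \<open>card T + card Y\<close>. Weighting the two bounds gives 5|I|
    >= 2(|X| + |F|) + 6|V|, and sparsity becomes |X| + |F| <= 6b + |Q| <= 6b + |F|. The objects
    involved number at most b + 4|X|, with |X| <= 6b + 1, which is the source of the factor 29 in
    \<open>size\<close>.\<close>
  ultimately show ?thesis using cP I1 I2 cQ unfolding add_mult_distrib2 by linarith
qed

lemma card_not_clean:
  "card {e \<in> E - T. \<exists>p\<in>Y. p \<in> inc e \<and> \<not> clean E inc T p e} \<le> 8 * (card T + card Y)"
proof (cases "card T + card Y = 0")
  case True
  then have "Y = {}" using finY by auto
  then show ?thesis by simp
next
  case False
  then have b: "1 \<le> card T + card Y" by linarith
  have 1: "card bad_direct \<le> 2 * (card T + card Y)"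
  proof (rule ccontr)
    assume "\<not> ?thesis"
    then have "2 * (card T + card Y) + 1 \<le> card bad_direct" by simp
    then obtain X where "X \<subseteq> bad_direct" "card X = 2 * (card T + card Y) + 1"
      by (rule obtain_subset_with_card_n)
    then show False using card_bad_direct_sub[of X] b by simp
  qed
  have 2: "card bad_ear \<le> 6 * (card T + card Y)"
  proof (rule ccontr)
    assume "\<not> ?thesis"
    then have "6 * (card T + card Y) + 1 \<le> card bad_ear" by simp
    then obtain X where "X \<subseteq> bad_ear" "card X = 6 * (card T + card Y) + 1"
      by (rule obtain_subset_with_card_n)
    then show False using card_bad_ear_sub[of X] b by simp
  qed
  have sub: "{e \<in> E - T. \<exists>p\<in>Y. p \<in> inc e \<and> \<not> clean E inc T p e} \<subseteq> bad_direct \<union> bad_ear"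
    unfolding bad_direct_def bad_ear_def clean_def by blast
  have "finite (bad_direct \<union> bad_ear)"
    by (rule finite_subset[OF _ finE]) (auto simp: bad_direct_def bad_ear_def)
  then have "card {e \<in> E - T. \<exists>p\<in>Y. p \<in> inc e \<and> \<not> clean E inc T p e} \<le> card (bad_direct \<union> bad_ear)"
    using sub by (rule card_mono)
  also have "\<dots> \<le> card bad_direct + card bad_ear" by (rule card_Un_le)
  finally show ?thesis using 1 2 by simp
qed

end

text \<open>Expansion against sparsity: \<open>X\<close> touches 600 hyperedges of \<open>S\<close>
  per vertex, of which at most 8 per object are unclean and at most \<open>card T\<close> are
  already used. The far end \<open>w\<close> is always new, so extensions grow trees and never close
  a cycle.\<close>

lemma clean_extension:
  assumes TE: "T \<subseteq> E" and XT: "X \<subseteq> shadow inc T" and XW: "X \<subseteq> W"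
    and size: "29 * (card T + card X) \<le> m0" and few: "8 * (card T + card X) + card T < 600 * card X"
  obtains e p w where "e \<in> S" "en e = {p, w}" "p \<in> X" "w \<in> W" "w \<in> inc e" "w \<notin> shadow inc T" "clean E inc T p e"
proof -
  let ?A = "{e \<in> S. en e \<inter> X \<noteq> {}}"
  let ?B = "{e \<in> E - T. \<exists>p\<in>X. p \<in> inc e \<and> \<not> clean E inc T p e}"
  have fT: "finite T" using TE finE finite_subset by blast
  have "card (?B \<union> T) \<le> card ?B + card T" by (rule card_Un_le)
  also have "\<dots> < 600 * card X" using card_not_clean[OF TE XT size] few by simp
  also have "\<dots> \<le> card ?A" by (rule touch[OF XW])
  finally have lt: "card (?B \<union> T) < card ?A" .
  have "\<not> ?A \<subseteq> ?B \<union> T"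
  proof
    assume sub: "?A \<subseteq> ?B \<union> T"
    have "finite (?B \<union> T)" using finE fT by simp
    from card_mono[OF this sub] lt show False by linarith
  qed
  then obtain e where e: "e \<in> S" "en e \<inter> X \<noteq> {}" "e \<notin> T" "e \<notin> ?B" by blast
  obtain p where p: "p \<in> en e" "p \<in> X" using e by blast
  obtain w where w: "en e = {p, w}" "w \<noteq> p" using ends_of[OF e(1) p(1)] .
  have pi: "p \<in> inc e" "w \<in> inc e" "w \<in> W" using en[OF e(1)] w by auto
  have "e \<in> E" using e(1) SE by blast
  then have cl: "clean E inc T p e" using e(3,4) p(2) pi(1) by blast
  then have "w \<notin> shadow inc T" using pi w unfolding clean_def by blast
  then show thesis by (rule that[OF e(1) w(1) p(2) pi(3,2) _ cl])
qed

end

context expanding_colour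
begin

section \<open>Depth-first search for a long tidy path\<close>

definition dead :: "'v set \<Rightarrow> 'e set \<Rightarrow> bool" where
  "dead D T \<longleftrightarrow> (\<forall>v\<in>D. \<forall>e\<in>S. v \<in> en e \<longrightarrow> \<not> clean E inc T v e)"

text \<open>Otherwise \<open>clean_extension\<close> would leave from a vertex of \<open>D\<close>.
  So the vertices abandoned by the search are few compared with the hyperedges it has used.\<close>

lemma dead_small:
  assumes "T \<subseteq> E" "D \<subseteq> W" "D \<subseteq> shadow inc T" "dead D T" "29 * (card T + card D) \<le> m0"
  shows "600 * card D \<le> 8 * (card T + card D) + card T"
proof (rule ccontr)
  assume "\<not> ?thesis"
  then have few: "8 * (card T + card D) + card T < 600 * card D" by simp
  obtain e p w where "e \<in> S" "en e = {p, w}" "p \<in> D" "clean E inc T p e"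
    using clean_extension[OF assms(1,3,2,5) few] by metis
  then show False using assms(4) unfolding dead_def by blast
qed

text \<open>A stage of depth-first search: \<open>T\<close> are all hyperedges used so far, \<open>D\<close> the vertices that the
  search has left, and \<open>vs\<close>, \<open>es\<close> the current path.\<close>

definition dfs_state :: "'e set \<Rightarrow> 'v set \<Rightarrow> 'v list \<Rightarrow> 'e list \<Rightarrow> bool" where
  "dfs_state T D vs es \<longleftrightarrow> T \<subseteq> E \<and> tidy E inc T \<and> D \<subseteq> W \<and> D \<subseteq> shadow inc T \<and>
     set vs \<subseteq> W \<and> set vs \<subseteq> shadow inc T \<and> D \<inter> set vs = {} \<and> walk en vs es \<and> distinct vs \<and>
     set es \<subseteq> T \<inter> S \<and> dead D T \<and> card T + 1 \<le> card D + length vs"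

text \<open>Every step, forward or backward, raises \<open>2 * card D + length vs\<close> by exactly
  one, since a backward step moves a vertex from the path to \<open>D\<close>; this quantity is the
  clock of the search. The last clause of \<open>dfs_state\<close> records that each hyperedge of
  \<open>T\<close> brought one vertex that is now on the path or in \<open>D\<close>. Dead vertices
  stay dead because cleanness is lost only as \<open>T\<close> grows.\<close>

lemma dfs_step:
  assumes st: "dfs_state T D vs es" and len: "length es < l" and D: "card D \<le> l"
    and l: "87 * l \<le> m0" "1 \<le> l"
  shows "\<exists>T' D' vs' es'. dfs_state T' D' vs' es' \<and>
     2 * card D' + length vs' = Suc (2 * card D + length vs) \<and> length es' \<le> l \<and> card D' \<le> l"
proof -
  have TE: "T \<subseteq> E" and td: "tidy E inc T" and DW: "D \<subseteq> W" and DT: "D \<subseteq> shadow inc T"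
    and vW: "set vs \<subseteq> W" and vT: "set vs \<subseteq> shadow inc T" and disj: "D \<inter> set vs = {}"
    and w: "walk en vs es" and dv: "distinct vs" and es: "set es \<subseteq> T \<inter> S" and dd: "dead D T"
    and cT: "card T + 1 \<le> card D + length vs"
    using st unfolding dfs_state_def by auto
  have lv: "length vs = Suc (length es)" by (rule walk_length[OF w])
  have fT: "finite T" and fD: "finite D" using TE finE DW finW finite_subset by blast+
  have cT2: "card T + card D \<le> 3 * l" using cT lv len D unfolding add_mult_distrib2 by linarith
  define v where "v = last vs"
  have v: "v \<in> set vs" unfolding v_def using lv by (metis last_in_set list.size(3) nat.distinct(1))
  \<comment> \<open>If \<open>D\<close> had \<open>l\<close> elements, \<open>T\<close> would have
    at most \<open>2 * l\<close>, too few to make \<open>l\<close> vertices dead.\<close>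
  have Dl: "card D < l"
  proof (rule ccontr)
    assume "\<not> ?thesis"
    then have "card D = l" using D by simp
    moreover have "600 * card D \<le> 8 * (card T + card D) + card T"
      by (rule dead_small[OF TE DW DT dd]) (use cT2 l in simp)
    ultimately show False using cT2 l unfolding add_mult_distrib2 by linarith
  qed
  show ?thesis
  proof (cases "\<exists>e\<in>S. v \<in> en e \<and> clean E inc T v e")
    case True
    then obtain e where e: "e \<in> S" "v \<in> en e" "clean E inc T v e" by blast
    obtain u where u: "en e = {v, u}" "u \<noteq> v" using ends_of[OF e(1,2)] .
    have uu: "u \<in> inc e" "u \<in> W" using en[OF e(1)] u by auto
    have uT: "u \<notin> shadow inc T" using e(3) uu(1) u(2) unfolding clean_def by blast
    have eT: "e \<notin> T" "e \<in> E" using e(3) unfolding clean_def by auto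
    have dd': "dead D (insert e T)"
      using dd clean_antimono[of E inc "insert e T" _ _ T] unfolding dead_def by blast
    have "dfs_state (insert e T) D (vs @ [u]) (es @ [e])"
      unfolding dfs_state_def
    proof (intro conjI)
      show "tidy E inc (insert e T)" by (rule tidy_insert[OF linear td TE e(3)])
      show "walk en (vs @ [u]) (es @ [e])" by (rule walk_snoc[OF w]) (use u v_def in simp)
      show "D \<inter> set (vs @ [u]) = {}" using disj uT DT by auto
      show "distinct (vs @ [u])" using dv uT vT by auto
      show "card (insert e T) + 1 \<le> card D + length (vs @ [u])" using cT eT fT by simp
      show "dead D (insert e T)" by (rule dd')
    qed (use TE eT DW DT vW vT uu es e in auto)
    then show ?thesis
      by (intro exI[of _ "insert e T"] exI[of _ D] exI[of _ "vs @ [u]"] exI[of _ "es @ [e]"])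
        (use len D in auto)
  next
    case False
    have dd': "dead (insert v D) T" using dd False unfolding dead_def by blast
    have vD: "v \<notin> D" using v disj by auto
    have cD: "card (insert v D) = Suc (card D)" using vD fD by simp
    have sub: "insert v D \<subseteq> W" "insert v D \<subseteq> shadow inc T" using v vW vT DW DT by auto
    \<comment> \<open>The root is never abandoned: with a one-vertex path, \<open>T\<close> has at
      most \<open>card D\<close> hyperedges, too few to make \<open>card D + 1\<close> vertices
      dead.\<close>
    have ne: "es \<noteq> []"
    proof
      assume "es = []"
      then have cT': "card T \<le> card D" using cT lv by simp
      have "600 * card (insert v D) \<le> 8 * (card T + card (insert v D)) + card T"
        by (rule dead_small[OF TE sub dd']) (use cT' cD Dl l in simp)
      then show False using cT' cD unfolding add_mult_distrib2 by linarith
    qed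
    have vs: "vs = butlast vs @ [v]" unfolding v_def using lv
      by (metis append_butlast_last_id list.size(3) nat.distinct(1))
    have vb: "v \<notin> set (butlast vs)" using dv by (subst (asm) vs) simp
    have w': "walk en (butlast vs) (butlast es)"
    proof -
      obtain m where m: "length es = Suc m" using ne by (cases es) auto
      have "walk en (take (Suc m) vs) (take m es)" by (rule walk_take[OF w]) (use m in simp)
      then show ?thesis using lv m by (simp add: butlast_conv_take)
    qed
    have sb: "set (butlast vs) \<subseteq> set vs" "set (butlast es) \<subseteq> set es"
      by (auto dest: in_set_butlastD)
    have "dfs_state T (insert v D) (butlast vs) (butlast es)"
      unfolding dfs_state_def
    proof (intro conjI)
      show "insert v D \<inter> set (butlast vs) = {}" using vb sb disj by auto
      show "card T + 1 \<le> card (insert v D) + length (butlast vs)" using cT cD lv by simp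
      show "distinct (butlast vs)" using dv by (rule distinct_butlast)
    qed (use TE td sub vW vT sb w' es dd' in auto)
    then show ?thesis
      by (intro exI[of _ T] exI[of _ "insert v D"] exI[of _ "butlast vs"] exI[of _ "butlast es"])
        (use len Dl cD lv in auto)
  qed
qed

lemma long_tidy_path:
  assumes l: "87 * l \<le> m0" "1 \<le> l"
  obtains T vs es where "T \<subseteq> E" "tidy E inc T" "card T \<le> 2 * l" "walk en vs es" "distinct vs"
    "length es = l" "set es \<subseteq> T \<inter> S" "set vs \<subseteq> W" "set vs \<subseteq> shadow inc T"
proof -
  define found where "found \<longleftrightarrow> (\<exists>T vs es. T \<subseteq> E \<and> tidy E inc T \<and> card T \<le> 2 * l \<and> walk en vs es \<and> distinct vs \<and>
    length es = l \<and> set es \<subseteq> T \<inter> S \<and> set vs \<subseteq> W \<and> set vs \<subseteq> shadow inc T)"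
  have "found \<or> (\<exists>T D vs es. dfs_state T D vs es \<and> 2 * card D + length vs = s + 2 \<and> length es \<le> l \<and> card D \<le> l)" for s
  proof (induction s)
    case 0
    obtain e where e: "e \<in> S" using S_nonempty by blast
    obtain a b where ab: "en e = {a, b}" "a \<noteq> b" using en(2)[OF e] by (auto simp: card_2_iff)
    have "dfs_state {e} {} [a, b] [e]"
      unfolding dfs_state_def using tidy_singleton[OF linear, of e] SE e ab en(1,3)[OF e]
      by (auto simp: dead_def)
    then show ?case using l by (intro disjI2 exI[of _ "{e}"] exI[of _ "{}"] exI[of _ "[a, b]"] exI[of _ "[e]"]) auto
  next
    case (Suc s)
    show ?case
    proof (cases found)
      case False
      then obtain T D vs es where st: "dfs_state T D vs es" "2 * card D + length vs = s + 2" "length es \<le> l" "card D \<le> l"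
        using Suc by blast
      have "length es \<noteq> l"
      proof
        assume eq: "length es = l"
        have lv: "length vs = Suc l" using st(1) walk_length eq unfolding dfs_state_def by metis
        have "card T \<le> 2 * l" using st(1,4) lv unfolding dfs_state_def unfolding add_mult_distrib2 by linarith
        then have found unfolding found_def using st(1) eq unfolding dfs_state_def
          by (intro exI[of _ T] exI[of _ vs] exI[of _ es]) auto
        then show False using False by simp
      qed
      then have "length es < l" using st(3) by simp
      from dfs_step[OF st(1) this st(4) l] show ?thesis using st(2) by auto
    qed auto
  qed
  \<comment> \<open>At this time the clock shows \<open>4 * l + 2\<close>, while an unsuccessful
    search has \<open>card D \<le> l\<close> and at most \<open>l + 1\<close> vertices on the path,
    hence at most \<open>3 * l + 1\<close>.\<close>
  from this[of "4 * l"] have found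
  proof
    assume "\<exists>T D vs es. dfs_state T D vs es \<and> 2 * card D + length vs = 4 * l + 2 \<and> length es \<le> l \<and> card D \<le> l"
    then obtain T D vs es where st: "dfs_state T D vs es" "2 * card D + length vs = 4 * l + 2" "length es \<le> l" "card D \<le> l"
      by blast
    have "length vs = Suc (length es)" using st(1) walk_length unfolding dfs_state_def by metis
    then show found using st l unfolding add_mult_distrib2 by linarith
  qed
  then show thesis unfolding found_def using that by blast
qed

section \<open>Trees grown from the two ends of the path\<close>

lemma grow_level:
  assumes TE: "T \<subseteq> E" and td: "tidy E inc T" and XW: "X \<subseteq> W" and XT: "X \<subseteq> shadow inc T"
    and size: "29 * (card T + j + card X) \<le> m0" and few: "8 * (card T + j + card X) + (card T + j) < 600 * card X"
  shows "\<exists>T' Y. T \<subseteq> T' \<and> T' \<subseteq> E \<and> tidy E inc T' \<and> card T' = card T + j \<and> Y \<subseteq> W \<and> Y \<subseteq> shadow inc T' \<and>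
    card Y = j \<and> finite Y \<and> Y \<inter> shadow inc T = {} \<and> (\<forall>w\<in>Y. \<exists>p\<in>X. \<exists>e\<in>T' \<inter> S. en e = {p, w})"
  using size few
proof (induction j)
  case 0
  then show ?case using TE td by (intro exI[of _ T] exI[of _ "{}"]) auto
next
  case (Suc j)
  have "29 * (card T + j + card X) \<le> m0" "8 * (card T + j + card X) + (card T + j) < 600 * card X"
    using Suc.prems by auto
  from Suc.IH[OF this] obtain T' Y where IH: "T \<subseteq> T'" "T' \<subseteq> E" "tidy E inc T'" "card T' = card T + j" "Y \<subseteq> W"
    "Y \<subseteq> shadow inc T'" "card Y = j" "finite Y" "Y \<inter> shadow inc T = {}" "\<forall>w\<in>Y. \<exists>p\<in>X. \<exists>e\<in>T' \<inter> S. en e = {p, w}"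
    by blast
  have fT': "finite T'" using IH(2) finE finite_subset by blast
  have sh: "shadow inc T \<subseteq> shadow inc T'" by (rule shadow_mono[OF IH(1)])
  obtain e p w where e: "e \<in> S" "en e = {p, w}" "p \<in> X" "w \<in> W" "w \<in> inc e" "w \<notin> shadow inc T'" "clean E inc T' p e"
    by (rule clean_extension[of T' X]) (use IH XW XT sh Suc.prems in auto)
  have eT: "e \<notin> T'" "e \<in> E" using e(7) unfolding clean_def by auto
  show ?case
  proof (intro exI[of _ "insert e T'"] exI[of _ "insert w Y"] conjI)
    show "tidy E inc (insert e T')" by (rule tidy_insert[OF linear IH(3,2) e(7)])
    show "card (insert e T') = card T + Suc j" using IH(4) eT fT' by simp
    show "card (insert w Y) = Suc j" using IH(6,7,8) e(6) by (subst card_insert_disjoint) auto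
    show "\<forall>w\<in>insert w Y. \<exists>p\<in>X. \<exists>e\<in>insert e T' \<inter> S. en e = {p, w}" using IH(10) e by blast
  qed (use IH e eT sh in auto)
qed

text \<open>A branch may meet \<open>P\<close> only in its first vertex, so it leaves the long path
  at once; it stays inside \<open>A\<close>, so branches of disjoint trees are disjoint.\<close>

definition spread :: "'e set \<Rightarrow> 'v set \<Rightarrow> 'v set \<Rightarrow> 'v set \<Rightarrow> nat \<Rightarrow> bool" where
  "spread T A0 P A i \<longleftrightarrow> (\<forall>x\<in>A. \<exists>vs es. walk en vs es \<and> distinct vs \<and> hd vs \<in> A0 \<and> last vs = x \<and>
     set vs \<subseteq> A \<and> set (tl vs) \<inter> P = {} \<and> set es \<subseteq> T \<inter> S \<and> length es \<le> i)"

lemma spread_mono: "spread T A0 P A i \<Longrightarrow> T \<subseteq> T' \<Longrightarrow> i \<le> i' \<Longrightarrow> spread T' A0 P A i'"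
  unfolding spread_def by (meson Int_mono dual_order.trans order_refl)

lemma spread_base: "spread T A0 P A0 0"
  unfolding spread_def
proof
  fix x assume "x \<in> A0"
  then show "\<exists>vs es. walk en vs es \<and> distinct vs \<and> hd vs \<in> A0 \<and> last vs = x \<and>
     set vs \<subseteq> A0 \<and> set (tl vs) \<inter> P = {} \<and> set es \<subseteq> T \<inter> S \<and> length es \<le> 0"
    by (intro exI[of _ "[x]"] exI[of _ "[]"]) auto
qed

lemma spread_step:
  assumes sp: "spread T A0 P A i" and TT: "T \<subseteq> T'" and Y: "Y \<inter> P = {}" "Y \<inter> A = {}"
    and att: "\<forall>w\<in>Y. \<exists>p\<in>A. \<exists>e\<in>T' \<inter> S. en e = {p, w}"
  shows "spread T' A0 P (A \<union> Y) (Suc i)"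
  unfolding spread_def
proof
  fix x assume x: "x \<in> A \<union> Y"
  show "\<exists>vs es. walk en vs es \<and> distinct vs \<and> hd vs \<in> A0 \<and> last vs = x \<and>
     set vs \<subseteq> A \<union> Y \<and> set (tl vs) \<inter> P = {} \<and> set es \<subseteq> T' \<inter> S \<and> length es \<le> Suc i"
  proof (cases "x \<in> A")
    case True
    then obtain vs es where "walk en vs es" "distinct vs" "hd vs \<in> A0" "last vs = x"
      "set vs \<subseteq> A" "set (tl vs) \<inter> P = {}" "set es \<subseteq> T \<inter> S" "length es \<le> i"
      using sp unfolding spread_def by blast
    then show ?thesis using TT by (intro exI[of _ vs] exI[of _ es]) auto
  next
    case False
    then have xY: "x \<in> Y" using x by auto
    obtain p e where pe: "p \<in> A" "e \<in> T' \<inter> S" "en e = {p, x}" using att xY by blast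
    obtain vs es where v: "walk en vs es" "distinct vs" "hd vs \<in> A0" "last vs = p"
      "set vs \<subseteq> A" "set (tl vs) \<inter> P = {}" "set es \<subseteq> T \<inter> S" "length es \<le> i"
      using sp pe(1) unfolding spread_def by blast
    have ne: "vs \<noteq> []" by (rule walk_nonempty[OF v(1)])
    have xv: "x \<notin> set vs" using v(5) Y(2) xY by auto
    show ?thesis
    proof (intro exI[of _ "vs @ [x]"] exI[of _ "es @ [e]"] conjI)
      show "walk en (vs @ [x]) (es @ [e])" by (rule walk_snoc[OF v(1)]) (use v(4) pe(3) in simp)
      show "distinct (vs @ [x])" using v(2) xv by auto
      show "hd (vs @ [x]) \<in> A0" using v(3) ne by simp
      show "set (vs @ [x]) \<subseteq> A \<union> Y" using v(5) xY by auto
      show "set (tl (vs @ [x])) \<inter> P = {}" using v(6) ne Y(1) xY by auto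
      show "set (es @ [e]) \<subseteq> T' \<inter> S" using v(7) TT pe(2) by auto
    qed (use v in auto)
  qed
qed

text \<open>Each round attaches \<open>x0\<close> new vertices to either tree. After
  \<open>c1 - 1\<close> rounds both have the \<open>c1 * x0\<close> vertices at which
  \<open>cut\<close> becomes applicable, and branches are shorter than \<open>c1\<close>. Such slow
  growth is affordable since \<open>c1\<close> will not depend on \<open>n\<close>.\<close>

lemma grow_two_sides:
  assumes TE: "T \<subseteq> E" and td: "tidy E inc T" and cT: "card T \<le> 40 * x0"
    and PW: "P \<subseteq> W" and PT: "P \<subseteq> shadow inc T"
    and A0: "A0 \<subseteq> P" "card A0 = x0" and B0: "B0 \<subseteq> P" "card B0 = x0" and AB: "A0 \<inter> B0 = {}"
  shows "Suc i \<le> c1 \<Longrightarrow> \<exists>T' A B. T \<subseteq> T' \<and> T' \<subseteq> E \<and> tidy E inc T' \<and> card T' \<le> 40 * x0 + 2 * (i * x0) \<and>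
     A \<subseteq> W \<and> A \<subseteq> shadow inc T' \<and> B \<subseteq> W \<and> B \<subseteq> shadow inc T' \<and> A \<inter> B = {} \<and> A \<inter> P = A0 \<and> B \<inter> P = B0 \<and>
     card A = i * x0 + x0 \<and> card B = i * x0 + x0 \<and> spread T' A0 P A i \<and> spread T' B0 P B i"
proof (induction i)
  case 0
  show ?case
    by (intro exI[of _ T] exI[of _ A0] exI[of _ B0]) (use assms spread_base in auto)
next
  case (Suc i)
  have "Suc i \<le> c1" using Suc.prems by simp
  from Suc.IH[OF this] obtain T1 A B where IH: "T \<subseteq> T1" "T1 \<subseteq> E" "tidy E inc T1" "card T1 \<le> 40 * x0 + 2 * (i * x0)"
     "A \<subseteq> W" "A \<subseteq> shadow inc T1" "B \<subseteq> W" "B \<subseteq> shadow inc T1" "A \<inter> B = {}" "A \<inter> P = A0" "B \<inter> P = B0"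
     "card A = i * x0 + x0" "card B = i * x0 + x0" "spread T1 A0 P A i" "spread T1 B0 P B i"
    by blast
  have "(i + 2) * x0 \<le> c1 * x0" using Suc.prems by (intro mult_right_mono) auto
  then have q: "i * x0 + 2 * x0 \<le> c1 * x0" by (simp add: add_mult_distrib)
  have finA: "finite A" "finite B" using IH finW finite_subset by blast+
  have s1: "29 * (card T1 + x0 + card A) \<le> m0" using IH(4,12) q m0_ge unfolding add_mult_distrib2 by linarith
  have f1: "8 * (card T1 + x0 + card A) + (card T1 + x0) < 600 * card A" using IH(4,12) x0_ge unfolding add_mult_distrib2 by linarith
  from grow_level[OF IH(2,3,5,6) s1 f1] obtain T2 Y where Y: "T1 \<subseteq> T2" "T2 \<subseteq> E" "tidy E inc T2" "card T2 = card T1 + x0"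
    "Y \<subseteq> W" "Y \<subseteq> shadow inc T2" "card Y = x0" "finite Y" "Y \<inter> shadow inc T1 = {}"
    "\<forall>w\<in>Y. \<exists>p\<in>A. \<exists>e\<in>T2 \<inter> S. en e = {p, w}"
    by blast
  have sh0: "shadow inc T \<subseteq> shadow inc T1" by (rule shadow_mono[OF IH(1)])
  have sh1: "shadow inc T1 \<subseteq> shadow inc T2" by (rule shadow_mono[OF Y(1)])
  have BT2: "B \<subseteq> shadow inc T2" using IH(8) sh1 by blast
  have s2: "29 * (card T2 + x0 + card B) \<le> m0" using IH(4,13) Y(4) q m0_ge unfolding add_mult_distrib2 by linarith
  have f2: "8 * (card T2 + x0 + card B) + (card T2 + x0) < 600 * card B" using IH(4,13) Y(4) x0_ge unfolding add_mult_distrib2 by linarith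
  from grow_level[OF Y(2,3) IH(7) BT2 s2 f2] obtain T3 Z where Z: "T2 \<subseteq> T3" "T3 \<subseteq> E" "tidy E inc T3" "card T3 = card T2 + x0"
    "Z \<subseteq> W" "Z \<subseteq> shadow inc T3" "card Z = x0" "finite Z" "Z \<inter> shadow inc T2 = {}"
    "\<forall>w\<in>Z. \<exists>p\<in>B. \<exists>e\<in>T3 \<inter> S. en e = {p, w}"
    by blast
  have sh2: "shadow inc T2 \<subseteq> shadow inc T3" by (rule shadow_mono[OF Z(1)])
  have YP: "Y \<inter> P = {}" "Y \<inter> A = {}" "Y \<inter> B = {}" using Y(9) PT sh0 IH(6,8) by blast+
  have ZP: "Z \<inter> P = {}" "Z \<inter> A = {}" "Z \<inter> B = {}" "Z \<inter> Y = {}"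
    using Z(9) PT sh0 sh1 IH(6,8) Y(6) by blast+
  show ?case
  proof (rule exI[of _ T3], rule exI[of _ "A \<union> Y"], rule exI[of _ "B \<union> Z"], intro conjI)
    show "card T3 \<le> 40 * x0 + 2 * (Suc i * x0)" using IH(4) Y(4) Z(4) by simp
    show "card (A \<union> Y) = Suc i * x0 + x0"
      using card_Un_disjoint[OF finA(1) Y(8)] YP IH(12) Y(7) by (simp add: Int_commute)
    show "card (B \<union> Z) = Suc i * x0 + x0"
      using card_Un_disjoint[OF finA(2) Z(8)] ZP IH(13) Z(7) by (simp add: Int_commute)
    show "spread T3 A0 P (A \<union> Y) (Suc i)"
      by (rule spread_mono[OF spread_step[OF IH(14) Y(1) YP(1,2) Y(10)] Z(1)]) simp
    show "spread T3 B0 P (B \<union> Z) (Suc i)"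
      by (rule spread_step[OF IH(15) _ ZP(1,3) Z(10)]) (use Y Z in blast)
    show "T \<subseteq> T3" using IH(1) Y(1) Z(1) by blast
    show "(A \<union> Y) \<inter> (B \<union> Z) = {}" using IH(9) YP ZP by blast
    show "(A \<union> Y) \<inter> P = A0" using IH(10) YP by blast
    show "(B \<union> Z) \<inter> P = B0" using IH(11) ZP by blast
    show "A \<union> Y \<subseteq> shadow inc T3" using IH(6) Y(6) sh1 sh2 by blast
    show "B \<union> Z \<subseteq> shadow inc T3" using IH(8) Z(6) sh1 sh2 by blast
  qed (use IH Y Z in auto)
qed

end

section \<open>A short connecting path away from the long path\<close>

context expanding_colour
begin

lemma card_meeting:
  assumes "finite Y"
  shows "card {e \<in> E. inc e \<inter> Y \<noteq> {}} \<le> \<Delta> * card Y"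
proof -
  have "{e \<in> E. inc e \<inter> Y \<noteq> {}} = (\<Union>v\<in>Y. {e \<in> E. v \<in> inc e})" by auto
  then have "card {e \<in> E. inc e \<inter> Y \<noteq> {}} \<le> (\<Sum>v\<in>Y. card {e \<in> E. v \<in> inc e})"
    using card_UN_le[OF assms] by simp
  also have "\<dots> \<le> (\<Sum>v\<in>Y. \<Delta>)" by (rule sum_mono) (rule deg)
  finally show ?thesis by (simp add: mult.commute)
qed

lemma finite_shadow: "T \<subseteq> E \<Longrightarrow> finite (shadow inc T)"
  unfolding shadow_def using finE fin_inc finite_subset by blast

lemma card_shadow:
  assumes "T \<subseteq> E"
  shows "card (shadow inc T) \<le> r * card T"
proof -
  have fT: "finite T" using assms finE finite_subset by blast
  have "card (shadow inc T) \<le> (\<Sum>e\<in>T. card (inc e))" unfolding shadow_def by (rule card_UN_le[OF fT])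
  also have "\<dots> \<le> (\<Sum>e\<in>T. r)" by (rule sum_mono) (use card_inc assms in auto)
  finally show ?thesis by (simp add: mult.commute)
qed

primrec ball :: "'e set \<Rightarrow> 'v set \<Rightarrow> nat \<Rightarrow> 'v set" where
  "ball N A 0 = A"
| "ball N A (Suc i) = ball N A i \<union> {w. \<exists>e\<in>S - N. \<exists>p\<in>ball N A i. en e = {p, w}}"

lemma ball_subset_W: "A \<subseteq> W \<Longrightarrow> ball N A i \<subseteq> W"
proof (induction i)
  case (Suc i)
  then show ?case using en(3) by fastforce
qed auto

lemma ball_mono: "A \<subseteq> ball N A i"
  by (induction i) auto

lemma spread_ball: "spread (S - N) A A (ball N A i) i"
proof (induction i)
  case 0
  then show ?case using spread_base by simp
next
  case (Suc i)
  let ?Y = "{w. \<exists>e\<in>S - N. \<exists>p\<in>ball N A i. en e = {p, w}} - ball N A i"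
  have "spread (S - N) A A (ball N A i \<union> ?Y) (Suc i)"
    by (rule spread_step[OF Suc order_refl]) (use ball_mono in blast)+
  moreover have "ball N A (Suc i) = ball N A i \<union> ?Y" by auto
  ultimately show ?case by simp
qed

text \<open>While the ball misses \<open>B\<close>, both it and its complement have at least
  \<open>c1 * x0\<close> vertices, so \<open>cut\<close> applies. Crossing hyperedges outside
  \<open>N\<close> end in new vertices, at most \<open>\<Delta>\<close> in the same one; by
  \<open>c1_large\<close> at least \<open>\<Delta> * x0\<close> of them remain, which gives
  \<open>x0\<close> new vertices.\<close>

lemma ball_grows:
  assumes A: "A \<subseteq> W" "c1 * x0 \<le> card A" and B: "B \<subseteq> W" "c1 * x0 \<le> card B"
    and N: "N \<subseteq> E" "card N \<le> \<Delta> * r * (\<Delta> * r * (20 * x0))"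
  shows "ball N A i \<inter> B = {} \<Longrightarrow> card A + i * x0 \<le> card (ball N A i)"
proof (induction i)
  case (Suc i)
  have disj: "ball N A i \<inter> B = {}" using Suc.prems by auto
  note IH = Suc.IH[OF disj]
  have XW: "ball N A i \<subseteq> W" "ball N A (Suc i) \<subseteq> W" by (rule ball_subset_W[OF A(1)])+
  have fX: "finite (ball N A (Suc i))" "finite (ball N A i)" using XW finW finite_subset by blast+
  define X where "X = ball N A i"
  define New where "New = ball N A (Suc i) - X"
  define C where "C = {e \<in> S. en e \<inter> X \<noteq> {} \<and> en e \<inter> (W - X) \<noteq> {}}"
  have "card B \<le> card (W - X)" by (rule card_mono) (use finW B disj in \<open>auto simp: X_def\<close>)
  then have c1: "600 * (c1 * x0) \<le> card C" unfolding C_def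
    by (intro cut) (use XW A B IH in \<open>auto simp: X_def\<close>)
  have sub: "C \<subseteq> N \<union> {e \<in> E. inc e \<inter> New \<noteq> {}}"
  proof
    fix e assume e: "e \<in> C"
    then have eS: "e \<in> S" unfolding C_def by simp
    obtain p where p: "p \<in> en e" "p \<in> X" using e unfolding C_def by blast
    obtain w where w: "en e = {p, w}" using ends_of[OF eS p(1)] by metis
    have wX: "w \<notin> X" using e w p unfolding C_def by auto
    show "e \<in> N \<union> {e \<in> E. inc e \<inter> New \<noteq> {}}"
    proof (cases "e \<in> N")
      case False
      have "w \<in> ball N A (Suc i)" using eS False w p(2) by (auto simp: X_def)
      then have "w \<in> New" using wX New_def by simp
      moreover have "w \<in> inc e" using en(1)[OF eS] w by auto
      ultimately show ?thesis using eS SE by auto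
    qed simp
  qed
  have fN: "finite N" "finite New" using N(1) finE finite_subset fX by (auto simp: New_def)
  have "card C \<le> card (N \<union> {e \<in> E. inc e \<inter> New \<noteq> {}})"
    by (rule card_mono[OF _ sub]) (use fN finE in auto)
  also have "\<dots> \<le> card N + card {e \<in> E. inc e \<inter> New \<noteq> {}}" by (rule card_Un_le)
  also have "\<dots> \<le> card N + \<Delta> * card New" using card_meeting[OF fN(2)] by simp
  finally have "\<Delta> * x0 \<le> \<Delta> * card New" using c1 c1_large N(2) by linarith
  moreover have "0 < \<Delta>"
  proof -
    obtain e where e: "e \<in> S" using S_nonempty by blast
    then obtain v where v: "v \<in> en e" using en(2)[OF e] by fastforce
    have "e \<in> {e \<in> E. v \<in> inc e}" using e SE v en(1)[OF e] by auto
    then have "0 < card {e \<in> E. v \<in> inc e}" using finE by (auto simp: card_gt_0_iff)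
    then show ?thesis using deg[of v] by linarith
  qed
  ultimately have "x0 \<le> card New" by simp
  moreover have "card (ball N A (Suc i)) = card X + card New"
  proof -
    have "ball N A (Suc i) = X \<union> New" unfolding New_def X_def by auto
    moreover have "card (X \<union> New) = card X + card New"
      by (rule card_Un_disjoint) (use fX in \<open>auto simp: X_def New_def\<close>)
    ultimately show ?thesis by simp
  qed
  ultimately show ?case using IH by (simp add: X_def)
qed simp

text \<open>\<open>W\<close> has room for \<open>\<Lambda>\<close> rounds of growth only, so the
  ball reaches \<open>B\<close> by then. Taking the least radius of contact keeps the path off
  \<open>B\<close> before its end.\<close>

lemma free_path:
  assumes A: "A \<subseteq> W" "c1 * x0 \<le> card A" and B: "B \<subseteq> W" "c1 * x0 \<le> card B" and AB: "A \<inter> B = {}"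
    and N: "N \<subseteq> E" "card N \<le> \<Delta> * r * (\<Delta> * r * (20 * x0))"
  obtains vs es where "walk en vs es" "distinct vs" "hd vs \<in> A" "last vs \<in> B" "set (tl vs) \<inter> A = {}"
    "set (butlast vs) \<inter> B = {}" "set es \<subseteq> S - N" "length es \<le> \<Lambda>" "es \<noteq> []"
proof -
  have "\<exists>i\<le>\<Lambda>. ball N A i \<inter> B \<noteq> {}"
  proof (rule ccontr)
    assume "\<not> ?thesis"
    then have "ball N A \<Lambda> \<inter> B = {}" by auto
    then have "card A + \<Lambda> * x0 \<le> card (ball N A \<Lambda>)" by (rule ball_grows[OF A B N])
    also have "\<dots> \<le> card W" by (rule card_mono[OF finW ball_subset_W[OF A(1)]])
    also have "\<dots> \<le> \<Lambda> * x0" by (rule cardW)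
    finally have "card A = 0" by simp
    then show False using A(2) c1_ge x0_ge by simp
  qed
  then obtain i where i: "i \<le> \<Lambda>" "ball N A i \<inter> B \<noteq> {}" by blast
  define m where "m = (LEAST i. ball N A i \<inter> B \<noteq> {})"
  have m: "ball N A m \<inter> B \<noteq> {}" unfolding m_def using i(2) by (rule LeastI)
  have mi: "m \<le> \<Lambda>" using Least_le[of "\<lambda>i. ball N A i \<inter> B \<noteq> {}", OF i(2)] i(1) unfolding m_def by linarith
  have "m \<noteq> 0" using m AB by (cases m) auto
  then obtain j where j: "m = Suc j" by (cases m) auto
  have jB: "ball N A j \<inter> B = {}" using not_less_Least[of j "\<lambda>i. ball N A i \<inter> B \<noteq> {}"] j m_def by auto
  obtain x where x: "x \<in> ball N A (Suc j)" "x \<in> B" using m j by blast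
  then have xj: "x \<notin> ball N A j" using jB by blast
  then obtain e p where e: "e \<in> S - N" "p \<in> ball N A j" "en e = {p, x}" using x(1) by auto
  obtain vs es where v: "walk en vs es" "distinct vs" "hd vs \<in> A" "last vs = p"
      "set vs \<subseteq> ball N A j" "set (tl vs) \<inter> A = {}" "set es \<subseteq> (S - N) \<inter> S" "length es \<le> j"
    using spread_ball[of N A j] e(2) unfolding spread_def by blast
  have ne: "vs \<noteq> []" by (rule walk_nonempty[OF v(1)])
  have xA: "x \<notin> A" using x(2) AB by auto
  show thesis
  proof (rule that[of "vs @ [x]" "es @ [e]"])
    show "walk en (vs @ [x]) (es @ [e])" by (rule walk_snoc[OF v(1)]) (use e v in simp)
    show "distinct (vs @ [x])" using v(2,5) xj by auto
    show "hd (vs @ [x]) \<in> A" using ne v by simp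
    show "set (tl (vs @ [x])) \<inter> A = {}" using ne v(6) xA by simp
    show "set (butlast (vs @ [x])) \<inter> B = {}" using v(5) jB by auto
    show "set (es @ [e]) \<subseteq> S - N" using v(7) e(1) by auto
    show "length (es @ [e]) \<le> \<Lambda>" using v(8) mi j by simp
  qed (use x in auto)
qed

end

section \<open>Closing the path to a loose cycle\<close>

lemma distinct_butlast_closed:
  assumes "distinct (tl xs)" "hd xs = last xs" "length xs \<ge> 2"
  shows "distinct (butlast xs)"
proof -
  obtain a ys where xs: "xs = a # ys" "ys \<noteq> []" using assms(3) by (cases xs) (auto simp: neq_Nil_conv Suc_le_length_iff)
  have "last ys = a" using assms(2) xs by simp
  then have "ys = butlast ys @ [a]" using xs(2) by (metis append_butlast_last_id)
  then have "distinct (butlast ys @ [a])" using assms(1) xs(1) by simp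
  then show ?thesis using xs by simp
qed

text \<open>The last clause ranges over all of \<open>E\<close>, that is over hyperedges of every
  colour: this makes the cycle induced in the host and not merely in its colour class.\<close>

definition loose_cycle :: "'e set \<Rightarrow> ('e \<Rightarrow> 'v set) \<Rightarrow> ('e \<Rightarrow> 'v set) \<Rightarrow> 'v list \<Rightarrow> 'e list \<Rightarrow> bool" where
  "loose_cycle E inc en vs es \<longleftrightarrow> length vs = length es \<and> distinct vs \<and> distinct es \<and> set es \<subseteq> E \<and>
     (\<forall>i<length es. en (es ! i) = {vs ! i, vs ! (Suc i mod length es)}) \<and>
     (\<forall>e\<in>set es. \<forall>e'\<in>set es. e \<noteq> e' \<longrightarrow> inc e \<inter> inc e' \<subseteq> en e \<inter> en e') \<and>
     (\<forall>f\<in>E - set es. meets_once inc f (set es))"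

context expanding_colour
begin

text \<open>The cycle is made of a piece \<open>eM\<close> of the long path, a branch at each end
  (\<open>ea\<close>, \<open>eb\<close>) and the free path \<open>eF\<close>. Only \<open>eF\<close>
  is not built by clean extensions. It compensates by being short, so that \<open>short\<close>
  governs it together with the branches, and by avoiding \<open>N2\<close>, so that no hyperedge
  meets both it and the long path.\<close>

theorem long_loose_cycle:
  obtains vs es where "loose_cycle E inc en vs es" "set es \<subseteq> S" "18 * x0 \<le> length es" "length es \<le> 20 * x0 + R"
proof -
  \<comment> \<open>The branches leave the path within its first and its last \<open>x0\<close>
    vertices, so at least \<open>18 * x0\<close> of these hyperedges survive in the cycle.\<close>
  define l where "l = 20 * x0"
  have "x0 * 1 \<le> x0 * c1" by (rule mult_left_mono) (use c1_ge in auto)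
  then have x0c: "x0 \<le> c1 * x0" by (simp add: mult.commute)
  have l: "87 * l \<le> m0" "1 \<le> l" using m0_ge x0c x0_ge unfolding l_def by linarith+
  obtain T vs es where T: "T \<subseteq> E" "tidy E inc T" "card T \<le> 2 * l" and w: "walk en vs es" "distinct vs"
    "length es = l" "set es \<subseteq> T \<inter> S" "set vs \<subseteq> W" "set vs \<subseteq> shadow inc T"
    using long_tidy_path[OF l] by metis
  define P where "P = set vs"
  define A0 where "A0 = set (take x0 vs)"
  define B0 where "B0 = set (drop (Suc l - x0) vs)"
  have lv: "length vs = Suc l" using walk_length[OF w(1)] w(3) by simp
  have "card A0 = length (take x0 vs)" unfolding A0_def by (rule distinct_card) (use w(2) in simp)
  then have cA0: "card A0 = x0" using lv l_def by simp
  have "card B0 = length (drop (Suc l - x0) vs)" unfolding B0_def by (rule distinct_card) (use w(2) in simp)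
  then have cB0: "card B0 = x0" using lv l_def by simp
  have AB0: "A0 \<inter> B0 = {}" unfolding A0_def B0_def
    by (rule set_take_disj_set_drop_if_distinct[OF w(2)]) (use l_def in simp)
  have PW: "P \<subseteq> W" "P \<subseteq> shadow inc T" using w P_def by auto
  have sub0: "A0 \<subseteq> P" "B0 \<subseteq> P" unfolding A0_def B0_def P_def by (auto dest: in_set_takeD in_set_dropD)
  have cT: "card T \<le> 40 * x0" using T(3) l_def by simp
  obtain c where c: "c1 = Suc c" using c1_ge by (cases c1) auto
  from grow_two_sides[OF T(1,2) cT PW sub0(1) cA0 sub0(2) cB0 AB0, of c]
  obtain T' A B where g: "T \<subseteq> T'" "T' \<subseteq> E" "tidy E inc T'" "A \<subseteq> W" "A \<subseteq> shadow inc T'" "B \<subseteq> W" "B \<subseteq> shadow inc T'"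
     "A \<inter> B = {}" "A \<inter> P = A0" "B \<inter> P = B0" "card A = c * x0 + x0" "card B = c * x0 + x0"
     "spread T' A0 P A c" "spread T' B0 P B c"
    using c by auto
  define N1 where "N1 = {e \<in> E. inc e \<inter> shadow inc (set es) \<noteq> {}}"
  \<comment> \<open>Avoiding \<open>N1\<close> would only make the free path disjoint from the long
    one; avoiding \<open>N2\<close> also excludes a third hyperedge that touches both.\<close>
  define N2 where "N2 = {e \<in> E. inc e \<inter> shadow inc N1 \<noteq> {}}"
  have esE: "set es \<subseteq> E" using w(4) T(1) by auto
  have N12: "N1 \<subseteq> N2"
  proof
    fix e assume e: "e \<in> N1"
    then have "inc e \<subseteq> shadow inc N1" by (rule inc_subset_shadow)
    moreover have "inc e \<noteq> {}" "e \<in> E" using e unfolding N1_def by auto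
    ultimately show "e \<in> N2" unfolding N2_def by auto
  qed
  have N1E: "N1 \<subseteq> E" "N2 \<subseteq> E" unfolding N1_def N2_def by auto
  have "card N1 \<le> \<Delta> * card (shadow inc (set es))" unfolding N1_def by (rule card_meeting[OF finite_shadow[OF esE]])
  also have "\<dots> \<le> \<Delta> * (r * card (set es))" by (intro mult_left_mono card_shadow esE) simp
  also have "\<dots> \<le> \<Delta> * (r * (20 * x0))" using card_length[of es] w(3) l_def by (intro mult_left_mono) auto
  finally have cN1: "card N1 \<le> \<Delta> * r * (20 * x0)" by (simp add: mult.assoc)
  have "card N2 \<le> \<Delta> * card (shadow inc N1)" unfolding N2_def by (rule card_meeting[OF finite_shadow[OF N1E(1)]])
  also have "\<dots> \<le> \<Delta> * (r * card N1)" by (intro mult_left_mono card_shadow N1E) simp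
  also have "\<dots> \<le> \<Delta> * (r * (\<Delta> * r * (20 * x0)))" using cN1 by (intro mult_left_mono) auto
  finally have cN2: "card N2 \<le> \<Delta> * r * (\<Delta> * r * (20 * x0))" by (simp add: mult.assoc)
  have cAB: "c1 * x0 \<le> card A" "c1 * x0 \<le> card B" using g(11,12) c by auto
  obtain vF eF where F: "walk en vF eF" "distinct vF" "hd vF \<in> A" "last vF \<in> B" "set (tl vF) \<inter> A = {}"
    "set (butlast vF) \<inter> B = {}" "set eF \<subseteq> S - N2" "length eF \<le> \<Lambda>" "eF \<noteq> []"
    using free_path[OF g(4) cAB(1) g(6) cAB(2) g(8) N1E(2) cN2] by metis
  obtain va ea where a: "walk en va ea" "distinct va" "hd va \<in> A0" "last va = hd vF" "set va \<subseteq> A"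
    "set (tl va) \<inter> P = {}" "set ea \<subseteq> T' \<inter> S" "length ea \<le> c"
    using g(13) F(3) unfolding spread_def by blast
  obtain vb eb where b: "walk en vb eb" "distinct vb" "hd vb \<in> B0" "last vb = last vF" "set vb \<subseteq> B"
    "set (tl vb) \<inter> P = {}" "set eb \<subseteq> T' \<inter> S" "length eb \<le> c"
    using g(14) F(4) unfolding spread_def by blast
  obtain i where i: "i < x0" "hd va = vs ! i" using a(3) unfolding A0_def
    by (auto simp: in_set_conv_nth)
  obtain j0 where j0: "j0 < length (drop (Suc l - x0) vs)" "hd vb = drop (Suc l - x0) vs ! j0"
    using b(3) unfolding B0_def by (metis in_set_conv_nth)
  define j where "j = Suc l - x0 + j0"
  have j: "Suc l - x0 \<le> j" "j \<le> l" "hd vb = vs ! j" using j0 lv l_def unfolding j_def by auto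
  have ij: "i < j" "18 * x0 \<le> j - i" "j - i \<le> l" using i j l_def by auto
  define vM where "vM = take (Suc (j - i)) (drop i vs)"
  define eM where "eM = take (j - i) (drop i es)"
  have M: "walk en vM eM" unfolding vM_def eM_def
    by (rule walk_take[OF walk_drop[OF w(1)]]) (use w(3) j ij in auto)
  have dM: "distinct vM" unfolding vM_def using w(2) by simp
  have lM: "length eM = j - i" unfolding eM_def using w(3) j by simp
  have lvM: "length vM = Suc (j - i)" using walk_length[OF M] lM by simp
  have hM: "hd vM = hd va" unfolding vM_def i(2) using lv j ij
    by (subst hd_conv_nth) auto
  have tM: "last vM = hd vb"
  proof -
    have "last vM = vM ! (j - i)" using lvM by (subst last_conv_nth) auto
    also have "\<dots> = vs ! j" unfolding vM_def using ij j lv by simp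
    finally show ?thesis using j by simp
  qed
  have MP: "set vM \<subseteq> P" unfolding vM_def P_def by (auto dest: in_set_takeD in_set_dropD)
  have eMes: "set eM \<subseteq> set es" unfolding eM_def by (auto dest: in_set_takeD in_set_dropD)
  have ltl: "length (tl vM) = j - i" "length (tl vF) = length eF"
    using lvM walk_length[OF F(1)] by simp_all
  have "tl vM \<noteq> []" using ltl(1) ij(1) by (cases "tl vM") simp_all
  moreover have "tl vF \<noteq> []" using ltl(2) F(9) by (cases "tl vF") simp_all
  ultimately have ne: "va \<noteq> []" "vb \<noteq> []" "vM \<noteq> []" "vF \<noteq> []" "tl vM \<noteq> []" "tl vF \<noteq> []"
    using walk_nonempty[OF a(1)] walk_nonempty[OF b(1)] walk_nonempty[OF M] walk_nonempty[OF F(1)]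
    by blast+
  obtain v0 va' where va: "va = v0 # va'" using ne(1) by (cases va) auto
  obtain v1 vb' where vb: "vb = v1 # vb'" using ne(2) by (cases vb) auto
  obtain vM' where vM: "vM = v0 # vM'" using ne(3) hM va by (cases vM) auto
  obtain x vF' where vF: "vF = x # vF'" using ne(4) by (cases vF) auto
  have vM'ne: "vM' \<noteq> []" "vF' \<noteq> []" using ne vM vF by auto
  have lM': "last vM' = v1" using tM vM vM'ne vb by simp
  have P0: "v0 \<in> P" "v1 \<in> P" using a(3) b(3) sub0 va vb by auto
  have vsshadow: "P \<subseteq> shadow inc (set es)" unfolding P_def
  proof (rule walk_verts_subset_shadow[OF w(1)])
    show "en e \<subseteq> inc e" if "e \<in> set es" for e by (rule en(1)) (use that w(4) in auto)
    show "es \<noteq> []" using w(3) l(2) by auto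
  qed
  have farF: "inc e \<inter> shadow inc (set es) = {}" if "e \<in> set eF" for e
  proof -
    have "e \<in> E" "e \<notin> N1" using that F(7) SE N12 by auto
    then show ?thesis unfolding N1_def by auto
  qed
  have FP: "set vF \<inter> P = {}"
  proof (rule equals0I)
    fix y assume y: "y \<in> set vF \<inter> P"
    have "set vF \<subseteq> shadow inc (set eF)"
    proof (rule walk_verts_subset_shadow[OF F(1)])
      show "en e \<subseteq> inc e" if "e \<in> set eF" for e by (rule en(1)) (use that F(7) in auto)
    qed (rule F(9))
    then obtain q where q: "q \<in> set eF" "y \<in> inc q" using y unfolding shadow_def by blast
    then show False using farF[OF q(1)] vsshadow y by blast
  qed
  have xP: "x \<notin> P" "last vF \<notin> P" using FP vF last_in_set[OF ne(4)] by (simp, blast)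
  have va'ne: "va' \<noteq> []" using a(4) va vF xP(1) P0 by (cases va') auto
  have vb'ne: "vb' \<noteq> []" using b(4) vb xP(2) P0 by (cases vb') auto

  text \<open>Any two hyperedges of the cycle lie on the tidy path \<open>S1\<close>, on the short path \<open>S2\<close>, or are
    a hyperedge of the long path and one of the free path, which are far apart.\<close>
  define S1 where "S1 = set ea \<union> set eM \<union> set eb"
  define S2 where "S2 = set ea \<union> set eF \<union> set eb"
  have S1T: "S1 \<subseteq> T'" unfolding S1_def using a b eMes w(4) g(1) by auto
  have S1S: "S1 \<subseteq> S" "S2 \<subseteq> S" unfolding S1_def S2_def using a b eMes w(4) F by auto
  have walk1: "walk en ((rev va @ vM') @ vb') ((rev ea @ eM) @ eb)"
  proof -
    have "walk en (rev va @ tl vM) (rev ea @ eM)"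
      by (rule walk_append[OF walk_rev[OF a(1)] M]) (use va vM in simp)
    then have 1: "walk en (rev va @ vM') (rev ea @ eM)" using vM by simp
    have "walk en ((rev va @ vM') @ tl vb) ((rev ea @ eM) @ eb)"
      by (rule walk_append[OF 1 b(1)]) (use lM' vM'ne vb in simp)
    then show ?thesis using vb by simp
  qed
  have dist1: "distinct ((rev va @ vM') @ vb')"
  proof -
    have "set va \<inter> set vM' = {}" using a(6) va vM MP dM by auto
    moreover have "set va \<inter> set vb' = {}" using a(5) b(5) g(8) vb by auto
    moreover have "set vM' \<inter> set vb' = {}" using b(6) vb MP vM by auto
    ultimately show ?thesis using a(2) b(2) dM vM vb by auto
  qed
  have set1: "set ((rev ea @ eM) @ eb) = S1" unfolding S1_def by auto
  have walk2: "walk en ((va @ vF') @ tl (rev vb)) ((ea @ eF) @ rev eb)"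
  proof -
    have "walk en (va @ tl vF) (ea @ eF)"
      by (rule walk_append[OF a(1) F(1)]) (use a(4) in simp)
    then have 1: "walk en (va @ vF') (ea @ eF)" using vF by simp
    show ?thesis
      by (rule walk_append[OF 1 walk_rev[OF b(1)]]) (use b(4) vF vM'ne in \<open>simp add: hd_rev\<close>)
  qed
  have bl: "vb = butlast vb @ [last vF]" using b(4) ne(2) by (metis append_butlast_last_id)
  have tlrev: "tl (rev vb) = rev (butlast vb)" by (subst bl) simp
  have lFb: "last vF \<notin> set (butlast vb)" using b(2) by (subst (asm) bl) simp
  have bF: "vF = butlast vF @ [last vF]" using ne(4) by simp
  have sF: "set vF = insert (last vF) (set (butlast vF))" by (subst bF) simp
  have lFn: "last vF \<notin> set (butlast vF)" using F(2) by (subst (asm) bF) simp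
  have dist2: "distinct ((va @ vF') @ tl (rev vb))"
  proof -
    have "set va \<inter> set vF' = {}" using a(5) F(5) vF by auto
    moreover have "set va \<inter> set (butlast vb) = {}" using a(5) b(5) g(8) by (auto dest: in_set_butlastD)
    moreover have "set vF' \<inter> set (butlast vb) = {}"
    proof (rule equals0I)
      fix z assume z: "z \<in> set vF' \<inter> set (butlast vb)"
      then have "z \<in> set vF" "z \<in> B" "z \<noteq> last vF" using vF b(5) lFb by (auto dest: in_set_butlastD simp del: last.simps)
      then show False using sF F(6) by blast
    qed
    ultimately show ?thesis using a(2) F(2) b(2) vF tlrev by (auto simp: distinct_butlast)
  qed
  have set2: "set ((ea @ eF) @ rev eb) = S2" unfolding S2_def by auto
  have enI: "\<And>e. e \<in> S1 \<Longrightarrow> en e \<subseteq> inc e" "\<And>e. e \<in> S2 \<Longrightarrow> en e \<subseteq> inc e"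
    using S1S by (metis en(1) subsetD)+
  have conn2: "conn inc S2"
    using walk_conn[OF walk2, of inc] enI(2) unfolding set2 by blast
  have card2: "card S2 \<le> R"
  proof -
    have "card S2 \<le> length ((ea @ eF) @ rev eb)" unfolding set2[symmetric] by (rule card_length)
    then show ?thesis using a(8) b(8) F(8) R_ge c by simp
  qed
  have conn1: "conn inc S1"
    using walk_conn[OF walk1, of inc] enI(1) unfolding set1 by blast
  have loose1: "inc e \<inter> inc e' \<subseteq> en e \<inter> en e'" if "e \<in> S1" "e' \<in> S1" "e \<noteq> e'" for e e'
  proof (rule path_loose[OF walk1 dist1])
    show "meets_once inc f K" if "K \<subseteq> set ((rev ea @ eM) @ eb)" "conn inc K" "f \<in> set ((rev ea @ eM) @ eb)" "f \<notin> K" for K f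
      by (rule tidyD[OF g(3) _ that(2) _ that(4)]) (use that set1 S1T g(2) in auto)
  qed (use that set1 enI(1) in blast)+
  have loose2: "inc e \<inter> inc e' \<subseteq> en e \<inter> en e'" if "e \<in> S2" "e' \<in> S2" "e \<noteq> e'" for e e'
  proof (rule path_loose[OF walk2 dist2])
    show "meets_once inc f K" if "K \<subseteq> set ((ea @ eF) @ rev eb)" "conn inc K" "f \<in> set ((ea @ eF) @ rev eb)" "f \<notin> K" for K f
    proof (rule short[OF that(2) _ _ _ that(4)])
      have "K \<subseteq> S2" using that set2 by simp
      then show "card K \<le> R" using card2 card_mono[of S2 K] set2 by (metis List.finite_set le_trans)
    qed (use that set2 S1S SE in auto)
  qed (use that set2 enI(2) in blast)+

  define wC where "wC = ((vM @ vb') @ tl (rev vF)) @ tl (rev va)"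
  define eC where "eC = ((eM @ eb) @ rev eF) @ rev ea"
  have walkC: "walk en wC eC"
  proof -
    have "walk en (vM @ tl vb) (eM @ eb)" by (rule walk_append[OF M b(1) tM])
    then have 1: "walk en (vM @ vb') (eM @ eb)" using vb by simp
    have 2: "walk en ((vM @ vb') @ tl (rev vF)) ((eM @ eb) @ rev eF)"
      by (rule walk_append[OF 1 walk_rev[OF F(1)]]) (use b(4) vb vb'ne in \<open>simp add: hd_rev\<close>)
    have "last (rev vF) = x" using vF by simp
    then have "last ((vM @ vb') @ tl (rev vF)) = x"
      using vF vM'ne by (metis hd_Cons_tl last_appendR last_tl list.sel(3) length_tl length_rev length_0_conv rev_is_Nil_conv list.size(3))
    then show ?thesis unfolding wC_def eC_def
      by (intro walk_append[OF 2 walk_rev[OF a(1)]]) (use a(4) vF in \<open>simp add: hd_rev\<close>)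
  qed
  have setC: "set eC = set eM \<union> set eb \<union> set eF \<union> set ea" unfolding eC_def by auto
  have tlF: "tl (rev vF) = rev (butlast vF)" by (subst bF) simp
  have bla: "va = butlast va @ [x]" using a(4) vF ne(1) by (metis append_butlast_last_id list.sel(1))
  have tla: "tl (rev va) = rev (butlast va)" by (subst bla) simp
  have xa: "x \<notin> set (butlast va)" using a(2) by (subst (asm) bla) simp
  have "tl wC = ((vM' @ vb') @ rev (butlast vF)) @ rev (butlast va)"
    unfolding wC_def tlF tla vM by simp
  moreover have "distinct (((vM' @ vb') @ rev (butlast vF)) @ rev (butlast va))"
  proof -
    have "set vM' \<inter> set vb' = {}" using b(6) vb MP vM by auto
    moreover have "set vM' \<inter> set (butlast vF) = {}" using FP MP vM by (auto dest: in_set_butlastD)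
    moreover have "set vb' \<inter> set (butlast vF) = {}" using F(6) b(5) vb by auto
    moreover have "set vM' \<inter> set (butlast va) = {}"
      using a(6) va vM MP dM by (auto dest: in_set_butlastD split: if_splits)
    moreover have "set vb' \<inter> set (butlast va) = {}" using a(5) b(5) g(8) vb by (auto dest: in_set_butlastD)
    moreover have "set (butlast vF) \<inter> set (butlast va) = {}"
    proof -
      have "set (butlast vF) \<subseteq> insert x (set (tl vF))" using vF by (auto dest: in_set_butlastD split: if_splits)
      then show ?thesis using F(5) a(5) xa by (auto dest: in_set_butlastD)
    qed
    ultimately show ?thesis using dM vM b(2) vb F(2) a(2) by (auto simp: distinct_butlast)
  qed
  ultimately have dtl: "distinct (tl wC)" by simp
  have closed: "hd wC = last wC"
  proof -
    have "rev (butlast va) \<noteq> []" using va va'ne by simp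
    then have "last wC = hd (butlast va)" unfolding wC_def tla by (simp add: last_rev)
    also have "\<dots> = v0" using va va'ne by simp
    finally show ?thesis unfolding wC_def using vM by simp
  qed
  define t where "t = length eC"
  have lwC: "length wC = Suc t" using walk_length[OF walkC] t_def by simp
  have tge: "18 * x0 \<le> t" unfolding t_def eC_def using lM ij by simp
  have tle: "t \<le> 20 * x0 + R" unfolding t_def eC_def using lM ij a(8) b(8) F(8) R_ge c l_def by simp
  define us where "us = butlast wC"
  have dus: "distinct us" unfolding us_def
    by (rule distinct_butlast_closed[OF dtl closed]) (use lwC tge x0_ge in simp)
  have lus: "length us = t" unfolding us_def using lwC by simp
  have usn: "us ! k = wC ! k" if "k < t" for k unfolding us_def using that lwC by (simp add: nth_butlast)
  have enC: "en (eC ! k) = {us ! k, us ! (Suc k mod t)}" if k: "k < t" for k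
  proof -
    have "en (eC ! k) = {wC ! k, wC ! Suc k}" by (rule walk_nth[OF walkC]) (use k t_def in simp)
    moreover have "wC ! Suc k = us ! (Suc k mod t)"
    proof (cases "Suc k = t")
      case True
      have "wC ! t = last wC" using lwC by (subst last_conv_nth) auto
      also have "\<dots> = wC ! 0" using closed lwC by (subst (asm) hd_conv_nth) auto
      finally show ?thesis using True k usn[of 0] by simp
    next
      case False
      then show ?thesis using k usn[of "Suc k"] by simp
    qed
    ultimately show ?thesis using usn[OF k] by simp
  qed
  have deC: "distinct eC"
  proof -
    have M_F: "set eM \<inter> set eF = {}"
    proof (rule equals0I)
      fix e assume e: "e \<in> set eM \<inter> set eF"
      then have "inc e \<inter> shadow inc (set es) = {}" using farF by auto
      moreover have "inc e \<subseteq> shadow inc (set es)" using e eMes by (intro inc_subset_shadow) auto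
      moreover have "en e \<subseteq> inc e" "card (en e) = 2" using e F(7) en by auto
      ultimately have "en e = {}" by blast
      then show False using \<open>card (en e) = 2\<close> by simp
    qed
    have "distinct ((rev ea @ eM) @ eb)" by (rule path_distinct_edges[OF walk1 dist1])
    moreover have "distinct ((ea @ eF) @ rev eb)" by (rule path_distinct_edges[OF walk2 dist2])
    ultimately show ?thesis unfolding eC_def using M_F by auto
  qed
  have far: "inc e \<inter> inc e' = {}" if "e \<in> set eM" "e' \<in> set eF" for e e'
    using farF[OF that(2)] inc_subset_shadow[of e "set es" inc] eMes that(1) by blast
  have SC: "set eC \<subseteq> S" using setC S1S S1_def S2_def by auto
  have pair: "inc e \<inter> inc e' \<subseteq> en e \<inter> en e'" if e: "e \<in> set eC" "e' \<in> set eC" "e \<noteq> e'" for e e'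
  proof -
    consider "e \<in> S1 \<and> e' \<in> S1" | "e \<in> S2 \<and> e' \<in> S2" | "e \<in> set eM \<and> e' \<in> set eF" | "e \<in> set eF \<and> e' \<in> set eM"
      using e(1,2) unfolding setC S1_def S2_def by auto
    then show ?thesis
    proof cases
      case 1 then show ?thesis using loose1 e(3) by simp
    next
      case 2 then show ?thesis using loose2 e(3) by simp
    next
      case 3 then show ?thesis using far[of e e'] by simp
    next
      case 4 then show ?thesis using far[of e' e] by (simp add: Int_commute)
    qed
  qed
  \<comment> \<open>Two common vertices of \<open>f\<close> with the cycle lie both on
    \<open>S1\<close>, both on \<open>S2\<close>, or one on the middle piece and one on the free
    path; in the last case \<open>f\<close> is in \<open>N1\<close> and the free path would use a
    hyperedge of \<open>N2\<close>.\<close>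
  have out: "meets_once inc f (set eC)" if f: "f \<in> E" "f \<notin> set eC" for f
    unfolding meets_once_def
  proof (intro ballI)
    fix u w assume u: "u \<in> inc f \<inter> shadow inc (set eC)" and w: "w \<in> inc f \<inter> shadow inc (set eC)"
    have m1: "meets_once inc f S1"
      by (rule tidyD[OF g(3) S1T conn1 f(1)]) (use f(2) setC S1_def in auto)
    have m2: "meets_once inc f S2"
      by (rule short[OF conn2 _ card2 f(1)]) (use f(2) setC S2_def S1S SE in auto)
    have MF: False
      if y: "y \<in> inc f" "y \<in> shadow inc (set eM)" and zz: "z \<in> inc f" "z \<in> shadow inc (set eF)" for y z
    proof -
      have "y \<in> shadow inc (set es)" using y(2) shadow_mono[OF eMes, of inc] by blast
      then have "f \<in> N1" unfolding N1_def using y(1) f(1) by blast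
      then have z: "z \<in> shadow inc N1" using inc_subset_shadow[of f N1 inc] zz(1) by blast
      obtain q where q: "q \<in> set eF" "z \<in> inc q" using zz(2) by (auto simp: shadow_def)
      have "q \<in> E" using q(1) F(7) SE by blast
      then have "q \<in> N2" unfolding N2_def using z q(2) by blast
      then show False using q(1) F(7) by blast
    qed
    have sh: "shadow inc (set eC) = shadow inc (set eM) \<union> shadow inc (set eb) \<union> shadow inc (set eF) \<union> shadow inc (set ea)"
      unfolding setC by simp
    have sh1: "shadow inc S1 = shadow inc (set ea) \<union> shadow inc (set eM) \<union> shadow inc (set eb)" unfolding S1_def by simp
    have sh2: "shadow inc S2 = shadow inc (set ea) \<union> shadow inc (set eF) \<union> shadow inc (set eb)" unfolding S2_def by simp
    consider "u \<in> shadow inc S1 \<and> w \<in> shadow inc S1" | "u \<in> shadow inc S2 \<and> w \<in> shadow inc S2"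
      | "u \<in> shadow inc (set eM) \<and> w \<in> shadow inc (set eF)" | "w \<in> shadow inc (set eM) \<and> u \<in> shadow inc (set eF)"
      using u w unfolding sh sh1 sh2 by auto
    then show "u = w"
    proof cases
      case 1 then show ?thesis using meets_onceD[OF m1] u w by blast
    next
      case 2 then show ?thesis using meets_onceD[OF m2] u w by blast
    next
      case 3 then show ?thesis using MF[of u w] u w by auto
    next
      case 4 then show ?thesis using MF[of w u] u w by auto
    qed
  qed
  have "loose_cycle E inc en us eC"
    unfolding loose_cycle_def
  proof (intro conjI)
    show "\<forall>i<length eC. en (eC ! i) = {us ! i, us ! (Suc i mod length eC)}" using enC unfolding t_def by simp
    show "\<forall>e\<in>set eC. \<forall>e'\<in>set eC. e \<noteq> e' \<longrightarrow> inc e \<inter> inc e' \<subseteq> en e \<inter> en e'" using pair by blast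
    show "\<forall>f\<in>E - set eC. meets_once inc f (set eC)" using out by blast
  qed (use lus dus deC SC SE in \<open>auto simp: t_def\<close>)
  then show thesis by (rule that) (use SC tge tle in \<open>auto simp: t_def\<close>)
qed

end

section \<open>Expanding subgraphs of dense graphs\<close>

text \<open>A vertex set \<open>W\<close> that maximises the number of edges it spans, divided by \<open>|W| g(|W|)\<close>, induces
  an expander. The slowly growing factor \<open>g\<close> rules out sparse cuts.\<close>

lemma dense_expander:
  fixes S :: "'e set" and en :: "'e \<Rightarrow> 'v set" and \<rho> u :: real
  assumes fin: "finite S" "finite V" and V: "V \<noteq> {}" and en: "\<And>e. e \<in> S \<Longrightarrow> en e \<subseteq> V \<and> en e \<noteq> {}"
    and u: "u > 0" and \<rho>0: "0 \<le> \<rho>"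
    and dense: "\<rho> * (real (card V) * (1 + max 0 (log 2 (real (card V) / u)))) \<le> real (card S)"
  obtains W where "W \<subseteq> V" "W \<noteq> {}"
    "\<And>X. X \<subseteq> W \<Longrightarrow> \<rho> * real (card X) \<le> real (card {e \<in> S. en e \<subseteq> W \<and> en e \<inter> X \<noteq> {}})"
    "\<And>X. X \<subseteq> W \<Longrightarrow> u \<le> real (card X) \<Longrightarrow> u \<le> real (card (W - X)) \<Longrightarrow>
       \<rho> * u \<le> real (card {e \<in> S. en e \<subseteq> W \<and> en e \<inter> X \<noteq> {} \<and> en e \<inter> (W - X) \<noteq> {}})"
proof -
  define g where "g w = 1 + max 0 (log 2 (real w / u))" for w :: nat
  define \<phi> where "\<phi> X = real (card X) * g (card X)" for X :: "'v set"
  define ne where "ne X = real (card {e \<in> S. en e \<subseteq> X})" for X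
  have g1: "1 \<le> g w" for w unfolding g_def by simp
  have gmono: "g a \<le> g b" if "a \<le> b" for a b
  proof (cases "a = 0")
    case True
    then show ?thesis unfolding g_def by (simp add: log_def)
  next
    case False
    then have "log 2 (real a / u) \<le> log 2 (real b / u)"
      using u that by (simp add: divide_right_mono)
    then show ?thesis unfolding g_def by simp
  qed
  define P where "P = Pow V - {{}}"
  have finP: "finite P" "P \<noteq> {}" unfolding P_def using fin V by auto
  have "Max ((\<lambda>X. ne X / \<phi> X) ` P) \<in> (\<lambda>X. ne X / \<phi> X) ` P" by (rule Max_in) (use finP in auto)
  then obtain W where W: "W \<in> P" "ne W / \<phi> W = Max ((\<lambda>X. ne X / \<phi> X) ` P)" by auto
  have best: "ne X / \<phi> X \<le> ne W / \<phi> W" if "X \<in> P" for X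
    unfolding W(2) by (rule Max_ge) (use finP that in auto)
  define \<sigma> where "\<sigma> = ne W / \<phi> W"
  have finsub: "finite X" if "X \<subseteq> V" for X using that fin(2) finite_subset by blast
  have WV: "W \<subseteq> V" "W \<noteq> {}" using W(1) unfolding P_def by auto
  have pos: "0 < \<phi> X" if "X \<in> P" for X
  proof -
    have "0 < card X" using that finsub[of X] by (auto simp: card_gt_0_iff P_def)
    then show ?thesis unfolding \<phi>_def using g1[of "card X"] by simp
  qed
  have neV: "ne V = real (card S)"
  proof -
    have "{e \<in> S. en e \<subseteq> V} = S" using en by auto
    then show ?thesis unfolding ne_def by simp
  qed
  have VP: "V \<in> P" unfolding P_def using V by auto
  have "\<rho> * \<phi> V \<le> ne V" using dense unfolding \<phi>_def g_def neV .
  then have "\<rho> \<le> ne V / \<phi> V" using pos[OF VP] by (simp add: field_simps)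
  then have \<rho>\<sigma>: "\<rho> \<le> \<sigma>" using best[OF VP] unfolding \<sigma>_def by linarith
  then have \<sigma>0: "0 \<le> \<sigma>" using \<rho>0 by linarith
  have neW: "ne W = \<sigma> * \<phi> W" unfolding \<sigma>_def using pos[OF W(1)] by simp
  have up: "ne X \<le> \<sigma> * \<phi> X" if X: "X \<subseteq> V" for X
  proof (cases "X = {}")
    case True
    have none: "{e \<in> S. en e \<subseteq> {}} = {}" using en by auto
    show ?thesis unfolding True ne_def \<phi>_def none by simp
  next
    case False
    then have XP: "X \<in> P" using X unfolding P_def by auto
    then show ?thesis using best[OF XP] pos[OF XP] unfolding \<sigma>_def[symmetric] by (simp add: divide_le_eq)
  qed
  have cardX: "real (card (W - X)) = real (card W) - real (card X)" if "X \<subseteq> W" for X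
    using that finsub[OF WV(1)] by (simp add: card_Diff_subset card_mono finite_subset of_nat_diff)
  have le: "card X \<le> card W" if "X \<subseteq> W" for X using that finsub[OF WV(1)] by (rule card_mono[rotated])
  \<comment> \<open>By maximality \<open>W - X\<close> spans at most
    \<open>\<sigma> * \<phi> (W - X)\<close> edges, and since \<open>g\<close> is monotone and at
    least 1, \<open>\<phi>\<close> drops by at least \<open>card X\<close> when \<open>X\<close> is
    removed.\<close>
  have touch: "\<rho> * real (card X) \<le> real (card {e \<in> S. en e \<subseteq> W \<and> en e \<inter> X \<noteq> {}})" if X: "X \<subseteq> W" for X
  proof -
    have "{e \<in> S. en e \<subseteq> W} = {e \<in> S. en e \<subseteq> W - X} \<union> {e \<in> S. en e \<subseteq> W \<and> en e \<inter> X \<noteq> {}}" by auto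
    then have "ne W = real (card ({e \<in> S. en e \<subseteq> W - X} \<union> {e \<in> S. en e \<subseteq> W \<and> en e \<inter> X \<noteq> {}}))"
      unfolding ne_def by simp
    also have "\<dots> \<le> ne (W - X) + real (card {e \<in> S. en e \<subseteq> W \<and> en e \<inter> X \<noteq> {}})"
      unfolding ne_def using card_Un_le[of "{e \<in> S. en e \<subseteq> W - X}" "{e \<in> S. en e \<subseteq> W \<and> en e \<inter> X \<noteq> {}}"]
      by linarith
    finally have 1: "\<sigma> * \<phi> W - ne (W - X) \<le> real (card {e \<in> S. en e \<subseteq> W \<and> en e \<inter> X \<noteq> {}})"
      using neW by simp
    have "ne (W - X) \<le> \<sigma> * \<phi> (W - X)" by (rule up) (use WV in auto)
    also have "\<phi> (W - X) \<le> (real (card W) - real (card X)) * g (card W)"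
      unfolding \<phi>_def cardX[OF X] using le[OF X]
      by (intro mult_left_mono gmono le) auto
    finally have "ne (W - X) \<le> \<sigma> * ((real (card W) - real (card X)) * g (card W))"
      using \<sigma>0 by (simp add: mult_left_mono)
    also have "\<dots> = \<sigma> * \<phi> W - \<sigma> * (real (card X) * g (card W))" unfolding \<phi>_def by (simp add: algebra_simps)
    finally have 2: "\<sigma> * (real (card X) * g (card W)) \<le> \<sigma> * \<phi> W - ne (W - X)" by simp
    have "\<rho> * real (card X) \<le> \<sigma> * (real (card X) * 1)" using \<rho>\<sigma> by (simp add: mult_right_mono)
    also have "\<dots> \<le> \<sigma> * (real (card X) * g (card W))" using \<sigma>0 g1 by (intro mult_left_mono) auto
    finally show ?thesis using 1 2 by linarith
  qed
  have cut1: "\<rho> * u \<le> real (card {e \<in> S. en e \<subseteq> W \<and> en e \<inter> X \<noteq> {} \<and> en e \<inter> (W - X) \<noteq> {}})"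
    if X: "X \<subseteq> W" and uX: "u \<le> real (card X)" and small: "2 * real (card X) \<le> real (card W)" for X
  proof -
    let ?C = "{e \<in> S. en e \<subseteq> W \<and> en e \<inter> X \<noteq> {} \<and> en e \<inter> (W - X) \<noteq> {}}"
    have "{e \<in> S. en e \<subseteq> W} = ({e \<in> S. en e \<subseteq> X} \<union> {e \<in> S. en e \<subseteq> W - X}) \<union> ?C" using X by auto
    then have "ne W = real (card (({e \<in> S. en e \<subseteq> X} \<union> {e \<in> S. en e \<subseteq> W - X}) \<union> ?C))" unfolding ne_def by simp
    also have "\<dots> \<le> real (card ({e \<in> S. en e \<subseteq> X} \<union> {e \<in> S. en e \<subseteq> W - X})) + real (card ?C)"
      using card_Un_le[of "{e \<in> S. en e \<subseteq> X} \<union> {e \<in> S. en e \<subseteq> W - X}" ?C] by linarith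
    also have "\<dots> \<le> ne X + ne (W - X) + real (card ?C)"
      unfolding ne_def using card_Un_le[of "{e \<in> S. en e \<subseteq> X}" "{e \<in> S. en e \<subseteq> W - X}"] by linarith
    finally have 1: "\<sigma> * \<phi> W - ne X - ne (W - X) \<le> real (card ?C)" using neW by simp
    \<comment> \<open>Halving the size lowers the logarithm by one. The maximum with 0 does not hide
      this, because \<open>X\<close> has at least \<open>u\<close> elements.\<close>
    have gX: "g (card X) \<le> g (card W) - 1"
    proof -
      have cX: "0 < real (card X)" using uX u by linarith
      have "log 2 (2 * (real (card X) / u)) \<le> log 2 (real (card W) / u)"
        using u small cX by (intro log_le_cancel_iff[THEN iffD2]) (auto simp: field_simps)
      moreover have "log 2 (2 * (real (card X) / u)) = 1 + log 2 (real (card X) / u)"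
        using u cX by (subst log_mult) auto
      moreover have "0 \<le> log 2 (real (card X) / u)" using u uX by (intro zero_le_log_cancel_iff[THEN iffD2]) auto
      ultimately show ?thesis unfolding g_def by simp
    qed
    have "ne X \<le> \<sigma> * \<phi> X" by (rule up) (use X WV in auto)
    also have "\<dots> \<le> \<sigma> * (real (card X) * (g (card W) - 1))"
      unfolding \<phi>_def using gX \<sigma>0 by (intro mult_left_mono) auto
    finally have 2: "ne X \<le> \<sigma> * (real (card X) * (g (card W) - 1))" .
    have "ne (W - X) \<le> \<sigma> * \<phi> (W - X)" by (rule up) (use WV in auto)
    also have "\<phi> (W - X) \<le> (real (card W) - real (card X)) * g (card W)"
      unfolding \<phi>_def cardX[OF X] using le[OF X]
      by (intro mult_left_mono gmono le) auto
    finally have 3: "ne (W - X) \<le> \<sigma> * ((real (card W) - real (card X)) * g (card W))"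
      using \<sigma>0 by (simp add: mult_left_mono)
    have "\<sigma> * \<phi> W - \<sigma> * (real (card X) * (g (card W) - 1)) - \<sigma> * ((real (card W) - real (card X)) * g (card W))
        = \<sigma> * real (card X)"
      unfolding \<phi>_def by (simp add: algebra_simps)
    then have "\<sigma> * real (card X) \<le> real (card ?C)" using 1 2 3 by linarith
    moreover have "\<rho> * u \<le> \<sigma> * real (card X)" using \<rho>\<sigma> uX u \<sigma>0 by (intro mult_mono) auto
    ultimately show ?thesis by linarith
  qed
  have cut: "\<rho> * u \<le> real (card {e \<in> S. en e \<subseteq> W \<and> en e \<inter> X \<noteq> {} \<and> en e \<inter> (W - X) \<noteq> {}})"
    if X: "X \<subseteq> W" and uX: "u \<le> real (card X)" "u \<le> real (card (W - X))" for X
  proof (cases "2 * real (card X) \<le> real (card W)")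
    case True
    then show ?thesis using cut1[OF X uX(1)] by simp
  next
    case False
    have dd: "W - (W - X) = X" using X by auto
    have "\<rho> * u \<le> real (card {e \<in> S. en e \<subseteq> W \<and> en e \<inter> (W - X) \<noteq> {} \<and> en e \<inter> (W - (W - X)) \<noteq> {}})"
      by (rule cut1[OF _ uX(2)]) (use False cardX[OF X] in auto)
    then show ?thesis unfolding dd by (simp add: conj_commute)
  qed
  show thesis by (rule that[OF WV touch cut])
qed

text \<open>The density needed is 600 times one plus the binary logarithm of
  \<open>card V / (c1 * x0)\<close>, and \<open>G\<close> bounds that factor. Since this quotient
  will depend on \<open>k\<close> and the gadget only, no logarithm of \<open>n\<close>
  enters.\<close>

lemma loose_cycle_in_dense_family:
  fixes E :: "'e set" and inc en :: "'e \<Rightarrow> 'v set" and S :: "'e set" and V :: "'v set"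
    and r \<Delta> m0 R x0 c1 \<Lambda> G :: nat
  assumes finE: "finite E" and fin_inc: "\<And>e. e \<in> E \<Longrightarrow> finite (inc e)"
    and card_inc: "\<And>e. e \<in> E \<Longrightarrow> card (inc e) \<le> r"
    and sparse: "\<And>XE XV. XE \<subseteq> E \<Longrightarrow> finite XV \<Longrightarrow> card XE + card XV \<le> m0 \<Longrightarrow>
        5 * incid inc XE XV \<le> 6 * (card XE + card XV)"
    and short: "\<And>S f. conn inc S \<Longrightarrow> S \<subseteq> E \<Longrightarrow> card S \<le> R \<Longrightarrow> f \<in> E \<Longrightarrow> f \<notin> S \<Longrightarrow> meets_once inc f S"
    and deg: "\<And>v. card {e \<in> E. v \<in> inc e} \<le> \<Delta>"
    and SE: "S \<subseteq> E"
    and en: "\<And>e. e \<in> S \<Longrightarrow> en e \<subseteq> inc e" "\<And>e. e \<in> S \<Longrightarrow> card (en e) = 2" "\<And>e. e \<in> S \<Longrightarrow> en e \<subseteq> V"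
    and V: "finite V" "card V = \<Lambda> * x0" and \<Lambda>: "1 \<le> \<Lambda>"
    and dense: "600 * (card V * G) \<le> card S" and G: "card V \<le> 2 ^ (G - 1) * (c1 * x0)" "1 \<le> G"
    and R_ge: "2 * c1 + \<Lambda> \<le> R" "1 \<le> R"
    and m0_ge: "2000 * (c1 * x0) \<le> m0" and c1_ge: "1 \<le> c1" and x0_ge: "3 \<le> x0"
    and c1_large: "\<Delta> * r * (\<Delta> * r * (20 * x0)) + \<Delta> * x0 \<le> 600 * (c1 * x0)"
  obtains vs es where "loose_cycle E inc en vs es" "set es \<subseteq> S" "18 * x0 \<le> length es" "length es \<le> 20 * x0 + R"
proof -
  define u where "u = real (c1 * x0)"
  have u: "u > 0" unfolding u_def using c1_ge x0_ge by simp
  have finS: "finite S" using SE finE finite_subset by blast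
  have cV: "card V > 0" using V(2) \<Lambda> x0_ge by simp
  then have V0: "V \<noteq> {}" by auto
  have "log 2 (real (card V) / u) \<le> real (G - 1)"
  proof -
    have "real (card V) \<le> 2 ^ (G - 1) * u" unfolding u_def using of_nat_mono[OF G(1), where 'a = real] by simp
    then have "real (card V) / u \<le> 2 powr real (G - 1)" using u by (simp add: field_simps powr_realpow)
    then have "log 2 (real (card V) / u) \<le> log 2 (2 powr real (G - 1))" using cV u by (subst log_le_cancel_iff) auto
    then show ?thesis by simp
  qed
  then have g: "1 + max 0 (log 2 (real (card V) / u)) \<le> real G" using G(2) by (simp add: of_nat_diff)
  have "600 * (real (card V) * (1 + max 0 (log 2 (real (card V) / u)))) \<le> 600 * (real (card V) * real G)"
    using g by (intro mult_left_mono) auto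
  also have "\<dots> = real (600 * (card V * G))" by simp
  also have "\<dots> \<le> real (card S)" using dense by (rule of_nat_mono)
  finally have dens: "600 * (real (card V) * (1 + max 0 (log 2 (real (card V) / u)))) \<le> real (card S)" .
  have en': "en e \<subseteq> V \<and> en e \<noteq> {}" if "e \<in> S" for e using en[OF that] by auto
  obtain W where W: "W \<subseteq> V" "W \<noteq> {}"
    "\<And>X. X \<subseteq> W \<Longrightarrow> 600 * real (card X) \<le> real (card {e \<in> S. en e \<subseteq> W \<and> en e \<inter> X \<noteq> {}})"
    "\<And>X. X \<subseteq> W \<Longrightarrow> u \<le> real (card X) \<Longrightarrow> u \<le> real (card (W - X)) \<Longrightarrow>
       600 * u \<le> real (card {e \<in> S. en e \<subseteq> W \<and> en e \<inter> X \<noteq> {} \<and> en e \<inter> (W - X) \<noteq> {}})"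
  proof (rule dense_expander[of S V en u 600, OF finS V(1) V0 _ u _ dens])
    show "en e \<subseteq> V \<and> en e \<noteq> {}" if "e \<in> S" for e by (rule en'[OF that])
  qed (simp | (rule that; assumption))+
  define S' where "S' = {e \<in> S. en e \<subseteq> W}"
  obtain v where v: "v \<in> W" using W(2) by blast
  have "S' \<noteq> {}"
  proof
    assume "S' = {}"
    then have none: "{e \<in> S. en e \<subseteq> W \<and> en e \<inter> {v} \<noteq> {}} = {}" unfolding S'_def by blast
    have "600 * real (card {v}) \<le> real (card {e \<in> S. en e \<subseteq> W \<and> en e \<inter> {v} \<noteq> {}})"
      by (rule W(3)) (use v in simp)
    then show False unfolding none by simp
  qed
  have eq: "{e \<in> S'. Q e} = {e \<in> S. en e \<subseteq> W \<and> Q e}" for Q unfolding S'_def by auto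
  interpret expanding_colour E inc en S' W r \<Delta> m0 R x0 c1 \<Lambda>
  proof
    show "S' \<subseteq> E" "S' \<noteq> {}" using SE \<open>S' \<noteq> {}\<close> unfolding S'_def by auto
    show "finite W" using W(1) V(1) finite_subset by blast
    show "card W \<le> \<Lambda> * x0" using card_mono[OF V(1) W(1)] V(2) by simp
    show "600 * card X \<le> card {e \<in> S'. en e \<inter> X \<noteq> {}}" if "X \<subseteq> W" for X
      unfolding eq using W(3)[OF that] by linarith
    show "600 * (c1 * x0) \<le> card {e \<in> S'. en e \<inter> X \<noteq> {} \<and> en e \<inter> (W - X) \<noteq> {}}"
      if "X \<subseteq> W" "c1 * x0 \<le> card X" "c1 * x0 \<le> card (W - X)" for X
      unfolding eq using W(4)[OF that(1)] that(2,3) unfolding u_def by (simp flip: of_nat_mult)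
    show "\<And>e. e \<in> S' \<Longrightarrow> en e \<subseteq> inc e" "\<And>e. e \<in> S' \<Longrightarrow> card (en e) = 2" "\<And>e. e \<in> S' \<Longrightarrow> en e \<subseteq> W"
      unfolding S'_def using en by auto
  qed (rule finE fin_inc card_inc sparse short deg R_ge m0_ge c1_ge x0_ge c1_large; assumption?)+
  obtain vs es where "loose_cycle E inc en vs es" "set es \<subseteq> S'" "18 * x0 \<le> length es" "length es \<le> 20 * x0 + R"
    by (rule long_loose_cycle)
  then show thesis by (intro that[of vs es]) (auto simp: S'_def)
qed

section \<open>Random sparse hypergraphs\<close>

text \<open>Probabilities are kept as cardinalities of sets of maps: the slots in \<open>I\<close>
  all fall into \<open>X\<close> with probability (|X| / |V|)^|I|.\<close>

lemma card_maps_into: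
  fixes Sl :: "'s set" and V X :: "'v set"
  assumes "finite Sl" "finite V" "I \<subseteq> Sl" "X \<subseteq> V"
  shows "card {f \<in> Sl \<rightarrow>\<^sub>E V. \<forall>s\<in>I. f s \<in> X} * card V ^ card I = card X ^ card I * card (Sl \<rightarrow>\<^sub>E V)"
proof -
  have eq: "{f \<in> Sl \<rightarrow>\<^sub>E V. \<forall>s\<in>I. f s \<in> X} = (\<Pi>\<^sub>E s\<in>Sl. if s \<in> I then X else V)"
    using assms by (auto simp: PiE_iff extensional_def split: if_splits) (metis subsetD)
  have "card {f \<in> Sl \<rightarrow>\<^sub>E V. \<forall>s\<in>I. f s \<in> X} = (\<Prod>s\<in>Sl. if s \<in> I then card X else card V)"
    unfolding eq using assms(1) by (subst card_PiE) (auto intro!: prod.cong)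
  also have "\<dots> = card X ^ card I * card V ^ card (Sl - I)"
  proof -
    have "Sl = I \<union> (Sl - I)" using assms by auto
    then have "(\<Prod>s\<in>Sl. if s \<in> I then card X else card V) = (\<Prod>s\<in>I \<union> (Sl - I). if s \<in> I then card X else card V)" by simp
    also have "\<dots> = (\<Prod>s\<in>I. if s \<in> I then card X else card V) * (\<Prod>s\<in>Sl - I. if s \<in> I then card X else card V)"
      by (rule prod.union_disjoint) (use assms finite_subset in auto)
    finally show ?thesis by simp
  qed
  finally have 1: "card {f \<in> Sl \<rightarrow>\<^sub>E V. \<forall>s\<in>I. f s \<in> X} = card X ^ card I * card V ^ card (Sl - I)" .
  have "card V ^ card (Sl - I) * card V ^ card I = card V ^ card Sl"
    using assms by (simp add: card_Diff_subset finite_subset card_mono flip: power_add)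
  moreover have "card (Sl \<rightarrow>\<^sub>E V) = card V ^ card Sl" by (rule card_funcsetE[OF assms(1)])
  ultimately show ?thesis unfolding 1 by (simp add: mult.assoc)
qed

text \<open>Configurations of total size \<open>m\<close>: a set of hyperedges, a set of vertices, and \<open>i\<close> incidence slots
  of these hyperedges, which the random map may send into the chosen vertices.\<close>

definition configs :: "nat \<Rightarrow> nat \<Rightarrow> 'a set \<Rightarrow> nat \<Rightarrow> nat \<Rightarrow> (nat set \<times> nat set \<times> (nat \<times> 'a) set) set" where
  "configs M N A m i = {(XE, XV, I). XE \<subseteq> {..<M} \<and> XV \<subseteq> {..<N} \<and> card XE + card XV = m \<and> I \<subseteq> XE \<times> A \<and> card I = i}"

lemma configs_subset: "configs M N A m i \<subseteq> Pow {..<M} \<times> Pow {..<N} \<times> Pow ({..<M} \<times> A)"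
  unfolding configs_def by auto

lemma finite_configs: "finite A \<Longrightarrow> finite (configs M N A m i)"
  by (rule finite_subset[OF configs_subset]) auto

lemma card_pairs_of_sets:
  "card {(XE, XV). XE \<subseteq> {..<M} \<and> XV \<subseteq> {..<N} \<and> card XE + card XV = m} = (M + N) choose m"
proof -
  let ?P = "{(XE, XV). XE \<subseteq> {..<M} \<and> XV \<subseteq> {..<N} \<and> card XE + card XV = m}"
  let ?Q = "{X. X \<subseteq> {..<M} <+> {..<N} \<and> card X = m}"
  have split: "X = Inl -` X <+> Inr -` X" for X :: "(nat + nat) set"
  proof (rule set_eqI)
    show "z \<in> X \<longleftrightarrow> z \<in> Inl -` X <+> Inr -` X" for z by (cases z) auto
  qed
  have "bij_betw (\<lambda>(XE, XV). XE <+> XV) ?P ?Q"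
  proof (rule bij_betwI[where g = "\<lambda>X. (Inl -` X, Inr -` X)"])
    show "(\<lambda>(XE, XV). XE <+> XV) \<in> ?P \<rightarrow> ?Q"
      by (auto simp: card_Plus finite_subset)
    show "(\<lambda>X. (Inl -` X, Inr -` X)) \<in> ?Q \<rightarrow> ?P"
    proof
      fix X assume X: "X \<in> ?Q"
      have sub: "Inl -` X \<subseteq> {..<M}" "Inr -` X \<subseteq> {..<N}" using X by auto
      have "card X = card (Inl -` X) + card (Inr -` X)"
        by (subst split[of X], rule card_Plus) (use sub finite_subset in blast)+
      then show "(Inl -` X, Inr -` X) \<in> ?P" using sub X by auto
    qed
    show "(\<lambda>X. (Inl -` X, Inr -` X)) ((\<lambda>(XE, XV). XE <+> XV) z) = z" if "z \<in> ?P" for z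
      by (cases z) auto
    show "(\<lambda>(XE, XV). XE <+> XV) ((\<lambda>X. (Inl -` X, Inr -` X)) X) = X" if "X \<in> ?Q" for X
      using split[of X] by simp
  qed
  then have "card ?P = card ?Q" by (rule bij_betw_same_card)
  also have "\<dots> = card ({..<M} <+> {..<N} :: (nat + nat) set) choose m"
    by (rule n_subsets) auto
  finally show ?thesis by (simp add: card_Plus)
qed

lemma card_configs_le:
  assumes "finite A"
  shows "card (configs M N A m i) \<le> ((M + N) choose m) * ((card A * m) choose i)"
proof -
  let ?P = "{(XE, XV). XE \<subseteq> {..<M} \<and> XV \<subseteq> {..<N} \<and> card XE + card XV = m}"
  have finP: "finite ?P" by (rule finite_subset[of _ "Pow {..<M} \<times> Pow {..<N}"]) auto
  have sub: "configs M N A m i \<subseteq> (\<Union>(XE, XV)\<in>?P. (\<lambda>I. (XE, XV, I)) ` {I. I \<subseteq> XE \<times> A \<and> card I = i})"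
    unfolding configs_def by auto
  have one: "card ((\<lambda>I. (XE, XV, I)) ` {I. I \<subseteq> XE \<times> A \<and> card I = i}) \<le> (card A * m) choose i"
    if "(XE, XV) \<in> ?P" for XE XV :: "nat set"
  proof -
    have fin: "finite (XE \<times> A)" using that assms finite_subset[of XE "{..<M}"] by auto
    have "card ((\<lambda>I. (XE, XV, I)) ` {I. I \<subseteq> XE \<times> A \<and> card I = i}) \<le> card {I. I \<subseteq> XE \<times> A \<and> card I = i}"
      by (rule card_image_le) (use fin in auto)
    also have "\<dots> = card (XE \<times> A) choose i" by (rule n_subsets[OF fin])
    also have "\<dots> \<le> (card A * m) choose i"
    proof (rule binomial_right_mono)
      have "card XE \<le> m" using that by auto
      then show "card (XE \<times> A) \<le> card A * m" by (simp add: card_cartesian_product mult.commute)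
    qed
    finally show ?thesis .
  qed
  have "card (configs M N A m i) \<le> card (\<Union>(XE, XV)\<in>?P. (\<lambda>I. (XE, XV, I)) ` {I. I \<subseteq> XE \<times> A \<and> card I = i})"
  proof (rule card_mono[OF _ sub])
    have "finite {I. I \<subseteq> XE \<times> A \<and> card I = i}" if "XE \<subseteq> {..<M}" for XE
      by (rule finite_subset[of _ "Pow (XE \<times> A)"]) (use that assms finite_subset in auto)
    then show "finite (\<Union>(XE, XV)\<in>?P. (\<lambda>I. (XE, XV, I)) ` {I. I \<subseteq> XE \<times> A \<and> card I = i})"
      by (intro finite_UN_I[OF finP]) auto
  qed
  also have "\<dots> \<le> (\<Sum>z\<in>?P. card (case z of (XE, XV) \<Rightarrow> (\<lambda>I. (XE, XV, I)) ` {I. I \<subseteq> XE \<times> A \<and> card I = i}))"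
    by (rule card_UN_le[OF finP])
  also have "\<dots> \<le> (\<Sum>z\<in>?P. (card A * m) choose i)"
  proof (rule sum_mono)
    fix z assume z: "z \<in> ?P"
    then show "card (case z of (XE, XV) \<Rightarrow> (\<lambda>I. (XE, XV, I)) ` {I. I \<subseteq> XE \<times> A \<and> card I = i}) \<le> (card A * m) choose i"
      using one by (cases z) auto
  qed
  also have "\<dots> = card ?P * ((card A * m) choose i)" by simp
  finally show ?thesis unfolding card_pairs_of_sets .
qed

definition hits :: "(nat \<times> 'a \<Rightarrow> nat) \<Rightarrow> nat set \<times> nat set \<times> (nat \<times> 'a) set \<Rightarrow> bool" where
  "hits f c = (case c of (XE, XV, I) \<Rightarrow> \<forall>s\<in>I. f s \<in> XV)"

lemma sum_card_swap:
  assumes "finite F" "finite C"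
  shows "(\<Sum>f\<in>F. card {c \<in> C. P f c}) = (\<Sum>c\<in>C. card {f \<in> F. P f c})"
proof -
  have "(\<Sum>f\<in>F. card {c \<in> C. P f c}) = (\<Sum>f\<in>F. \<Sum>c\<in>C. if P f c then 1 else 0)"
    using assms by (simp add: sum.If_cases Int_def)
  also have "\<dots> = (\<Sum>c\<in>C. \<Sum>f\<in>F. if P f c then 1 else 0)" by (rule sum.swap)
  also have "\<dots> = (\<Sum>c\<in>C. card {f \<in> F. P f c})"
    using assms by (simp add: sum.If_cases Int_def)
  finally show ?thesis .
qed

text \<open>The usual bound (e n / k)^k with 3 in place of e; the estimate of the factorial is a
  single term of the exponential series.\<close>

lemma binomial_le_power_div:
  assumes "0 < k"
  shows "real (n choose k) \<le> (3 * real n / real k) ^ k"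
proof -
  have k: "(real k / 3) ^ k \<le> fact k"
  proof -
    have "exp (real k) \<ge> (real k) ^ k / fact k" 
    proof -
      have s: "summable (\<lambda>n. (real k) ^ n /\<^sub>R fact n)" by (rule summable_exp_generic)
      have "(\<Sum>n\<in>{k}. (real k) ^ n /\<^sub>R fact n) \<le> (\<Sum>n. (real k) ^ n /\<^sub>R fact n)"
        by (rule sum_le_suminf[OF s]) auto
      then show ?thesis unfolding exp_def by (simp add: field_simps)
    qed
    moreover have "exp (real k) \<le> 3 ^ k"
      using exp_le power_mono[of "exp 1 :: real" 3 k] by (simp add: exp_of_nat_mult[of k 1, simplified])
    ultimately have "(real k) ^ k / fact k \<le> 3 ^ k" by linarith
    then show ?thesis by (simp add: power_divide field_simps)
  qed
  have "real ((n choose k) * fact k) \<le> real (n ^ k)" by (rule of_nat_mono) (rule binomial_fact_pow)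
  then have "real (n choose k) \<le> real n ^ k / fact k" by (simp add: field_simps)
  also have "\<dots> \<le> real n ^ k / (real k / 3) ^ k"
    by (rule divide_left_mono[OF k]) (use assms in auto)
  also have "\<dots> = (3 * real n / real k) ^ k" by (simp add: power_divide field_simps power_mult_distrib)
  finally show ?thesis .
qed

text \<open>Every incidence beyond the \<open>m\<close>-th costs a factor of order m / N. For
  \<open>i = m\<close> the average number does not grow with \<open>N\<close>, so short cycles are
  few. For a fixed proportion of additional incidences it remains small even when summed over all
  \<open>m\<close> up to a small multiple of \<open>N\<close>.\<close>

lemma expected_configs:
  fixes A :: "'a set"
  assumes A: "finite A" and N: "0 < N" and M: "M = \<mu> * N" and m: "0 < m" and i: "m \<le> i"
  defines "\<Omega> \<equiv> ({..<M} \<times> A) \<rightarrow>\<^sub>E {..<N}"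
  shows "real (\<Sum>f\<in>\<Omega>. card {c \<in> configs M N A m i. hits f c})
    \<le> (9 * (real \<mu> + 1) * real (card A)) ^ m * (3 * real (card A) * real m / real N) ^ (i - m) * real (card \<Omega>)"
proof -
  have fin: "finite ({..<M} \<times> A)" using A by auto
  have fO: "finite \<Omega>" unfolding \<Omega>_def by (rule finite_PiE) (use fin in auto)
  have one: "real (card {f \<in> \<Omega>. hits f c}) \<le> (real m / real N) ^ i * real (card \<Omega>)"
    if "c \<in> configs M N A m i" for c
  proof -
    obtain XE XV I where c: "c = (XE, XV, I)" by (cases c) auto
    have h: "XE \<subseteq> {..<M}" "XV \<subseteq> {..<N}" "card XE + card XV = m" "I \<subseteq> XE \<times> A" "card I = i"
      using that unfolding configs_def c by auto
    have "card {f \<in> \<Omega>. \<forall>s\<in>I. f s \<in> XV} * card {..<N} ^ card I = card XV ^ card I * card \<Omega>"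
      unfolding \<Omega>_def by (rule card_maps_into) (use fin h in auto)
    then have "real (card {f \<in> \<Omega>. \<forall>s\<in>I. f s \<in> XV}) * real N ^ i = real (card XV) ^ i * real (card \<Omega>)"
      unfolding h(5) by (simp flip: of_nat_power of_nat_mult)
    then have "real (card {f \<in> \<Omega>. \<forall>s\<in>I. f s \<in> XV}) = (real (card XV) / real N) ^ i * real (card \<Omega>)"
      using N by (simp add: power_divide field_simps)
    also have "\<dots> \<le> (real m / real N) ^ i * real (card \<Omega>)"
      using h(3) by (intro mult_right_mono power_mono divide_right_mono) auto
    finally show ?thesis unfolding hits_def c by simp
  qed
  have "real (\<Sum>f\<in>\<Omega>. card {c \<in> configs M N A m i. hits f c})
      = (\<Sum>c\<in>configs M N A m i. real (card {f \<in> \<Omega>. hits f c}))"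
    by (subst sum_card_swap[OF fO finite_configs[OF A]]) simp
  also have "\<dots> \<le> (\<Sum>c\<in>configs M N A m i. (real m / real N) ^ i * real (card \<Omega>))"
    by (rule sum_mono) (rule one)
  also have "\<dots> = real (card (configs M N A m i)) * ((real m / real N) ^ i * real (card \<Omega>))" by simp
  also have "\<dots> \<le> (((3 * (real \<mu> + 1) * real N) / real m) ^ m * (3 * real (card A)) ^ i) * ((real m / real N) ^ i * real (card \<Omega>))"
  proof (rule mult_right_mono)
    have "real (card (configs M N A m i)) \<le> real (((M + N) choose m) * ((card A * m) choose i))"
      by (rule of_nat_mono) (rule card_configs_le[OF A])
    also have "\<dots> = real ((M + N) choose m) * real ((card A * m) choose i)" by simp
    also have "\<dots> \<le> (3 * (real \<mu> + 1) * real N / real m) ^ m * (3 * real (card A)) ^ i"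
    proof (rule mult_mono)
      have "real ((M + N) choose m) \<le> (3 * real (M + N) / real m) ^ m" by (rule binomial_le_power_div[OF m])
      also have "3 * real (M + N) = 3 * (real \<mu> + 1) * real N" unfolding M by (simp add: algebra_simps)
      finally show "real ((M + N) choose m) \<le> (3 * (real \<mu> + 1) * real N / real m) ^ m" .
      have i0: "0 < i" using m i by simp
      have "real ((card A * m) choose i) \<le> (3 * real (card A * m) / real i) ^ i" by (rule binomial_le_power_div[OF i0])
      also have "\<dots> \<le> (3 * real (card A)) ^ i"
      proof (rule power_mono)
        have "real (card A) * real m \<le> real (card A) * real i" using i by (intro mult_left_mono) auto
        then show "3 * real (card A * m) / real i \<le> 3 * real (card A)" using i0 by (simp add: field_simps)
      qed simp
      finally show "real ((card A * m) choose i) \<le> (3 * real (card A)) ^ i" .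
    qed auto
    finally show "real (card (configs M N A m i)) \<le> ((3 * (real \<mu> + 1) * real N) / real m) ^ m * (3 * real (card A)) ^ i" by simp
  qed simp
  also have "\<dots> = (9 * (real \<mu> + 1) * real (card A)) ^ m * (3 * real (card A) * real m / real N) ^ (i - m) * real (card \<Omega>)"
  proof -
    let ?x = "3 * real (card A) * real m / real N"
    have "(3 * real (card A)) ^ i * (real m / real N) ^ i = ?x ^ i"
      by (subst power_mult_distrib[symmetric]) simp
    also have "\<dots> = ?x ^ m * ?x ^ (i - m)" by (subst power_add[symmetric]) (use i in simp)
    finally have 1: "(3 * real (card A)) ^ i * (real m / real N) ^ i = ?x ^ m * ?x ^ (i - m)" .
    have "((3 * (real \<mu> + 1) * real N) / real m) ^ m * ?x ^ m = (((3 * (real \<mu> + 1) * real N) / real m) * ?x) ^ m"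
      by (rule power_mult_distrib[symmetric])
    also have "((3 * (real \<mu> + 1) * real N) / real m) * ?x = 9 * (real \<mu> + 1) * real (card A)"
      using m N by (simp add: field_simps)
    finally have 2: "((3 * (real \<mu> + 1) * real N) / real m) ^ m * ?x ^ m = (9 * (real \<mu> + 1) * real (card A)) ^ m" .
    have "(((3 * (real \<mu> + 1) * real N) / real m) ^ m * (3 * real (card A)) ^ i) * ((real m / real N) ^ i * real (card \<Omega>))
      = ((3 * (real \<mu> + 1) * real N) / real m) ^ m * ((3 * real (card A)) ^ i * (real m / real N) ^ i) * real (card \<Omega>)"
      by (simp only: mult_ac)
    also have "\<dots> = (((3 * (real \<mu> + 1) * real N) / real m) ^ m * ?x ^ m) * ?x ^ (i - m) * real (card \<Omega>)"
      unfolding 1 by (simp only: mult_ac)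
    finally show ?thesis unfolding 2 .
  qed
  finally show ?thesis .
qed

lemma card_maps_equal_at:
  fixes Sl :: "'s set" and N :: nat
  assumes Sl: "finite Sl" and N: "0 < N" and s: "s \<in> Sl" "t \<in> Sl" "s \<noteq> t"
  shows "real (card {f \<in> Sl \<rightarrow>\<^sub>E {..<N}. f s = f t}) \<le> real (card (Sl \<rightarrow>\<^sub>E {..<N})) / real N"
proof -
  let ?O = "Sl \<rightarrow>\<^sub>E {..<N}"
  have fO: "finite ?O" by (rule finite_PiE) (use Sl in auto)
  have "{f \<in> ?O. f s = f t} \<subseteq> (\<Union>v\<in>{..<N}. {f \<in> ?O. \<forall>x\<in>{s, t}. f x \<in> {v}})"
    using s by (auto simp: PiE_iff)
  then have "card {f \<in> ?O. f s = f t} \<le> card (\<Union>v\<in>{..<N}. {f \<in> ?O. \<forall>x\<in>{s, t}. f x \<in> {v}})"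
    by (rule card_mono[rotated]) (use fO in auto)
  also have "\<dots> \<le> (\<Sum>v\<in>{..<N}. card {f \<in> ?O. \<forall>x\<in>{s, t}. f x \<in> {v}})"
    by (rule card_UN_le) simp
  finally have "card {f \<in> ?O. f s = f t} \<le> (\<Sum>v\<in>{..<N}. card {f \<in> ?O. \<forall>x\<in>{s, t}. f x \<in> {v}})" .
  from of_nat_mono[OF this, where 'a = real]
  have 1: "real (card {f \<in> ?O. f s = f t}) \<le> (\<Sum>v\<in>{..<N}. real (card {f \<in> ?O. \<forall>x\<in>{s, t}. f x \<in> {v}}))"
    by (simp only: of_nat_sum)
  have 2: "real (card {f \<in> ?O. \<forall>x\<in>{s, t}. f x \<in> {v}}) = real (card ?O) / real N ^ 2" if "v \<in> {..<N}" for v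
  proof -
    have "card {f \<in> ?O. \<forall>x\<in>{s, t}. f x \<in> {v}} * card {..<N} ^ card {s, t} = card {v} ^ card {s, t} * card ?O"
      by (rule card_maps_into) (use Sl s that in auto)
    then have "card {f \<in> ?O. \<forall>x\<in>{s, t}. f x \<in> {v}} * N ^ 2 = card ?O"
      using s(3) by (simp add: power2_eq_square)
    then have "real (card {f \<in> ?O. \<forall>x\<in>{s, t}. f x \<in> {v}}) * real N ^ 2 = real (card ?O)"
      using arg_cong[of _ _ real] by (simp flip: of_nat_mult of_nat_power)
    then show ?thesis using N by (simp add: field_simps)
  qed
  have "(\<Sum>v\<in>{..<N}. real (card {f \<in> ?O. \<forall>x\<in>{s, t}. f x \<in> {v}})) = (\<Sum>v\<in>{..<N}. real (card ?O) / real N ^ 2)"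
    by (rule sum.cong[OF refl]) (rule 2)
  also have "\<dots> = real (card ?O) / real N" using N by (simp add: power2_eq_square)
  finally show ?thesis using 1 by linarith
qed

text \<open>The diagonal contributes \<open>card Sl\<close>, and any other pair of slots collides
  with probability at most 1 / N. As the number of colliding pairs is a sum of squared degrees, it
  controls vertices of large degree.\<close>

lemma expected_collisions:
  fixes Sl :: "'s set" and N :: nat
  assumes Sl: "finite Sl" and N: "0 < N"
  shows "real (\<Sum>f\<in>Sl \<rightarrow>\<^sub>E {..<N}. card {z \<in> Sl \<times> Sl. f (fst z) = f (snd z)})
    \<le> (real (card Sl) + (real (card Sl))\<^sup>2 / real N) * real (card (Sl \<rightarrow>\<^sub>E {..<N}))"
proof -
  let ?O = "Sl \<rightarrow>\<^sub>E {..<N}"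
  have fO: "finite ?O" by (rule finite_PiE) (use Sl in auto)
  have "real (\<Sum>f\<in>?O. card {z \<in> Sl \<times> Sl. f (fst z) = f (snd z)})
      = (\<Sum>z\<in>Sl \<times> Sl. real (card {f \<in> ?O. f (fst z) = f (snd z)}))"
    by (subst sum_card_swap[OF fO]) (use Sl in auto)
  also have "\<dots> = (\<Sum>s\<in>Sl. \<Sum>t\<in>Sl. real (card {f \<in> ?O. f s = f t}))"
    by (simp add: sum.cartesian_product case_prod_beta)
  also have "\<dots> \<le> (\<Sum>s\<in>Sl. real (card ?O) + real (card Sl) * (real (card ?O) / real N))"
  proof (rule sum_mono)
    fix s assume s: "s \<in> Sl"
    have "(\<Sum>t\<in>Sl. real (card {f \<in> ?O. f s = f t}))
        \<le> (\<Sum>t\<in>Sl. (if t = s then real (card ?O) else 0) + real (card ?O) / real N)"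
    proof (rule sum_mono)
      fix t assume t: "t \<in> Sl"
      show "real (card {f \<in> ?O. f s = f t}) \<le> (if t = s then real (card ?O) else 0) + real (card ?O) / real N"
      proof (cases "t = s")
        case False
        then show ?thesis using card_maps_equal_at[OF Sl N s t] by simp
      qed (simp add: N)
    qed
    also have "\<dots> = real (card ?O) + real (card Sl) * (real (card ?O) / real N)"
      using Sl s by (simp add: sum.distrib)
    finally show "(\<Sum>t\<in>Sl. real (card {f \<in> ?O. f s = f t})) \<le> real (card ?O) + real (card Sl) * (real (card ?O) / real N)" .
  qed
  also have "\<dots> = (real (card Sl) + (real (card Sl))\<^sup>2 / real N) * real (card ?O)"
    by (simp add: algebra_simps power2_eq_square)
  finally show ?thesis .
qed

lemma sum_powers_eighth: "(\<Sum>m\<in>{1..n}. (1 / 8 :: real) ^ m) \<le> 1 / 7"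
proof -
  have "(\<Sum>m\<in>{1..n}. (1 / 8 :: real) ^ m) = 1 / 7 - (1 / 7) * (1 / 8) ^ n"
    by (induction n) (auto simp: algebra_simps)
  then show ?thesis by simp
qed

lemma exists_below_average:
  fixes h :: "'b \<Rightarrow> real"
  assumes "finite \<Omega>" "(\<Sum>f\<in>\<Omega>. h f) < real (card \<Omega>)"
  obtains f where "f \<in> \<Omega>" "h f < 1"
proof -
  have "\<exists>f\<in>\<Omega>. h f < 1"
  proof (rule ccontr)
    assume "\<not> ?thesis"
    then have "(\<Sum>f\<in>\<Omega>. 1) \<le> (\<Sum>f\<in>\<Omega>. h f)" by (intro sum_mono) auto
    then show False using assms by simp
  qed
  then show thesis using that by blast
qed

text \<open>A first-moment argument for three kinds of defects at once, with expectations weighted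
  to at most 1/7 + 1/4 + 1/4. Dense configurations must be absent altogether; short cycles and
  collisions need only be few, as deletion will remove them.\<close>

lemma exists_good_map:
  fixes A :: "'a set" and \<mu> R N m0 :: nat
  assumes A: "finite A" "A \<noteq> {}" and \<mu>: "1 \<le> \<mu>"
    and N: "1 \<le> N" "16 * real R * (\<Sum>m\<in>{1..R}. (9 * (real \<mu> + 1) * real (card A)) ^ m) \<le> real N"
    and m0: "m0 * (3 * card A * (72 * (\<mu> + 1) * card A) ^ 5) \<le> N"
  obtains f where "f \<in> ({..<\<mu> * N} \<times> A) \<rightarrow>\<^sub>E {..<N}"
    "\<forall>m c. 1 \<le> m \<longrightarrow> m \<le> m0 \<longrightarrow> c \<in> configs (\<mu> * N) N A m (m + (m + 4) div 5) \<longrightarrow> \<not> hits f c"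
    "4 * R * (\<Sum>m\<in>{1..R}. card {c \<in> configs (\<mu> * N) N A m m. hits f c}) \<le> \<mu> * N"
    "card {z \<in> ({..<\<mu> * N} \<times> A) \<times> ({..<\<mu> * N} \<times> A). f (fst z) = f (snd z)} \<le> 8 * (\<mu> * card A)\<^sup>2 * N"
proof -
  define M where "M = \<mu> * N"
  define r where "r = card A"
  define Sl where "Sl = {..<M} \<times> A"
  define \<Omega> where "\<Omega> = Sl \<rightarrow>\<^sub>E {..<N}"
  define \<omega> where "\<omega> = real (card \<Omega>)"
  have r: "1 \<le> r" unfolding r_def using A by (simp add: Suc_le_eq card_gt_0_iff)
  have N0: "0 < N" using N by simp
  have M0: "0 < real M" unfolding M_def using \<mu> N by simp
  have fSl: "finite Sl" unfolding Sl_def using A by auto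
  have cSl: "card Sl = \<mu> * N * r" unfolding Sl_def r_def M_def by (simp add: card_cartesian_product)
  have fO: "finite \<Omega>" unfolding \<Omega>_def by (rule finite_PiE) (use fSl in auto)
  have cO: "card \<Omega> = N ^ card Sl" unfolding \<Omega>_def using card_funcsetE[OF fSl, of "{..<N}"] by simp
  have \<omega>0: "0 < \<omega>" unfolding \<omega>_def cO using N0 by simp
  define cnt2 where "cnt2 f = (\<Sum>m\<in>{1..m0}. card {c \<in> configs M N A m (m + (m + 4) div 5). hits f c})" for f
  define cntS where "cntS f = (\<Sum>m\<in>{1..R}. card {c \<in> configs M N A m m. hits f c})" for f
  define col where "col f = card {z \<in> Sl \<times> Sl. f (fst z) = f (snd z)}" for f :: "nat \<times> 'a \<Rightarrow> nat"
  define K where "K = 9 * (real \<mu> + 1) * real r"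
  have K1: "9 \<le> K"
  proof -
    have "9 * 1 * 1 \<le> 9 * (real \<mu> + 1) * real r" by (intro mult_mono) (use r in auto)
    then show ?thesis unfolding K_def by simp
  qed
  have s2: "(\<Sum>f\<in>\<Omega>. real (cnt2 f)) \<le> 1 / 7 * \<omega>"
  proof -
    have each: "real (\<Sum>f\<in>\<Omega>. card {c \<in> configs M N A m (m + (m + 4) div 5). hits f c}) \<le> (1 / 8) ^ m * \<omega>"
      if m: "m \<in> {1..m0}" for m
    proof -
      let ?x = "3 * real r * real m / real N"
      \<comment> \<open>\<open>q\<close> is m / 5 rounded up, the number of available factors
        \<open>?x\<close>. They must outweigh \<open>m\<close> factors \<open>K\<close>, hence the
        fifth power of \<open>72 * (\<mu> + 1) * r = 8 * K\<close> in the bound on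
        \<open>m0\<close>; the 8 leaves a geometric series.\<close>
      define q where "q = (m + 4) div 5"
      define z where "z = 1 / (8 * K)"
      have z: "0 < z" "z \<le> 1" unfolding z_def using K1 by (auto simp: field_simps)
      have xz: "?x \<le> z ^ 5"
      proof -
        have "m * (3 * r * (72 * (\<mu> + 1) * r) ^ 5) \<le> N"
          using m m0 unfolding r_def by (meson atLeastAtMost_iff le_trans mult_le_mono1)
        then have "real (m * (3 * r * (72 * (\<mu> + 1) * r) ^ 5)) \<le> real N" by (rule of_nat_mono)
        then have "real m * (3 * real r * (72 * (real \<mu> + 1) * real r) ^ 5) \<le> real N" by (simp add: add.commute)
        moreover have "72 * (real \<mu> + 1) * real r = 8 * K" unfolding K_def by simp
        ultimately have "(3 * real r * real m) * (8 * K) ^ 5 \<le> real N" by (simp add: mult_ac)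
        then show ?thesis unfolding z_def using N0 K1 by (simp add: power_one_over field_simps)
      qed
      have x0: "0 \<le> ?x" by simp
      have "?x ^ q \<le> (z ^ 5) ^ q" by (rule power_mono[OF xz x0])
      also have "\<dots> = z ^ (5 * q)" by (simp add: power_mult)
      also have "\<dots> \<le> z ^ m" by (rule power_decreasing) (use z q_def in auto)
      finally have xq: "?x ^ q \<le> z ^ m" .
      have "real (\<Sum>f\<in>\<Omega>. card {c \<in> configs M N A m (m + (m + 4) div 5). hits f c})
          \<le> (9 * (real \<mu> + 1) * real (card A)) ^ m * (3 * real (card A) * real m / real N) ^ ((m + (m + 4) div 5) - m) * real (card \<Omega>)"
        unfolding \<Omega>_def Sl_def by (rule expected_configs) (use A N0 M_def m in auto)
      also have "\<dots> = K ^ m * ?x ^ q * \<omega>" unfolding K_def r_def q_def \<omega>_def by simp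
      also have "\<dots> \<le> K ^ m * z ^ m * \<omega>"
        using xq K1 \<omega>0 by (intro mult_right_mono mult_left_mono) auto
      also have "K ^ m * z ^ m = (1 / 8) ^ m" unfolding z_def using K1 by (simp flip: power_mult_distrib)
      finally show ?thesis .
    qed
    have "(\<Sum>f\<in>\<Omega>. real (cnt2 f)) = (\<Sum>m\<in>{1..m0}. real (\<Sum>f\<in>\<Omega>. card {c \<in> configs M N A m (m + (m + 4) div 5). hits f c}))"
      unfolding cnt2_def of_nat_sum by (rule sum.swap)
    also have "\<dots> \<le> (\<Sum>m\<in>{1..m0}. (1 / 8) ^ m * \<omega>)" by (rule sum_mono) (rule each)
    also have "\<dots> = (\<Sum>m\<in>{1..m0}. (1 / 8) ^ m) * \<omega>" by (simp add: sum_distrib_right)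
    also have "\<dots> \<le> 1 / 7 * \<omega>" using sum_powers_eighth \<omega>0 by (intro mult_right_mono) auto
    finally show ?thesis .
  qed
  define C1 where "C1 = (\<Sum>m\<in>{1..R}. K ^ m)"
  have sS: "(\<Sum>f\<in>\<Omega>. real (cntS f)) \<le> C1 * \<omega>"
  proof -
    have each: "real (\<Sum>f\<in>\<Omega>. card {c \<in> configs M N A m m. hits f c}) \<le> K ^ m * \<omega>" if m: "m \<in> {1..R}" for m
    proof -
      have "real (\<Sum>f\<in>\<Omega>. card {c \<in> configs M N A m m. hits f c})
          \<le> (9 * (real \<mu> + 1) * real (card A)) ^ m * (3 * real (card A) * real m / real N) ^ (m - m) * real (card \<Omega>)"
        unfolding \<Omega>_def Sl_def by (rule expected_configs) (use A N0 M_def m in auto)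
      then show ?thesis unfolding K_def r_def \<omega>_def by simp
    qed
    have "(\<Sum>f\<in>\<Omega>. real (cntS f)) = (\<Sum>m\<in>{1..R}. real (\<Sum>f\<in>\<Omega>. card {c \<in> configs M N A m m. hits f c}))"
      unfolding cntS_def of_nat_sum by (rule sum.swap)
    also have "\<dots> \<le> (\<Sum>m\<in>{1..R}. K ^ m * \<omega>)" by (rule sum_mono) (rule each)
    finally show ?thesis unfolding C1_def by (simp add: sum_distrib_right)
  qed
  have sD: "(\<Sum>f\<in>\<Omega>. real (col f)) \<le> 2 * (real \<mu> * real r)\<^sup>2 * real N * \<omega>"
  proof -
    have "(\<Sum>f\<in>\<Omega>. real (col f)) = real (\<Sum>f\<in>\<Omega>. col f)" by simp
    also have "\<dots> \<le> (real (card Sl) + (real (card Sl))\<^sup>2 / real N) * \<omega>"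
      unfolding col_def \<omega>_def \<Omega>_def by (rule expected_collisions[OF fSl N0])
    also have "real (card Sl) + (real (card Sl))\<^sup>2 / real N = (real \<mu> * real r + (real \<mu> * real r)\<^sup>2) * real N"
      unfolding cSl using N0 by (simp add: power2_eq_square field_simps)
    also have "\<dots> \<le> (2 * (real \<mu> * real r)\<^sup>2) * real N"
    proof (rule mult_right_mono)
      have "1 * 1 \<le> real \<mu> * real r" by (rule mult_mono) (use \<mu> r in auto)
      then have "real \<mu> * real r * 1 \<le> real \<mu> * real r * (real \<mu> * real r)" by (intro mult_left_mono) auto
      then show "real \<mu> * real r + (real \<mu> * real r)\<^sup>2 \<le> 2 * (real \<mu> * real r)\<^sup>2" by (simp add: power2_eq_square mult_ac)
    qed simp
    finally show ?thesis using \<omega>0 by simp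
  qed
  define D where "D = 8 * (real \<mu> * real r)\<^sup>2 * real N"
  have D0: "0 < D" unfolding D_def using \<mu> r N0 by simp
  \<comment> \<open>Each of the last two counts is divided by at least four times the bound on its
    expectation.\<close>
  define h where "h f = real (cnt2 f) + real (cntS f) * (4 * real R / real M) + real (col f) / D" for f
  have "(\<Sum>f\<in>\<Omega>. h f) = (\<Sum>f\<in>\<Omega>. real (cnt2 f)) + (\<Sum>f\<in>\<Omega>. real (cntS f)) * (4 * real R / real M) + (\<Sum>f\<in>\<Omega>. real (col f)) / D"
    unfolding h_def by (simp add: sum.distrib sum_distrib_right sum_divide_distrib)
  also have "\<dots> \<le> 1 / 7 * \<omega> + C1 * \<omega> * (4 * real R / real M) + (2 * (real \<mu> * real r)\<^sup>2 * real N * \<omega>) / D"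
    using s2 sS sD D0 M0 by (intro add_mono mult_right_mono divide_right_mono) auto
  also have "(2 * (real \<mu> * real r)\<^sup>2 * real N * \<omega>) / D = 1 / 4 * \<omega>"
  proof -
    have "2 * (real \<mu> * real r)\<^sup>2 * real N * \<omega> = (1 / 4 * \<omega>) * D" unfolding D_def by simp
    then have "(2 * (real \<mu> * real r)\<^sup>2 * real N * \<omega>) / D = ((1 / 4 * \<omega>) * D) / D" by (simp only:)
    also have "\<dots> = 1 / 4 * \<omega>" using D0 by (intro nonzero_mult_div_cancel_right) simp
    finally show ?thesis .
  qed
  also have "C1 * \<omega> * (4 * real R / real M) \<le> 1 / 4 * \<omega>"
  proof -
    have "16 * real R * C1 \<le> real N" using N(2) unfolding C1_def K_def r_def .
    also have "real N \<le> real M" unfolding M_def by (rule of_nat_mono) (use \<mu> in simp)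
    finally have "C1 * (4 * real R / real M) \<le> 1 / 4" using M0 by (simp add: field_simps)
    then have "C1 * (4 * real R / real M) * \<omega> \<le> 1 / 4 * \<omega>" using \<omega>0 by (intro mult_right_mono) auto
    then show ?thesis by (simp add: mult_ac)
  qed
  finally have "(\<Sum>f\<in>\<Omega>. h f) \<le> (1 / 7 + 1 / 4 + 1 / 4) * \<omega>" by (simp add: algebra_simps)
  also have "\<dots> < real (card \<Omega>)" using \<omega>0 unfolding \<omega>_def by simp
  finally have "(\<Sum>f\<in>\<Omega>. h f) < real (card \<Omega>)" .
  then obtain f where f: "f \<in> \<Omega>" "h f < 1" using exists_below_average[OF fO] by blast
  have nn: "0 \<le> real (cnt2 f)" "0 \<le> real (cntS f) * (4 * real R / real M)" "0 \<le> real (col f) / D"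
    using D0 M0 by auto
  have "real (cnt2 f) < 1" using f(2) nn unfolding h_def by linarith
  then have c2: "cnt2 f = 0" by simp
  have "real (cntS f) * (4 * real R / real M) < 1" using f(2) nn unfolding h_def by linarith
  then have "real (cntS f) * (4 * real R) < real M" using M0 by (simp add: field_simps)
  then have "real (4 * R * cntS f) \<le> real M" by (simp add: mult_ac)
  then have cS: "4 * R * cntS f \<le> M" by (simp only: of_nat_le_iff)
  have "real (col f) / D < 1" using f(2) nn unfolding h_def by linarith
  then have "real (col f) \<le> real (8 * (\<mu> * r)\<^sup>2 * N)" using D0 unfolding D_def by simp
  then have cD: "col f \<le> 8 * (\<mu> * r)\<^sup>2 * N" by (simp only: of_nat_le_iff)
  show thesis
  proof (rule that[of f])
    show "f \<in> {..<\<mu> * N} \<times> A \<rightarrow>\<^sub>E {..<N}" using f(1) unfolding \<Omega>_def Sl_def M_def .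
    show "\<forall>m c. 1 \<le> m \<longrightarrow> m \<le> m0 \<longrightarrow> c \<in> configs (\<mu> * N) N A m (m + (m + 4) div 5) \<longrightarrow> \<not> hits f c"
    proof (intro allI impI)
      fix m c assume m: "1 \<le> m" "m \<le> m0" and c: "c \<in> configs (\<mu> * N) N A m (m + (m + 4) div 5)"
      have "card {c \<in> configs M N A m (m + (m + 4) div 5). hits f c} = 0"
        using c2 m unfolding cnt2_def by (simp add: sum_eq_0_iff)
      then have "{c \<in> configs M N A m (m + (m + 4) div 5). hits f c} = {}"
        using finite_configs[OF A(1)] by (subst (asm) card_0_eq) auto
      then show "\<not> hits f c" using c unfolding M_def by blast
    qed
    show "4 * R * (\<Sum>m\<in>{1..R}. card {c \<in> configs (\<mu> * N) N A m m. hits f c}) \<le> \<mu> * N"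
      using cS unfolding cntS_def M_def .
    show "card {z \<in> ({..<\<mu> * N} \<times> A) \<times> ({..<\<mu> * N} \<times> A). f (fst z) = f (snd z)} \<le> 8 * (\<mu> * card A)\<^sup>2 * N"
      using cD unfolding col_def Sl_def M_def r_def .
  qed
qed

text \<open>At most a quarter of the hyperedges lies in short cycles and at most a quarter contains
  a vertex of large degree. What remains inherits sparsity at linear scale and has no short cycles,
  since every such configuration has lost its hyperedges.\<close>

lemma exists_sparse_hypergraph:
  fixes A :: "'a set" and \<mu> R N m0 :: nat
  assumes A: "finite A" "A \<noteq> {}" and \<mu>: "1 \<le> \<mu>"
    and N: "1 \<le> N" "16 * real R * (\<Sum>m\<in>{1..R}. (9 * (real \<mu> + 1) * real (card A)) ^ m) \<le> real N"
    and m0: "m0 * (3 * card A * (72 * (\<mu> + 1) * card A) ^ 5) \<le> N"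
    and R: "2 \<le> R"
  obtains f :: "nat \<Rightarrow> 'a \<Rightarrow> nat" and J where "J \<subseteq> {..<\<mu> * N}" "\<mu> * N \<le> 2 * card J"
    "\<And>j a. j \<in> J \<Longrightarrow> a \<in> A \<Longrightarrow> f j a < N" "\<And>j. j \<in> J \<Longrightarrow> inj_on (f j) A"
    "\<And>XE XV. XE \<subseteq> J \<Longrightarrow> finite XV \<Longrightarrow> 0 < card XE + card XV \<Longrightarrow> card XE + card XV \<le> R \<Longrightarrow>
       incid (\<lambda>j. f j ` A) XE XV < card XE + card XV"
    "\<And>XE XV. XE \<subseteq> J \<Longrightarrow> finite XV \<Longrightarrow> card XE + card XV \<le> m0 \<Longrightarrow>
       5 * incid (\<lambda>j. f j ` A) XE XV \<le> 6 * (card XE + card XV)"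
    "\<And>v. card {j \<in> J. v \<in> f j ` A} \<le> 32 * \<mu> * (card A)\<^sup>2"
proof -
  define M where "M = \<mu> * N"
  define r where "r = card A"
  define Sl where "Sl = {..<M} \<times> A"
  obtain f where f: "f \<in> Sl \<rightarrow>\<^sub>E {..<N}"
    "\<forall>m c. 1 \<le> m \<longrightarrow> m \<le> m0 \<longrightarrow> c \<in> configs M N A m (m + (m + 4) div 5) \<longrightarrow> \<not> hits f c"
    "4 * R * (\<Sum>m\<in>{1..R}. card {c \<in> configs M N A m m. hits f c}) \<le> M"
    "card {z \<in> Sl \<times> Sl. f (fst z) = f (snd z)} \<le> 8 * (\<mu> * r)\<^sup>2 * N"
    by (rule exists_good_map[OF A \<mu> N m0, folded M_def r_def, folded Sl_def])
  have fSl: "finite Sl" unfolding Sl_def using A by auto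
  have r: "1 \<le> r" unfolding r_def using A by (simp add: Suc_le_eq card_gt_0_iff)
  have fN: "f (j, a) < N" if "j < M" "a \<in> A" for j a using f(1) that unfolding Sl_def by (auto simp: PiE_iff)
  define \<Delta> where "\<Delta> = 32 * \<mu> * r\<^sup>2"
  define XS where "XS = (\<Union>m\<in>{1..R}. \<Union>c\<in>{c \<in> configs M N A m m. hits f c}. fst c)"
  define XH where "XH = {j. j < M \<and> (\<exists>a\<in>A. \<Delta> < card {s \<in> Sl. f s = f (j, a)})}"
  define J where "J = {..<M} - XS - XH"
  have cXS: "4 * card XS \<le> M"
  proof -
    have "card XS \<le> (\<Sum>m\<in>{1..R}. card (\<Union>c\<in>{c \<in> configs M N A m m. hits f c}. fst c))"
      unfolding XS_def by (rule card_UN_le) simp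
    also have "\<dots> \<le> (\<Sum>m\<in>{1..R}. R * card {c \<in> configs M N A m m. hits f c})"
    proof (rule sum_mono)
      fix m assume m: "m \<in> {1..R}"
      have "card (\<Union>c\<in>{c \<in> configs M N A m m. hits f c}. fst c) \<le> (\<Sum>c\<in>{c \<in> configs M N A m m. hits f c}. card (fst c))"
        by (rule card_UN_le) (use finite_configs[OF A(1)] in auto)
      also have "\<dots> \<le> (\<Sum>c\<in>{c \<in> configs M N A m m. hits f c}. R)"
        by (rule sum_mono) (use m in \<open>auto simp: configs_def\<close>)
      finally show "card (\<Union>c\<in>{c \<in> configs M N A m m. hits f c}. fst c) \<le> R * card {c \<in> configs M N A m m. hits f c}"
        by (simp add: mult.commute)
    qed
    also have "\<dots> = R * (\<Sum>m\<in>{1..R}. card {c \<in> configs M N A m m. hits f c})" by (simp add: sum_distrib_left)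
    finally show ?thesis using f(3) by linarith
  qed
  \<comment> \<open>Markov's inequality: a slot in \<open>H\<close> collides with more than
    \<open>\<Delta>\<close> slots, so \<open>\<Delta> * card H\<close> is bounded by the number of
    colliding pairs.\<close>
  have cXH: "4 * card XH \<le> M"
  proof -
    define H where "H = {s \<in> Sl. \<Delta> < card {s' \<in> Sl. f s' = f s}}"
    have fH: "finite H" unfolding H_def using fSl by simp
    have "XH \<subseteq> fst ` H" unfolding XH_def H_def Sl_def by force
    then have 1: "card XH \<le> card H" using surj_card_le[OF fH] by blast
    have "\<Delta> * card H = (\<Sum>s\<in>H. \<Delta>)" by (simp add: mult.commute)
    also have "\<dots> \<le> (\<Sum>s\<in>H. card {s' \<in> Sl. f s = f s'})"
    proof (rule sum_mono)
      fix s assume "s \<in> H"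
      then have "\<Delta> < card {s' \<in> Sl. f s' = f s}" unfolding H_def by simp
      also have "{s' \<in> Sl. f s' = f s} = {s' \<in> Sl. f s = f s'}" by auto
      finally show "\<Delta> \<le> card {s' \<in> Sl. f s = f s'}" by simp
    qed
    also have "\<dots> = card (SIGMA s:H. {s' \<in> Sl. f s = f s'})" using fH fSl by (subst card_SigmaI) auto
    also have "\<dots> \<le> card {z \<in> Sl \<times> Sl. f (fst z) = f (snd z)}"
      by (rule card_mono) (use fSl in \<open>auto simp: H_def\<close>)
    also have "\<dots> \<le> 8 * (\<mu> * r)\<^sup>2 * N" by (rule f(4))
    finally have "\<Delta> * card H \<le> 8 * (\<mu> * r)\<^sup>2 * N" .
    then have "(8 * \<mu> * r\<^sup>2) * (4 * card H) \<le> (8 * \<mu> * r\<^sup>2) * M"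
      unfolding \<Delta>_def M_def by (simp add: power2_eq_square mult_ac)
    then have "4 * card H \<le> M" using \<mu> r by simp
    then show ?thesis using 1 by linarith
  qed
  have fin: "finite XS" "finite XH"
  proof -
    show "finite XH" unfolding XH_def by simp
    have "XS \<subseteq> {..<M}" unfolding XS_def configs_def by auto
    then show "finite XS" using finite_subset by blast
  qed
  have cJ: "M \<le> 2 * card J"
  proof -
    have "M - card XS - card XH \<le> card J"
      unfolding J_def using diff_card_le_card_Diff[OF fin(1), of "{..<M}"] diff_card_le_card_Diff[OF fin(2), of "{..<M} - XS"]
      by simp
    then show ?thesis using cXS cXH by linarith
  qed
  have noS: "\<not> hits f (XE, XV, I)" if "(XE, XV, I) \<in> configs M N A m m" "1 \<le> m" "m \<le> R" "XE \<inter> J \<noteq> {}" for XE XV I m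
  proof
    assume "hits f (XE, XV, I)"
    then have "XE \<subseteq> XS" unfolding XS_def using that(1,2,3)
      by (intro subsetI UN_I[of m] UN_I[of "(XE, XV, I)"]) auto
    then show False using that(4) unfolding J_def by blast
  qed
  let ?inc = "\<lambda>j. (\<lambda>a. f (j, a)) ` A"
  \<comment> \<open>Vertices outside \<open>{..<N}\<close> carry no incidences and are dropped,
    because configurations only contain vertices below \<open>N\<close>.\<close>
  have slots: "\<exists>I. (XE, XV \<inter> {..<N}, I) \<in> configs M N A (card XE + card (XV \<inter> {..<N})) i \<and> hits f (XE, XV \<inter> {..<N}, I)"
    if XE: "XE \<subseteq> J" and i: "i \<le> incid ?inc XE XV" for XE XV i
  proof -
    let ?P = "{(e, v). e \<in> XE \<and> v \<in> XV \<and> v \<in> ?inc e}"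
    let ?I = "{s \<in> XE \<times> A. f s \<in> XV}"
    have XM: "XE \<subseteq> {..<M}" using XE unfolding J_def by auto
    have fI: "finite ?I" by (rule finite_subset[of _ "XE \<times> A"]) (use XM A finite_subset in auto)
    have "?P \<subseteq> (\<lambda>s. (fst s, f s)) ` ?I" by force
    then have "incid ?inc XE XV \<le> card ?I" unfolding incid_def using surj_card_le[OF fI] by blast
    then obtain I where I: "I \<subseteq> ?I" "card I = i" using i by (meson le_trans obtain_subset_with_card_n)
    have "(XE, XV \<inter> {..<N}, I) \<in> configs M N A (card XE + card (XV \<inter> {..<N})) i"
      unfolding configs_def using XM I by auto
    moreover have "hits f (XE, XV \<inter> {..<N}, I)" unfolding hits_def using I(1) XM fN by auto
    ultimately show ?thesis by blast
  qed
  have incid0: "incid ?inc {} XV = 0" for XV unfolding incid_def by simp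
  have Nle: "card (XV \<inter> {..<N}) \<le> card XV" if "finite XV" for XV by (rule card_mono) (use that in auto)
  have incid1: "incid ?inc XE XV = 0" if XE: "XE \<subseteq> J" and z': "XV \<inter> {..<N} = {}" for XE XV
  proof -
    have "{(e, v). e \<in> XE \<and> v \<in> XV \<and> v \<in> ?inc e} = {}"
    proof (rule equals0I)
      fix z assume "z \<in> {(e, v). e \<in> XE \<and> v \<in> XV \<and> v \<in> ?inc e}"
      then obtain j a where ja: "j \<in> XE" "a \<in> A" "f (j, a) \<in> XV" by auto
      then have "j < M" using XE unfolding J_def by auto
      then show False using fN ja z' by blast
    qed
    then show ?thesis unfolding incid_def by (metis card.empty)
  qed
  show thesis
  proof (rule that[of J "\<lambda>j a. f (j, a)"])
    show "J \<subseteq> {..<\<mu> * N}" unfolding J_def M_def by auto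
    show "\<mu> * N \<le> 2 * card J" using cJ unfolding M_def .
    show "f (j, a) < N" if "j \<in> J" "a \<in> A" for j a using fN that unfolding J_def by auto
    show "inj_on (\<lambda>a. f (j, a)) A" if j: "j \<in> J" for j
    proof (rule inj_onI, rule ccontr)
      fix a b assume ab: "a \<in> A" "b \<in> A" "f (j, a) = f (j, b)" "a \<noteq> b"
      have jM: "j < M" using j unfolding J_def by auto
      \<comment> \<open>A vertex repeated within one hyperedge is itself a short cycle: one
        hyperedge and one vertex with two incidences.\<close>
      have "({j}, {f (j, a)}, {(j, a), (j, b)}) \<in> configs M N A 2 2"
        unfolding configs_def using ab jM fN[OF jM ab(1)] by auto
      then have "\<not> hits f ({j}, {f (j, a)}, {(j, a), (j, b)})" by (rule noS) (use R j in auto)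
      then show False using ab unfolding hits_def by auto
    qed
    show "incid ?inc XE XV < card XE + card XV"
      if XE: "XE \<subseteq> J" and fV: "finite XV" and pos: "0 < card XE + card XV" and le: "card XE + card XV \<le> R" for XE XV
    proof (cases "XE = {}")
      case True
      then show ?thesis using pos incid0 by simp
    next
      case False
      have fE: "finite XE" using XE unfolding J_def by (meson Diff_subset finite_lessThan finite_subset)
      have m: "1 \<le> card XE + card (XV \<inter> {..<N})" "card XE + card (XV \<inter> {..<N}) \<le> R"
        using False fE Nle[OF fV] le by (auto simp: Suc_le_eq card_gt_0_iff)
      have "incid ?inc XE XV < card XE + card (XV \<inter> {..<N})"
      proof (rule ccontr)
        assume "\<not> ?thesis"
        then have "card XE + card (XV \<inter> {..<N}) \<le> incid ?inc XE XV" by simp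
        from slots[OF XE this] obtain I where I: "(XE, XV \<inter> {..<N}, I) \<in> configs M N A (card XE + card (XV \<inter> {..<N})) (card XE + card (XV \<inter> {..<N}))"
          "hits f (XE, XV \<inter> {..<N}, I)" by blast
        show False using noS[OF I(1) m] I(2) False XE by blast
      qed
      then show ?thesis using Nle[OF fV] by linarith
    qed
    show "5 * incid ?inc XE XV \<le> 6 * (card XE + card XV)"
      if XE: "XE \<subseteq> J" and fV: "finite XV" and le: "card XE + card XV \<le> m0" for XE XV
    proof (cases "XV \<inter> {..<N} = {}")
      case True
      then show ?thesis using incid1[OF XE] by simp
    next
      case False
      define m where "m = card XE + card (XV \<inter> {..<N})"
      have m: "1 \<le> m" "m \<le> m0"
        using False fV Nle[OF fV] le unfolding m_def by (auto simp: Suc_le_eq card_gt_0_iff)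
      have "incid ?inc XE XV < m + (m + 4) div 5"
      proof (rule ccontr)
        assume "\<not> ?thesis"
        then have "m + (m + 4) div 5 \<le> incid ?inc XE XV" by simp
        from slots[OF XE this] obtain I where I: "(XE, XV \<inter> {..<N}, I) \<in> configs M N A m (m + (m + 4) div 5)"
          "hits f (XE, XV \<inter> {..<N}, I)" unfolding m_def by blast
        show False using f(2) m I by blast
      qed
      moreover have "5 * ((m + 4) div 5) \<le> m + 4" by simp
      ultimately have "5 * incid ?inc XE XV \<le> 6 * m" by linarith
      also have "\<dots> \<le> 6 * (card XE + card XV)"
        using Nle[OF fV] unfolding m_def by (intro mult_left_mono add_left_mono) auto
      finally show ?thesis .
    qed
    show "card {j \<in> J. v \<in> ?inc j} \<le> 32 * \<mu> * (card A)\<^sup>2" for v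
    proof (cases "{j \<in> J. v \<in> ?inc j} = {}")
      case False
      then obtain j a where ja: "j \<in> J" "a \<in> A" "v = f (j, a)" by blast
      have fv: "finite {s \<in> Sl. f s = v}" using fSl by simp
      have "{j \<in> J. v \<in> ?inc j} \<subseteq> fst ` {s \<in> Sl. f s = v}"
      proof
        fix j assume "j \<in> {j \<in> J. v \<in> ?inc j}"
        then obtain a where "j \<in> J" "a \<in> A" "v = f (j, a)" by blast
        then have "(j, a) \<in> {s \<in> Sl. f s = v}" unfolding J_def Sl_def by auto
        then show "j \<in> fst ` {s \<in> Sl. f s = v}" by force
      qed
      then have "card {j \<in> J. v \<in> ?inc j} \<le> card {s \<in> Sl. f s = v}" using surj_card_le[OF fv] by blast
      also have "\<dots> \<le> \<Delta>" using ja unfolding J_def XH_def by auto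
      finally show ?thesis unfolding \<Delta>_def r_def .
    next
      case True
      show ?thesis unfolding True by simp
    qed
  qed
qed

section \<open>From loose cycles and gadgets to induced cycles\<close>

fun pedges :: "'v list \<Rightarrow> 'v set set" where
  "pedges (x # y # zs) = insert {x, y} (pedges (y # zs))"
| "pedges _ = {}"

lemma pedges_Cons: "ys \<noteq> [] \<Longrightarrow> pedges (x # ys) = insert {x, hd ys} (pedges ys)"
  by (cases ys) auto

lemma pedges_append:
  "xs \<noteq> [] \<Longrightarrow> ys \<noteq> [] \<Longrightarrow> last xs = hd ys \<Longrightarrow> pedges (butlast xs @ ys) = pedges xs \<union> pedges ys"
proof (induction xs rule: pedges.induct)
  case (1 x y zs)
  have hd: "hd (butlast (y # zs) @ ys) = y" using 1(4) by (cases zs) auto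
  have IH: "pedges (butlast (y # zs) @ ys) = pedges (y # zs) \<union> pedges ys" using 1 by auto
  have "pedges (butlast (x # y # zs) @ ys) = pedges (x # (butlast (y # zs) @ ys))" by simp
  also have "\<dots> = insert {x, y} (pedges (butlast (y # zs) @ ys))"
    by (subst pedges_Cons) (use 1 hd in auto)
  finally show ?case using IH by auto
qed auto

lemma pedges_snoc: "xs \<noteq> [] \<Longrightarrow> pedges (xs @ [x]) = insert {last xs, x} (pedges xs)"
  by (induction xs rule: pedges.induct) auto

lemma pedges_rev [simp]: "pedges (rev xs) = pedges xs"
proof (induction xs rule: pedges.induct)
  case (1 x y zs)
  have "pedges (rev (x # y # zs)) = pedges (rev (y # zs) @ [x])" by simp
  also have "\<dots> = insert {last (rev (y # zs)), x} (pedges (rev (y # zs)))" by (rule pedges_snoc) simp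
  finally show ?case using 1 by (simp add: insert_commute)
qed auto

lemma pedges_map: "pedges (map f xs) = (`) f ` pedges xs"
  by (induction xs rule: pedges.induct) auto

lemma pedges_subset: "e \<in> pedges xs \<Longrightarrow> e \<subseteq> set xs"
  by (induction xs rule: pedges.induct) auto

lemma pedges_nth: "pedges xs = {{xs ! i, xs ! Suc i} | i. Suc i < length xs}"
proof (induction xs rule: pedges.induct)
  case (1 x y zs)
  have "{{(x # y # zs) ! i, (x # y # zs) ! Suc i} | i. Suc i < length (x # y # zs)}
      = insert {x, y} {{(y # zs) ! i, (y # zs) ! Suc i} | i. Suc i < length (y # zs)}" (is "?L = ?R")
  proof (intro equalityI subsetI)
    fix e assume "e \<in> ?L"
    then obtain i where i: "e = {(x # y # zs) ! i, (x # y # zs) ! Suc i}" "Suc i < length (x # y # zs)" by blast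
    show "e \<in> ?R"
    proof (cases i)
      case (Suc j)
      then show ?thesis using i by auto
    qed (use i in auto)
  next
    fix e assume "e \<in> ?R"
    then consider "e = {x, y}" | i where "e = {(y # zs) ! i, (y # zs) ! Suc i}" "Suc i < length (y # zs)" by blast
    then show "e \<in> ?L"
    proof cases
      case 1
      then show ?thesis by (intro CollectI exI[of _ 0]) auto
    next
      case 2
      then show ?thesis by (intro CollectI exI[of _ "Suc i"]) auto
    qed
  qed
  then show ?case using 1 by simp
qed auto

text \<open>Neighbouring lists share an end, so dropping the last entry of each and restoring only
  the final one glues them without repeating a vertex.\<close>

lemma pedges_concat:
  "Ls \<noteq> [] \<Longrightarrow> (\<And>L. L \<in> set Ls \<Longrightarrow> 2 \<le> length L) \<Longrightarrow> successively (\<lambda>L M. last L = hd M) Ls \<Longrightarrow>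
     pedges (concat (map butlast Ls) @ [last (last Ls)]) = (\<Union>L\<in>set Ls. pedges L)"
proof (induction Ls rule: induct_list012)
  case (2 L)
  then have "L \<noteq> []" by auto
  then show ?case by simp
next
  case (3 L M Ls)
  let ?T = "concat (map butlast (M # Ls)) @ [last (last (M # Ls))]"
  have IH: "pedges ?T = (\<Union>L\<in>set (M # Ls). pedges L)" by (rule 3(2)) (use 3 in auto)
  have M2: "2 \<le> length M" and L2: "2 \<le> length L" using 3(4) by auto
  have "hd ?T = hd M" using M2 by (cases M) (auto simp: Suc_le_length_iff)
  moreover have "last L = hd M" using 3(5) by simp
  ultimately have "pedges (butlast L @ ?T) = pedges L \<union> pedges ?T"
    by (intro pedges_append) (use L2 in auto)
  then show ?case using IH by simp
qed auto

definition ipath :: "'v set set \<Rightarrow> 'v list \<Rightarrow> bool" where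
  "ipath D xs \<longleftrightarrow> distinct xs \<and> {d \<in> D. d \<subseteq> set xs} = pedges xs"

lemma ipath_rev [simp]: "ipath D (rev xs) \<longleftrightarrow> ipath D xs"
  unfolding ipath_def by simp

text \<open>In every \<open>k\<close>-colouring of the gadget there are two vertices joined, in one colour, by an induced
  path with two edges and by an induced path with \<open>\<delta> + 2\<close> edges. The length of a cycle through many
  copies can thus be adjusted in steps of \<open>\<delta>\<close>.\<close>

definition gadget :: "'a set \<Rightarrow> 'a set set \<Rightarrow> nat \<Rightarrow> nat \<Rightarrow> bool" where
  "gadget A D k \<delta> \<longleftrightarrow> finite A \<and> (\<forall>d\<in>D. d \<subseteq> A \<and> card d = 2) \<and>
     (\<forall>c. (\<forall>d\<in>D. c d < k) \<longrightarrow> (\<exists>a x m y zs. length zs = Suc \<delta> \<and> {x, m, y} \<subseteq> A \<and> set zs \<subseteq> A \<and>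
        ipath D [x, m, y] \<and> ipath D (x # zs @ [y]) \<and> (\<forall>e\<in>pedges [x, m, y] \<union> pedges (x # zs @ [y]). c e = (a :: nat))))"

lemma cycle_graph_iso:
  fixes Ed :: "nat set set"
  assumes U: "distinct U" "length U = n" "0 < n"
    and Ed: "{e \<in> Ed. e \<subseteq> set U} = pedges (U @ [hd U])"
  shows "graph_iso (induced_subgraph (V, Ed) (set U)) (cycle_graph n)"
proof -
  define g where "g i = U ! i" for i
  have bij: "bij_betw g {..<n} (set U)" unfolding g_def by (rule bij_betw_nth) (use U in auto)
  have inj: "inj_on g {..<n}" and img: "g ` {..<n} = set U" using bij unfolding bij_betw_def by auto
  define C where "C = {{i, Suc i mod n} | i. i < n}"
  have gC: "pedges (U @ [hd U]) = (`) g ` C"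
  proof -
    have "pedges (U @ [hd U]) = {{(U @ [hd U]) ! i, (U @ [hd U]) ! Suc i} | i. i < n}"
      unfolding pedges_nth using U by auto
    also have "\<dots> = {{g i, g (Suc i mod n)} | i. i < n}"
    proof -
      have "(U @ [hd U]) ! i = g i \<and> (U @ [hd U]) ! Suc i = g (Suc i mod n)" if "i < n" for i
      proof (cases "Suc i = n")
        case True
        have "hd U = U ! 0" using U by (intro hd_conv_nth) auto
        then show ?thesis using True U unfolding g_def by (auto simp: nth_append)
      next
        case False
        then show ?thesis using that U unfolding g_def by (auto simp: nth_append)
      qed
      then show ?thesis by (metis (no_types, lifting))
    qed
    also have "\<dots> = (`) g ` C" unfolding C_def by (auto simp: image_iff) (metis image_insert image_empty)+
    finally show ?thesis .
  qed
  define h where "h = inv_into {..<n} g"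
  have hg: "h (g i) = i" if "i < n" for i unfolding h_def by (rule inv_into_f_f[OF inj]) (use that in auto)
  have bh: "bij_betw h (set U) {..<n}" unfolding h_def by (rule bij_betw_inv_into[OF bij])
  have key: "{u, v} \<in> {e \<in> Ed. e \<subseteq> set U} \<longleftrightarrow> {h u, h v} \<in> C" if uv: "u \<in> set U" "v \<in> set U" for u v
  proof -
    obtain i j where ij: "i < n" "u = g i" "j < n" "v = g j" using uv img by (metis imageE lessThan_iff)
    have Csub: "c \<subseteq> {..<n}" if "c \<in> C" for c using that U(3) unfolding C_def by auto
    have "{u, v} \<in> (`) g ` C \<longleftrightarrow> {i, j} \<in> C"
    proof
      assume "{u, v} \<in> (`) g ` C"
      then obtain c where c: "c \<in> C" "g ` {i, j} = g ` c" using ij by auto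
      have "{i, j} = c" using inj_on_image_eq_iff[OF inj, of "{i, j}" c] Csub[OF c(1)] ij c(2) by auto
      then show "{i, j} \<in> C" using c by simp
    next
      assume "{i, j} \<in> C"
      then have "g ` {i, j} \<in> (`) g ` C" by (rule imageI)
      then show "{u, v} \<in> (`) g ` C" using ij by simp
    qed
    then show ?thesis unfolding Ed gC using hg ij by simp
  qed
  show ?thesis
    unfolding graph_iso_def induced_subgraph_def cycle_graph_def
    using bh key unfolding C_def by (intro exI[of _ h]) auto
qed

text \<open>Each hyperedge of the loose cycle is replaced by an induced path of its gadget copy. An
  edge of the host inside \<open>U\<close> belongs to some hyperedge. If that lies outside the
  cycle, it has at most one vertex in the shadow of the cycle, too few for an edge. If it is on the
  cycle, looseness leaves it no vertices of \<open>U\<close> except those of its own path, and that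
  path is induced.\<close>

lemma induced_cycle_from_loose_cycle:
  fixes f :: "nat \<Rightarrow> 'a \<Rightarrow> nat"
  assumes lc: "loose_cycle J (\<lambda>j. f j ` A) en vs es"
    and inj: "\<And>j. j \<in> J \<Longrightarrow> inj_on (f j) A" and D: "\<And>d. d \<in> D \<Longrightarrow> d \<subseteq> A \<and> card d = 2"
    and P: "\<And>i. i < length es \<Longrightarrow> ipath D (P i) \<and> set (P i) \<subseteq> A \<and> 2 \<le> length (P i) \<and>
       f (es ! i) (hd (P i)) = vs ! i \<and> f (es ! i) (last (P i)) = vs ! (Suc i mod length es)"
    and t: "0 < length es"
  obtains U where "distinct U" "length U = (\<Sum>i<length es. length (P i) - 1)"
    "set U \<subseteq> (\<Union>j\<in>J. f j ` A)"
    "{e. (\<exists>j\<in>J. \<exists>d\<in>D. e = f j ` d) \<and> e \<subseteq> set U} = pedges (U @ [hd U])"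
    "pedges (U @ [hd U]) = (\<Union>i<length es. (`) (f (es ! i)) ` pedges (P i))"
proof -
  let ?inc = "\<lambda>j. f j ` A"
  define t where "t = length es"
  have t0: "0 < t" using t unfolding t_def .
  have lv: "length vs = t" and dv: "distinct vs" and de: "distinct es" and esJ: "set es \<subseteq> J"
    and en: "\<And>i. i < t \<Longrightarrow> en (es ! i) = {vs ! i, vs ! (Suc i mod t)}"
    and loose: "\<And>e e'. e \<in> set es \<Longrightarrow> e' \<in> set es \<Longrightarrow> e \<noteq> e' \<Longrightarrow> ?inc e \<inter> ?inc e' \<subseteq> en e \<inter> en e'"
    and out: "\<And>g. g \<in> J - set es \<Longrightarrow> meets_once ?inc g (set es)"
    using lc unfolding loose_cycle_def t_def by auto
  define L where "L i = map (f (es ! i)) (P i)" for i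
  have esi: "es ! i \<in> J" "es ! i \<in> set es" if "i < t" for i using that esJ unfolding t_def by auto
  have PP: "ipath D (P i)" "set (P i) \<subseteq> A" "2 \<le> length (P i)" "P i \<noteq> []" if "i < t" for i
    using P[of i] that unfolding t_def by auto
  have Lhd: "hd (L i) = vs ! i" and Llast: "last (L i) = vs ! (Suc i mod t)" and Llen: "length (L i) = length (P i)" if "i < t" for i
    unfolding L_def using P[of i] that PP(4)[OF that] unfolding t_def by (auto simp: hd_map last_map)
  have Lset: "set (L i) \<subseteq> ?inc (es ! i)" if "i < t" for i unfolding L_def using PP[OF that] by auto
  have Ldist: "distinct (L i)" if "i < t" for i
    unfolding L_def using PP(1,2)[OF that] inj[OF esi(1)[OF that]]
    by (auto simp: distinct_map ipath_def intro: inj_on_subset)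
  have Lne: "L i \<noteq> []" if "i < t" for i using PP(4)[OF that] unfolding L_def by simp
  define Ls where "Ls = map L [0..<t]"
  define U where "U = concat (map butlast Ls)"
  have Ls_ne: "Ls \<noteq> []" unfolding Ls_def using t0 by simp
  have Ls_nth: "Ls ! i = L i" if "i < t" for i unfolding Ls_def using that by simp
  have Ls_set: "set Ls = L ` {..<t}" unfolding Ls_def by (simp add: atLeast0LessThan)
  have lenLs: "length Ls = t" unfolding Ls_def by simp
  have bl: "L i = butlast (L i) @ [last (L i)]" if "i < t" for i using Lne[OF that] by simp
  \<comment> \<open>Different hyperedges share only joints, and the final vertex of each list has
    been cut off, so a common entry would be the initial joint of both.\<close>
  have shared: "x = vs ! i \<and> x = vs ! j" if "i < t" "j < t" "i \<noteq> j" "x \<in> set (butlast (L i))" "x \<in> set (butlast (L j))" for i j x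
  proof -
    have one: "x = vs ! i" if ij: "i < t" "j < t" "i \<noteq> j" "x \<in> set (butlast (L i))" "x \<in> set (L j)" for i j
    proof -
      have ne: "es ! i \<noteq> es ! j" using de ij unfolding t_def by (simp add: nth_eq_iff_index_eq)
      have "x \<in> ?inc (es ! i) \<inter> ?inc (es ! j)" using Lset ij in_set_butlastD by fast
      then have "x \<in> en (es ! i)" using loose[OF esi(2) esi(2) ne] ij by blast
      then have "x = vs ! i \<or> x = last (L i)" using en ij Llast by auto
      moreover have "x \<noteq> last (L i)" using Ldist[OF ij(1)] ij(4) by (subst (asm) bl[OF ij(1)]) auto
      ultimately show ?thesis by simp
    qed
    show ?thesis using one[OF that(1,2,3,4)] one[OF that(2,1) _ that(5)] that in_set_butlastD by metis
  qed
  have bdisj: "set (butlast (L i)) \<inter> set (butlast (L j)) = {}" if "i < t" "j < t" "i \<noteq> j" for i j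
  proof (rule equals0I)
    fix x assume "x \<in> set (butlast (L i)) \<inter> set (butlast (L j))"
    then have "vs ! i = vs ! j" using shared[OF that] by blast
    then show False using dv lv that by (simp add: nth_eq_iff_index_eq)
  qed
  have hd_in: "vs ! i \<in> set (butlast (L i))" if i: "i < t" for i
  proof -
    obtain a b zs where "L i = a # b # zs" using PP(3)[OF i] Llen[OF i]
      by (metis Suc_le_length_iff numeral_2_eq_2)
    then show ?thesis using Lhd[OF i] by auto
  qed
  have distU: "distinct U"
    unfolding U_def
  proof (rule distinct_concat)
    show "distinct (map butlast Ls)"
      unfolding distinct_conv_nth
    proof (intro allI impI)
      fix i j assume "i < length (map butlast Ls)" "j < length (map butlast Ls)" "i \<noteq> j"
      then have ij: "i < t" "j < t" "i \<noteq> j" using lenLs by auto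
      have "butlast (L i) \<noteq> butlast (L j)" using bdisj[OF ij] hd_in[OF ij(1)] by auto
      then show "map butlast Ls ! i \<noteq> map butlast Ls ! j" using ij lenLs Ls_nth by simp
    qed
    show "distinct ys" if "ys \<in> set (map butlast Ls)" for ys
      using that Ldist unfolding set_map Ls_set by (auto intro: distinct_butlast)
    show "set ys \<inter> set zs = {}" if yz: "ys \<in> set (map butlast Ls)" "zs \<in> set (map butlast Ls)" "ys \<noteq> zs" for ys zs
    proof -
      obtain i j where "i < t" "ys = butlast (L i)" "j < t" "zs = butlast (L j)"
        using yz(1,2) unfolding set_map Ls_set by auto
      then show ?thesis using bdisj yz(3) by blast
    qed
  qed
  have lenU: "length U = (\<Sum>i<t. length (P i) - 1)"
    unfolding U_def Ls_def using Llen
    by (simp add: length_concat o_def sum_list_distinct_conv_sum_set atLeast0LessThan)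
  have U_eq: "set U = (\<Union>i<t. set (butlast (L i)))" unfolding U_def set_concat set_map Ls_set by auto
  have LU: "set (L i) \<subseteq> set U" if i: "i < t" for i
  proof -
    have "last (L i) = vs ! (Suc i mod t)" by (rule Llast[OF i])
    moreover have "vs ! (Suc i mod t) \<in> set (butlast (L (Suc i mod t)))" by (rule hd_in) (use t0 in simp)
    ultimately have "last (L i) \<in> set U" unfolding U_eq using t0 by (metis UN_iff lessThan_iff mod_less_divisor)
    moreover have "set (butlast (L i)) \<subseteq> set U" unfolding U_eq using i by blast
    moreover have "set (L i) = insert (last (L i)) (set (butlast (L i)))" by (subst bl[OF i]) auto
    ultimately show ?thesis by simp
  qed
  have UL: "x \<in> set (L i)" if x: "x \<in> set U" "x \<in> ?inc (es ! i)" and i: "i < t" for x i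
  proof -
    obtain j where j: "j < t" "x \<in> set (butlast (L j))" using x(1) unfolding U_eq by auto
    show ?thesis
    proof (cases "i = j")
      case True
      then show ?thesis using j in_set_butlastD by fast
    next
      case False
      then have ne: "es ! i \<noteq> es ! j" using de i j unfolding t_def by (simp add: nth_eq_iff_index_eq)
      have "x \<in> ?inc (es ! j)" using Lset[OF j(1)] j(2) in_set_butlastD by fast
      then have "x \<in> en (es ! i)" using loose[OF esi(2)[OF i] esi(2)[OF j(1)] ne] x(2) by blast
      then have "x = hd (L i) \<or> x = last (L i)" using en[OF i] Lhd[OF i] Llast[OF i] by auto
      then show ?thesis using Lne[OF i] by auto
    qed
  qed
  have hdU: "hd U = last (last Ls)"
  proof -
    have "hd U = vs ! 0"
    proof -
      obtain s where s: "t = Suc s" using t0 by (cases t) auto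
      have "Ls = L 0 # map L [1..<t]" unfolding Ls_def using t0 by (simp add: upt_rec)
      then have "U = butlast (L 0) @ concat (map butlast (map L [1..<t]))" unfolding U_def by simp
      moreover have "butlast (L 0) \<noteq> []" using hd_in[OF t0] by auto
      ultimately have "hd U = hd (butlast (L 0))" by simp
      also have "\<dots> = hd (L 0)" using \<open>butlast (L 0) \<noteq> []\<close> by (subst (2) bl[OF t0]) simp
      finally show ?thesis using Lhd[OF t0] by simp
    qed
    moreover have "last Ls = L (t - 1)" using Ls_ne lenLs Ls_nth t0 by (simp add: last_conv_nth)
    moreover have "last (L (t - 1)) = vs ! 0" using Llast[of "t - 1"] t0 by simp
    ultimately show ?thesis by simp
  qed
  have pU: "pedges (U @ [hd U]) = (\<Union>i<t. pedges (L i))"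
  proof -
    have "pedges (concat (map butlast Ls) @ [last (last Ls)]) = (\<Union>L\<in>set Ls. pedges L)"
    proof (rule pedges_concat[OF Ls_ne])
      show "2 \<le> length l" if "l \<in> set Ls" for l using that PP(3) Llen unfolding Ls_set by auto
      show "successively (\<lambda>L M. last L = hd M) Ls"
        unfolding successively_conv_nth lenLs using Ls_nth Llast Lhd by auto
    qed
    then have "pedges (U @ [last (last Ls)]) = (\<Union>L\<in>set Ls. pedges L)" unfolding U_def .
    then show ?thesis unfolding hdU Ls_set by simp
  qed
  have pL: "pedges (L i) = (`) (f (es ! i)) ` pedges (P i)" for i unfolding L_def by (rule pedges_map)
  have sub1: "\<exists>j\<in>J. \<exists>d\<in>D. e = f j ` d" and sub2: "e \<subseteq> set U" if e: "e \<in> pedges (U @ [hd U])" for e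
  proof -
    obtain i where i: "i < t" "e \<in> pedges (L i)" using e unfolding pU by auto
    then obtain d where d: "d \<in> pedges (P i)" "e = f (es ! i) ` d" unfolding pL by auto
    have "d \<in> D" using d(1) PP(1)[OF i(1)] unfolding ipath_def by auto
    then show "\<exists>j\<in>J. \<exists>d\<in>D. e = f j ` d" using d(2) esi(1)[OF i(1)] by blast
    show "e \<subseteq> set U" using pedges_subset[OF i(2)] LU[OF i(1)] by simp
  qed
  have sup: "f j ` d \<in> pedges (U @ [hd U])" if j: "j \<in> J" and d: "d \<in> D" and sU: "f j ` d \<subseteq> set U" for j d
  proof -
    have dA: "d \<subseteq> A" "card d = 2" using D[OF d] by auto
    have incU: "set U \<subseteq> shadow ?inc (set es)"
    proof
      fix x assume "x \<in> set U"
      then obtain i where i: "i < t" "x \<in> set (butlast (L i))" unfolding U_eq by auto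
      then have "x \<in> ?inc (es ! i)" using Lset in_set_butlastD by fast
      then show "x \<in> shadow ?inc (set es)" using inc_subset_shadow[OF esi(2)[OF i(1)], of ?inc] by blast
    qed
    obtain a b where ab: "d = {a, b}" "a \<noteq> b" using dA(2) by (auto simp: card_2_iff)
    have fab: "f j a \<noteq> f j b" using inj[OF j] ab dA(1) by (auto dest: inj_onD)
    have jes: "j \<in> set es"
    proof (rule ccontr)
      assume "j \<notin> set es"
      then have "meets_once ?inc j (set es)" using out j by simp
      then have "f j a = f j b" by (rule meets_onceD) (use ab dA sU incU in auto)
      then show False using fab by simp
    qed
    then obtain i where i: "i < t" "j = es ! i" unfolding t_def by (metis in_set_conv_nth)
    have "f j ` d \<subseteq> set (L i)" using UL[OF _ _ i(1)] sU dA(1) i(2) by blast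
    then have "f j ` d \<subseteq> f j ` set (P i)" unfolding L_def i(2) by simp
    then have "d \<subseteq> set (P i)"
      using inj_on_image_mem_iff[OF inj[OF j] _ PP(2)[OF i(1)]] dA(1) by blast
    then have "d \<in> pedges (P i)" using d PP(1)[OF i(1)] unfolding ipath_def by auto
    then show ?thesis unfolding pU pL using i by auto
  qed
  show thesis
  proof (rule that[of U])
    show "length U = (\<Sum>i<length es. length (P i) - 1)" using lenU unfolding t_def .
    show "set U \<subseteq> (\<Union>j\<in>J. f j ` A)"
    proof
      fix x assume "x \<in> set U"
      then obtain i where i: "i < t" "x \<in> set (butlast (L i))" unfolding U_eq by auto
      then have "x \<in> ?inc (es ! i)" using Lset in_set_butlastD by fast
      then show "x \<in> (\<Union>j\<in>J. f j ` A)" using esi(1)[OF i(1)] by blast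
    qed
    show "{e. (\<exists>j\<in>J. \<exists>d\<in>D. e = f j ` d) \<and> e \<subseteq> set U} = pedges (U @ [hd U])"
    proof (intro equalityI subsetI)
      fix e assume "e \<in> {e. (\<exists>j\<in>J. \<exists>d\<in>D. e = f j ` d) \<and> e \<subseteq> set U}"
      then obtain j d where "j \<in> J" "d \<in> D" "e = f j ` d" "e \<subseteq> set U" by blast
      then show "e \<in> pedges (U @ [hd U])" using sup[of j d] by simp
    next
      fix e assume "e \<in> pedges (U @ [hd U])"
      then show "e \<in> {e. (\<exists>j\<in>J. \<exists>d\<in>D. e = f j ` d) \<and> e \<subseteq> set U}" using sub1 sub2 by simp
    qed
    show "pedges (U @ [hd U]) = (\<Union>i<length es. (`) (f (es ! i)) ` pedges (P i))"
      using pU pL unfolding t_def by simp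
  qed (rule distU)
qed

section \<open>The host graph\<close>

lemma pigeonhole_colour:
  assumes "finite J" "0 < k" "\<And>j. j \<in> J \<Longrightarrow> col j < (k :: nat)"
  obtains a where "a < k" "card J \<le> k * card {j \<in> J. col j = a}"
proof -
  have "\<exists>a<k. card J \<le> k * card {j \<in> J. col j = a}"
  proof (rule ccontr)
    assume "\<not> ?thesis"
    then have less: "k * card {j \<in> J. col j = a} < card J" if "a < k" for a using that by (meson not_le)
    have "J = (\<Union>a\<in>{..<k}. {j \<in> J. col j = a})" using assms(3) by auto
    then have "card J \<le> (\<Sum>a<k. card {j \<in> J. col j = a})"
      using card_UN_le[of "{..<k}" "\<lambda>a. {j \<in> J. col j = a}"] by simp
    then have "k * card J \<le> (\<Sum>a<k. k * card {j \<in> J. col j = a})" by (simp flip: sum_distrib_left)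
    also have "\<dots> < (\<Sum>a<k. card J)" by (rule sum_strict_mono) (use less assms(2) in auto)
    finally show False by simp
  qed
  then show thesis using that by blast
qed

lemma ind_size_ramsey_le:
  fixes G :: "nat graph"
  assumes "simple_graph G" "induced_ramsey k G H" "card (edges G) \<le> m"
  shows "ind_size_ramsey k H \<le> enat m"
proof -
  have "ind_size_ramsey k H \<le> enat (card (edges G))"
    unfolding ind_size_ramsey_def by (rule Inf_lower, rule CollectI, rule exI[of _ G]) (simp only: assms simp_thms)
  also have "\<dots> \<le> enat m" using assms(3) by simp
  finally show ?thesis .
qed

text \<open>Hyperedges per vertex: the popular colour needs \<open>600 * G\<close>, a factor
  \<open>k\<close> is lost by choosing that colour, and a factor 2 by the deletions.\<close>

definition host_density :: "nat \<Rightarrow> nat \<Rightarrow> nat" where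
  "host_density k G = 1200 * k * G"

text \<open>The number of vertices needed per object of the sparse range: the factor of
  \<open>m0\<close> in \<open>exists_sparse_hypergraph\<close>.\<close>

definition host_sparsity :: "nat \<Rightarrow> nat \<Rightarrow> nat \<Rightarrow> nat" where
  "host_sparsity k G r = 3 * r * (72 * (host_density k G + 1) * r) ^ 5"

text \<open>With the degree bound \<open>\<Delta> = 32 * \<mu> * r\<^sup>2\<close> this is
  \<open>(\<Delta> * r)\<^sup>2\<close>, which bounds the number of hyperedges within two steps of a
  given one. The trees have to outgrow the part of the host that is forbidden around the long
  path.\<close>

definition host_growth :: "nat \<Rightarrow> nat \<Rightarrow> nat \<Rightarrow> nat" where
  "host_growth k G r = (32 * host_density k G * r\<^sup>2)\<^sup>2 * r\<^sup>2"

text \<open>The host has this many vertices per unit of \<open>x0\<close>, just enough for a sparse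
  range of \<open>m0 = 2000 * (c1 * x0)\<close> objects.\<close>

definition host_factor :: "nat \<Rightarrow> nat \<Rightarrow> nat \<Rightarrow> nat" where
  "host_factor k G r = 2000 * host_growth k G r * host_sparsity k G r"

text \<open>A loose cycle with \<open>t\<close> hyperedges yields all lengths from 2t to (2 +
  \<delta>)t in steps of \<delta>. As t lies between \<open>18 * x0\<close> and
  \<open>20 * x0 + R\<close>, the bounds on \<open>n\<close> place it between 2t and 3t whatever t
  is.\<close>

lemma induced_ramsey_host:
  fixes A :: "'a set" and D :: "'a set set" and k \<delta> G x0 n :: nat
  defines "r \<equiv> card A" and "\<mu> \<equiv> host_density k G"
  defines "\<Lambda> \<equiv> host_factor k G r" and "c1 \<equiv> host_growth k G r"
  defines "R \<equiv> 2 * c1 + \<Lambda>"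
  assumes gad: "gadget A D k \<delta>" and k: "1 \<le> k" and \<delta>: "\<delta> = 1 \<or> \<delta> = 2" and dvd: "\<delta> dvd n"
    and G: "1 \<le> G" "2000 * host_sparsity k G r \<le> 2 ^ (G - 1)"
    and x0: "3 \<le> x0" "16 * real (2 * R + 3) * (\<Sum>m\<in>{1..2 * R + 3}. (9 * (real \<mu> + 1) * real r) ^ m) \<le> real x0"
    and n: "2 * (20 * x0 + R) \<le> n" "n \<le> 54 * x0"
  shows "ind_size_ramsey k (cycle_graph n) \<le> enat (\<mu> * (\<Lambda> * x0) * card D)"
proof -
  define \<Delta> where "\<Delta> = 32 * \<mu> * r\<^sup>2"
  define B where "B = host_sparsity k G r"
  define N where "N = \<Lambda> * x0"
  define m0 where "m0 = 2000 * (c1 * x0)"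
  have finA: "finite A" and D: "\<And>d. d \<in> D \<Longrightarrow> d \<subseteq> A \<and> card d = 2"
    and gad': "\<And>c. (\<forall>d\<in>D. c d < k) \<Longrightarrow> (\<exists>a x m y zs. length zs = Suc \<delta> \<and> {x, m, y} \<subseteq> A \<and> set zs \<subseteq> A \<and>
        ipath D [x, m, y] \<and> ipath D (x # zs @ [y]) \<and> (\<forall>e\<in>pedges [x, m, y] \<union> pedges (x # zs @ [y]). c e = (a :: nat)))"
    using gad unfolding gadget_def by blast+
  have Ane: "A \<noteq> {}" using gad'[of "\<lambda>_. 0"] k by auto
  have finD: "finite D" by (rule finite_subset[of _ "Pow A"]) (use D finA in auto)
  have r: "1 \<le> r" unfolding r_def using finA Ane by (simp add: Suc_le_eq card_gt_0_iff)
  have \<mu>: "1 \<le> \<mu>" unfolding \<mu>_def host_density_def using k G by simp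
  have c1eq: "c1 = \<Delta>\<^sup>2 * r\<^sup>2" unfolding c1_def host_growth_def \<Delta>_def \<mu>_def ..
  have \<Delta>1: "1 \<le> \<Delta>" unfolding \<Delta>_def using \<mu> r by simp
  have c1: "1 \<le> c1" unfolding c1eq using \<Delta>1 r by simp
  have B1: "1 \<le> B" unfolding B_def host_sparsity_def using r by simp
  have \<Lambda>eq: "\<Lambda> = 2000 * c1 * B" unfolding \<Lambda>_def host_factor_def c1_def B_def ..
  have \<Lambda>1: "1 \<le> \<Lambda>" unfolding \<Lambda>eq using c1 B1 by simp
  have xN: "x0 \<le> N" unfolding N_def using \<Lambda>1 by simp
  have N1: "1 \<le> N" using xN x0 by simp
  have Nbig: "16 * real (2 * R + 3) * (\<Sum>m\<in>{1..2 * R + 3}. (9 * (real \<mu> + 1) * real (card A)) ^ m) \<le> real N"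
    using x0(2) xN unfolding r_def by linarith
  have m0B: "m0 * (3 * card A * (72 * (\<mu> + 1) * card A) ^ 5) \<le> N"
  proof -
    have "3 * card A * (72 * (\<mu> + 1) * card A) ^ 5 = B" unfolding B_def host_sparsity_def r_def \<mu>_def ..
    then show ?thesis unfolding N_def \<Lambda>eq m0_def by simp
  qed
  \<comment> \<open>Short cycles are excluded up to \<open>2 * R + 3\<close> objects, which is what
    \<open>short_meets_once\<close> needs for families of \<open>R\<close> hyperedges.\<close>
  obtain f J where H: "J \<subseteq> {..<\<mu> * N}" "\<mu> * N \<le> 2 * card J"
    "\<And>j a. j \<in> J \<Longrightarrow> a \<in> A \<Longrightarrow> f j a < N" "\<And>j. j \<in> J \<Longrightarrow> inj_on (f j) A"
    "\<And>XE XV. XE \<subseteq> J \<Longrightarrow> finite XV \<Longrightarrow> 0 < card XE + card XV \<Longrightarrow> card XE + card XV \<le> 2 * R + 3 \<Longrightarrow>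
       incid (\<lambda>j. f j ` A) XE XV < card XE + card XV"
    "\<And>XE XV. XE \<subseteq> J \<Longrightarrow> finite XV \<Longrightarrow> card XE + card XV \<le> m0 \<Longrightarrow>
       5 * incid (\<lambda>j. f j ` A) XE XV \<le> 6 * (card XE + card XV)"
    "\<And>v. card {j \<in> J. v \<in> f j ` A} \<le> 32 * \<mu> * (card A)\<^sup>2"
    by (rule exists_sparse_hypergraph[OF finA Ane \<mu> N1 Nbig m0B]) (simp, blast)
  have finJ: "finite J" using H(1) finite_subset by blast
  let ?inc = "\<lambda>j. f j ` A"
  define Ed where "Ed = {e. \<exists>j\<in>J. \<exists>d\<in>D. e = f j ` d}"
  have Ed_eq: "Ed = (\<lambda>(j, d). f j ` d) ` (J \<times> D)" unfolding Ed_def by auto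
  have cEd: "card Ed \<le> \<mu> * (\<Lambda> * x0) * card D"
  proof -
    have "card Ed \<le> card (J \<times> D)" unfolding Ed_eq by (rule card_image_le) (use finJ finD in auto)
    also have "\<dots> = card J * card D" by (rule card_cartesian_product)
    also have "card J \<le> \<mu> * N" using card_mono[OF _ H(1)] by simp
    finally show ?thesis unfolding N_def by simp
  qed
  have simple: "simple_graph ({..<N}, Ed)"
    unfolding simple_graph_def
  proof (intro conjI ballI)
    fix e assume "e \<in> edges ({..<N}, Ed)"
    then obtain j d where jd: "j \<in> J" "d \<in> D" "e = f j ` d" unfolding Ed_def by auto
    show "e \<subseteq> verts ({..<N}, Ed)" using jd D[OF jd(2)] H(3)[OF jd(1)] by auto
    have "card (f j ` d) = card d" by (rule card_image) (use H(4)[OF jd(1)] D[OF jd(2)] inj_on_subset in blast)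
    then show "card e = 2" using jd D[OF jd(2)] by simp
  qed simp
  have short: "meets_once ?inc g S" if "conn ?inc S" "S \<subseteq> J" "card S \<le> R" "g \<in> J" "g \<notin> S" for S g
    by (rule short_meets_once[OF _ finJ that(2,1) _ that(4,5)]) (use H(5) that(3) in auto)
  have "induced_ramsey k ({..<N}, Ed) (cycle_graph n)"
    unfolding induced_ramsey_def
  proof
    fix c assume "c \<in> edges ({..<N}, Ed) \<rightarrow> {..<k}"
    then have c: "c (f j ` d) < k" if "j \<in> J" "d \<in> D" for j d using that unfolding Ed_def by auto
    have "\<forall>j\<in>J. \<exists>a x m y zs. length zs = Suc \<delta> \<and> {x, m, y} \<subseteq> A \<and> set zs \<subseteq> A \<and>
        ipath D [x, m, y] \<and> ipath D (x # zs @ [y]) \<and> (\<forall>e\<in>pedges [x, m, y] \<union> pedges (x # zs @ [y]). c (f j ` e) = a)"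
      using gad'[of "\<lambda>d. c (f _ ` d)"] c by blast
    then obtain col x m y zs where g: "\<And>j. j \<in> J \<Longrightarrow> length (zs j) = Suc \<delta> \<and> {x j, m j, y j} \<subseteq> A \<and> set (zs j) \<subseteq> A \<and>
        ipath D [x j, m j, y j] \<and> ipath D (x j # zs j @ [y j]) \<and>
        (\<forall>e\<in>pedges [x j, m j, y j] \<union> pedges (x j # zs j @ [y j]). c (f j ` e) = col j)"
      by metis
    have colk: "col j < k" if j: "j \<in> J" for j
    proof -
      have "{x j, m j} \<in> D" using g[OF j] unfolding ipath_def by auto
      then have "c (f j ` {x j, m j}) < k" by (rule c[OF j])
      moreover have "c (f j ` {x j, m j}) = col j" using g[OF j] by auto
      ultimately show ?thesis by simp
    qed
    obtain a where a: "a < k" "card J \<le> k * card {j \<in> J. col j = a}"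
      by (rule pigeonhole_colour[OF finJ _ colk]) (use k in auto)
    define S where "S = {j \<in> J. col j = a}"
    define en where "en j = {f j (x j), f j (y j)}" for j
    have fxy: "f j (x j) \<noteq> f j (y j)" if j: "j \<in> J" for j
    proof -
      have "x j \<noteq> y j" using g[OF j] unfolding ipath_def by auto
      then show ?thesis using H(4)[OF j] g[OF j] by (auto dest: inj_onD)
    qed
    have dense: "600 * (N * G) \<le> card S"
    proof -
      have "\<mu> * N \<le> 2 * (k * card S)" using H(2) a(2) unfolding S_def by linarith
      then have "(2 * k) * (600 * (N * G)) \<le> (2 * k) * card S" unfolding \<mu>_def host_density_def by (simp add: mult_ac)
      then show ?thesis using k by (simp add: mult_ac)
    qed
    obtain vs es where lc: "loose_cycle J ?inc en vs es" "set es \<subseteq> S" "18 * x0 \<le> length es" "length es \<le> 20 * x0 + R"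
    proof (rule loose_cycle_in_dense_family[of J ?inc r m0 R \<Delta> S en "{..<N}" \<Lambda> x0 G c1])
      show "card (?inc e) \<le> r" for e unfolding r_def by (rule card_image_le[OF finA])
      show "en e \<subseteq> ?inc e" if "e \<in> S" for e using g[of e] that unfolding S_def en_def by auto
      show "card (en e) = 2" if "e \<in> S" for e using fxy[of e] that unfolding S_def en_def by auto
      show "en e \<subseteq> {..<N}" if "e \<in> S" for e using g[of e] H(3)[of e] that unfolding S_def en_def by auto
      show "600 * (card {..<N} * G) \<le> card S" using dense by simp
      show "card {..<N} \<le> 2 ^ (G - 1) * (c1 * x0)"
      proof -
        have "N = (2000 * B) * (c1 * x0)" unfolding N_def \<Lambda>eq by simp
        also have "\<dots> \<le> 2 ^ (G - 1) * (c1 * x0)" using G(2) unfolding B_def by (rule mult_right_mono) simp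
        finally show ?thesis by simp
      qed
      show "\<Delta> * r * (\<Delta> * r * (20 * x0)) + \<Delta> * x0 \<le> 600 * (c1 * x0)"
      proof -
        have "\<Delta> * 1 \<le> \<Delta> * (\<Delta> * r\<^sup>2)" using \<Delta>1 r by (intro mult_left_mono) auto
        then have "\<Delta> \<le> c1" unfolding c1eq by (simp add: power2_eq_square mult_ac)
        then have "\<Delta> * x0 \<le> c1 * x0" by (rule mult_right_mono) simp
        moreover have "\<Delta> * r * (\<Delta> * r * (20 * x0)) = 20 * (c1 * x0)" unfolding c1eq by (simp add: power2_eq_square mult_ac)
        ultimately show ?thesis by linarith
      qed
      show "card {e \<in> J. v \<in> ?inc e} \<le> \<Delta>" for v using H(7)[of v] unfolding \<Delta>_def r_def .
      show "meets_once ?inc g K" if "conn ?inc K" "K \<subseteq> J" "card K \<le> R" "g \<in> J" "g \<notin> K" for K g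
        by (rule short[OF that])
      show "5 * incid ?inc XE XV \<le> 6 * (card XE + card XV)" if "XE \<subseteq> J" "finite XV" "card XE + card XV \<le> m0" for XE XV
        by (rule H(6)[OF that])
    qed (use finJ finA c1 x0 \<Lambda>1 G in \<open>auto simp: S_def N_def R_def m0_def\<close>)
    define t where "t = length es"
    \<comment> \<open>The number of hyperedges that are traversed by the longer path, each adding
      \<open>\<delta>\<close> to the basic length \<open>2 * t\<close>.\<close>
    define q where "q = (n - 2 * t) div \<delta>"
    have t2: "2 * t \<le> n" using lc(4) n(1) unfolding t_def add_mult_distrib2 by linarith
    have dn: "\<delta> dvd n - 2 * t" using \<delta> dvd by (auto intro: dvd_diff_nat)
    then have dq: "\<delta> * q = n - 2 * t" unfolding q_def by simp
    have qt: "q \<le> t"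
    proof -
      have "n - 2 * t \<le> t" using lc(3) n(2) unfolding t_def by linarith
      then have "\<delta> * q \<le> t" using dq by simp
      then show ?thesis using \<delta> by auto
    qed
    have t3: "2 \<le> t" unfolding t_def using lc(3) x0 by linarith
    define Q where "Q i = (if i < q then x (es ! i) # zs (es ! i) @ [y (es ! i)] else [x (es ! i), m (es ! i), y (es ! i)])" for i
    \<comment> \<open>The cycle may traverse a hyperedge from its \<open>y\<close> to its
      \<open>x\<close>; the path is then reversed.\<close>
    define P where "P i = (if f (es ! i) (x (es ! i)) = vs ! i then Q i else rev (Q i))" for i
    have esS: "es ! i \<in> S" "es ! i \<in> J" if i: "i < t" for i
    proof -
      have "es ! i \<in> set es" using i unfolding t_def by (rule nth_mem)
      then show "es ! i \<in> S" using lc(2) by blast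
      then show "es ! i \<in> J" unfolding S_def by simp
    qed
    have colS: "col (es ! i) = a" if "i < t" for i using esS(1)[OF that] unfolding S_def by simp
    have Qp: "ipath D (Q i)" "set (Q i) \<subseteq> A" "hd (Q i) = x (es ! i)" "last (Q i) = y (es ! i)"
      "length (Q i) - 1 = 2 + (if i < q then \<delta> else 0)" "2 \<le> length (Q i)" "\<forall>e\<in>pedges (Q i). c (f (es ! i) ` e) = a" if i: "i < t" for i
      using g[OF esS(2)[OF i]] colS[OF i] unfolding Q_def by auto
    have Pp: "ipath D (P i) \<and> set (P i) \<subseteq> A \<and> 2 \<le> length (P i) \<and>
       f (es ! i) (hd (P i)) = vs ! i \<and> f (es ! i) (last (P i)) = vs ! (Suc i mod t)" if i: "i < t" for i
    proof -
      have "en (es ! i) = {vs ! i, vs ! (Suc i mod t)}" using lc(1) i unfolding loose_cycle_def t_def by auto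
      then have e: "{f (es ! i) (x (es ! i)), f (es ! i) (y (es ! i))} = {vs ! i, vs ! (Suc i mod t)}" unfolding en_def .
      have ne: "Q i \<noteq> []" using Qp(6)[OF i] by auto
      show ?thesis
      proof (cases "f (es ! i) (x (es ! i)) = vs ! i")
        case True
        then have "f (es ! i) (y (es ! i)) = vs ! (Suc i mod t)" using e fxy[OF esS(2)[OF i]] by (metis doubleton_eq_iff)
        then show ?thesis using True Qp[OF i] unfolding P_def by simp
      next
        case False
        then have "f (es ! i) (x (es ! i)) = vs ! (Suc i mod t) \<and> f (es ! i) (y (es ! i)) = vs ! i"
          using e by (metis doubleton_eq_iff)
        then show ?thesis using False Qp[OF i] ne unfolding P_def by (simp add: hd_rev last_rev)
      qed
    qed
    obtain U where U: "distinct U" "length U = (\<Sum>i<length es. length (P i) - 1)"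
      "set U \<subseteq> (\<Union>j\<in>J. f j ` A)"
      "{e. (\<exists>j\<in>J. \<exists>d\<in>D. e = f j ` d) \<and> e \<subseteq> set U} = pedges (U @ [hd U])"
      "pedges (U @ [hd U]) = (\<Union>i<length es. (`) (f (es ! i)) ` pedges (P i))"
      by (rule induced_cycle_from_loose_cycle[OF lc(1) H(4) D, where P = P]) (use Pp t3 in \<open>auto simp: t_def\<close>)
    have lenP: "length (P i) = length (Q i)" for i unfolding P_def by simp
    have pP: "pedges (P i) = pedges (Q i)" for i unfolding P_def by simp
    have "(\<Sum>i<t. length (P i) - 1) = (\<Sum>i<t. 2 + (if i < q then \<delta> else 0))"
      by (rule sum.cong) (use Qp(5) lenP in auto)
    also have "\<dots> = (\<Sum>i<t. 2) + (\<Sum>i<t. if i < q then \<delta> else 0)" by (rule sum.distrib)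
    also have "(\<Sum>i<t. if i < q then \<delta> else 0) = (\<Sum>i\<in>{..<t} \<inter> {i. i < q}. \<delta>)"
      by (subst sum.inter_restrict) auto
    also have "{..<t} \<inter> {i. i < q} = {..<q}" using qt by auto
    finally have lenU: "length U = n" using U(2) dq t2 unfolding t_def by (simp add: mult.commute)
    have Ed_U: "{e \<in> Ed. e \<subseteq> set U} = pedges (U @ [hd U])" using U(4) unfolding Ed_def by simp
    show "\<exists>S\<subseteq>verts ({..<N}, Ed). \<exists>a<k. graph_iso (induced_subgraph ({..<N}, Ed) S) (cycle_graph n) \<and>
        (\<forall>e\<in>edges (induced_subgraph ({..<N}, Ed) S). c e = a)"
    proof (intro exI[of _ "set U"] exI[of _ a] conjI)
      show "set U \<subseteq> verts ({..<N}, Ed)" using U(3) H(3) by auto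
      show "graph_iso (induced_subgraph ({..<N}, Ed) (set U)) (cycle_graph n)"
        by (rule cycle_graph_iso[OF U(1) lenU _ Ed_U]) (use t2 t3 in linarith)
      show "\<forall>e\<in>edges (induced_subgraph ({..<N}, Ed) (set U)). c e = a"
      proof
        fix e assume "e \<in> edges (induced_subgraph ({..<N}, Ed) (set U))"
        then have "e \<in> pedges (U @ [hd U])" unfolding induced_subgraph_def using Ed_U by auto
        then obtain i where i: "i < t" "e \<in> (`) (f (es ! i)) ` pedges (Q i)" unfolding U(5) t_def pP by auto
        then show "c e = a" using Qp(7)[OF i(1)] by auto
      qed
    qed (rule a(1))
  qed
  then show ?thesis using ind_size_ramsey_le[OF simple] cEd by simp
qed

theorem ind_size_ramsey_cycle_le:
  fixes A :: "'a set" and D :: "'a set set" and k \<delta> G :: nat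
  assumes gad: "gadget A D k \<delta>" and k: "1 \<le> k" and \<delta>: "\<delta> = 1 \<or> \<delta> = 2"
    and G: "1 \<le> G" "2000 * host_sparsity k G (card A) \<le> 2 ^ (G - 1)"
  obtains n0 where "\<And>n. n0 \<le> n \<Longrightarrow> \<delta> dvd n \<Longrightarrow>
    ind_size_ramsey k (cycle_graph n) \<le> enat (host_density k G * host_factor k G (card A) * card D * n)"
proof -
  define R where "R = 2 * host_growth k G (card A) + host_factor k G (card A)"
  define Z where "Z = 16 * real (2 * R + 3) * (\<Sum>m\<in>{1..2 * R + 3}. (9 * (real (host_density k G) + 1) * real (card A)) ^ m)"
  obtain z where z: "Z \<le> real z" using real_arch_simple by blast
  show thesis
  proof (rule that[of "54 * z + 4 * (40 + 2 * R) + 200"])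
    fix n assume n: "54 * z + 4 * (40 + 2 * R) + 200 \<le> n" and dvd: "\<delta> dvd n"
    \<comment> \<open>The requirement is 40 x0 + 2R <= n <= 54 x0; the slack between 40 and 54
      absorbs \<open>R\<close> and the rounding for large \<open>n\<close>.\<close>
    define x0 where "x0 = n div 54 + 1"
    have x1: "n \<le> 54 * x0" "54 * x0 \<le> n + 54" unfolding x0_def add_mult_distrib2 using div_mult_mod_eq[of n 54] mod_less_divisor[of 54 n] by linarith+
    have x2: "3 \<le> x0" using x1 n by linarith
    have x3: "z \<le> x0" using x1 n by linarith
    have x4: "2 * (20 * x0 + R) \<le> n" using x1 n unfolding add_mult_distrib2 by linarith
    have x5: "x0 \<le> n" using x4 unfolding add_mult_distrib2 by linarith
    have "ind_size_ramsey k (cycle_graph n) \<le> enat (host_density k G * (host_factor k G (card A) * x0) * card D)"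
    proof (rule induced_ramsey_host[OF gad k \<delta> dvd G x2])
      have "Z \<le> real x0" using z x3 by linarith
      then show "16 * real (2 * (2 * host_growth k G (card A) + host_factor k G (card A)) + 3) *
          (\<Sum>m\<in>{1..2 * (2 * host_growth k G (card A) + host_factor k G (card A)) + 3}. (9 * (real (host_density k G) + 1) * real (card A)) ^ m) \<le> real x0"
        unfolding Z_def R_def .
      show "2 * (20 * x0 + (2 * host_growth k G (card A) + host_factor k G (card A))) \<le> n"
        using x4 unfolding R_def .
    qed (rule x1)
    also have "\<dots> \<le> enat (host_density k G * host_factor k G (card A) * card D * n)"
      using x5 by (simp add: mult_ac mult_left_mono)
    finally show "ind_size_ramsey k (cycle_graph n) \<le> enat (host_density k G * host_factor k G (card A) * card D * n)" .
  qed
qed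

section \<open>Primes in short intervals\<close>

text \<open>The entries \<open>1 / ((n + 1) (n choose m))\<close> of the Leibniz triangle are integral multiples of
  \<open>1 / Lcm {1..n + 1}\<close>, since every entry below the first is a difference of two earlier ones.\<close>

lemma Lcm_Leibniz:
  "m \<le> n \<Longrightarrow> n < N \<Longrightarrow> real (Lcm {1..N}) / (real (Suc n) * real (n choose m)) \<in> \<int>"
proof (induction m arbitrary: n)
  case 0
  have "Suc n dvd Lcm {1..N}" by (rule dvd_Lcm) (use 0 in auto)
  then obtain q where "Lcm {1..N} = Suc n * q" by (elim dvdE)
  then have "real (Lcm {1..N}) = real (Suc n) * real q" by (metis of_nat_mult)
  then have "real (Lcm {1..N}) / (real (Suc n) * real (n choose 0)) = real q" by (simp del: of_nat_Suc)
  then show ?case by simp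
next
  case (Suc m)
  obtain n' where n': "n = Suc n'" using Suc.prems by (cases n) auto
  let ?d = "real (Lcm {1..N})"
  have c: "0 < real (n' choose m)" using Suc.prems n' by simp
  have b1: "real (n choose m) * (real n - real m) = real n * real (n' choose m)"
  proof -
    have "(n choose m) * (n - m) = n * (n' choose m)"
      using binomial_absorb_comp[of n m] n' by (simp add: mult.commute)
    then have "real ((n choose m) * (n - m)) = real (n * (n' choose m))" by simp
    then show ?thesis using Suc.prems by (simp add: of_nat_diff)
  qed
  have b2: "real (n choose Suc m) * (real m + 1) = real n * real (n' choose m)"
  proof -
    have "Suc m * (n choose Suc m) = n * (n' choose m)" using Suc_times_binomial_eq[of n' m] n' by (simp add: mult.commute)
    then have "real (Suc m * (n choose Suc m)) = real (n * (n' choose m))" by simp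
    then show ?thesis by (simp add: algebra_simps)
  qed
  have nm: "0 < real n - real m" using Suc.prems by simp
  have pos: "0 < real (n choose m)" "0 < real (n choose Suc m)" "0 < real n"
    using Suc.prems zero_less_binomial[of m n] zero_less_binomial[of "Suc m" n] by auto
  have e1: "1 / real (n choose m) = (real n - real m) / (real n * real (n' choose m))"
    using b1 c pos nm by (simp add: field_simps)
  have e2: "1 / real (n choose Suc m) = (real m + 1) / (real n * real (n' choose m))"
    using b2 c pos by (simp add: field_simps)
  have "1 / real (n choose m) + 1 / real (n choose Suc m) = (real n + 1) / (real n * real (n' choose m))"
    unfolding e1 e2 by (simp add: add_divide_distrib[symmetric])
  then have "1 / (real n * real (n' choose m)) = (1 / real (n choose m) + 1 / real (n choose Suc m)) / (real n + 1)"
    by simp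
  then have "?d / (real n * real (n' choose m)) = ?d * ((1 / real (n choose m) + 1 / real (n choose Suc m)) / (real n + 1))"
    by (metis mult.right_neutral times_divide_eq_right)
  also have "\<dots> = ?d / (real (Suc n) * real (n choose m)) + ?d / (real (Suc n) * real (n choose Suc m))"
    by (simp add: add_divide_distrib distrib_left mult.commute add.commute)
  finally have eq: "?d / (real (Suc n) * real (n choose Suc m))
      = ?d / (real (Suc n') * real (n' choose m)) - ?d / (real (Suc n) * real (n choose m))"
    using n' by simp
  have "?d / (real (Suc n') * real (n' choose m)) \<in> \<int>" by (rule Suc.IH) (use Suc.prems n' in auto)
  moreover have "?d / (real (Suc n) * real (n choose m)) \<in> \<int>" by (rule Suc.IH) (use Suc.prems in auto)
  ultimately show ?case unfolding eq by (rule Ints_diff)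
qed

text \<open>By integrality each \<open>Suc n * (n choose m)\<close> is at most the least common
  multiple, and the average of these numbers over \<open>m\<close> is 2^n.\<close>

lemma Lcm_lower: "2 ^ n \<le> Lcm {1..Suc n}"
proof -
  let ?L = "Lcm {1..Suc n}"
  have L0: "0 < ?L" by (metis Lcm_0_iff_nat atLeastAtMost_iff finite_atLeastAtMost gr0I not_one_le_zero)
  have each: "Suc n * (n choose m) \<le> ?L" if m: "m \<le> n" for m
  proof -
    let ?q = "real ?L / (real (Suc n) * real (n choose m))"
    have "?q \<in> \<int>" by (rule Lcm_Leibniz) (use m in auto)
    moreover have c: "0 < real (Suc n) * real (n choose m)" using m by simp
    moreover have "0 < ?q" using c L0 by simp
    ultimately have "1 \<le> ?q" by (metis Ints_cases of_int_0_less_iff of_int_1_le_iff int_one_le_iff_zero_less)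
    then have "real (Suc n) * real (n choose m) \<le> real ?L" using c by (simp add: le_divide_eq_1)
    then show ?thesis by (metis of_nat_le_iff of_nat_mult)
  qed
  have "Suc n * 2 ^ n = (\<Sum>m\<le>n. Suc n * (n choose m))" by (simp only: choose_row_sum sum_distrib_left[symmetric])
  also have "\<dots> \<le> (\<Sum>m\<le>n. ?L)" by (rule sum_mono) (use each in auto)
  also have "\<dots> = Suc n * ?L" by simp
  finally show ?thesis by (simp only: mult_le_cancel1)
qed

lemma prime_power_dvd_Lcm_le:
  assumes "prime (p :: nat)" "p ^ a dvd Lcm {1..y}" "1 \<le> y"
  shows "p ^ a \<le> y"
  using assms(3,2)
proof (induction y rule: dec_induct)
  case base
  then show ?case using assms(1) by auto
next
  case (step y)
  have L0: "Lcm {1..y} \<noteq> 0" by (simp add: Lcm_0_iff_nat)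
  have "{1..Suc y} = insert (Suc y) {1..y}" by auto
  then have dv: "p ^ a dvd lcm (Suc y) (Lcm {1..y})" using step by simp
  have "multiplicity p (lcm (Suc y) (Lcm {1..y})) = max (multiplicity p (Suc y)) (multiplicity p (Lcm {1..y}))"
    by (rule multiplicity_lcm) (use L0 assms(1) in auto)
  moreover have "a \<le> multiplicity p (lcm (Suc y) (Lcm {1..y}))"
    using dv L0 assms(1) by (subst (asm) power_dvd_iff_le_multiplicity) auto
  ultimately have "a \<le> multiplicity p (Suc y) \<or> a \<le> multiplicity p (Lcm {1..y})" by linarith
  then have "p ^ a dvd Suc y \<or> p ^ a dvd Lcm {1..y}" by (auto intro: multiplicity_dvd')
  then show ?case
  proof
    assume "p ^ a dvd Suc y"
    then show ?thesis by (rule dvd_imp_le) simp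
  next
    assume "p ^ a dvd Lcm {1..y}"
    then show ?thesis using step by simp
  qed
qed

text \<open>Prime powers dividing the least common multiple are at most \<open>y\<close>, and if no
  prime lies in (x, y], at most \<open>x\<close> primes occur.\<close>

lemma Lcm_upper:
  assumes none: "\<And>p. prime p \<Longrightarrow> p \<le> y \<Longrightarrow> p \<le> x" and y: "1 \<le> y"
  shows "Lcm {1..y} \<le> y ^ x"
proof -
  let ?L = "Lcm {1..y} :: nat"
  have L0: "0 < ?L" by (metis Lcm_0_iff_nat atLeastAtMost_iff finite_atLeastAtMost gr0I not_one_le_zero)
  have sub: "prime_factors ?L \<subseteq> {1..x}"
  proof
    fix p assume p: "p \<in> prime_factors ?L"
    then have pp: "prime p" by auto
    have "p ^ 1 dvd ?L" using p by auto
    then have "p ^ 1 \<le> y" by (rule prime_power_dvd_Lcm_le[OF pp _ y])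
    then show "p \<in> {1..x}" using none[OF pp] prime_ge_1_nat[OF pp] by auto
  qed
  have "?L = (\<Prod>p\<in>prime_factors ?L. p ^ multiplicity p ?L)" by (rule prime_factorization_nat[OF L0])
  also have "\<dots> \<le> (\<Prod>p\<in>prime_factors ?L. y)"
  proof (rule prod_mono)
    fix p assume "p \<in> prime_factors ?L"
    then have pp: "prime p" by auto
    show "0 \<le> p ^ multiplicity p ?L \<and> p ^ multiplicity p ?L \<le> y"
      using prime_power_dvd_Lcm_le[OF pp multiplicity_dvd y] by simp
  qed
  also have "\<dots> = y ^ card (prime_factors ?L)" by simp
  also have "\<dots> \<le> y ^ x"
  proof (rule power_increasing[OF _ y])
    show "card (prime_factors ?L) \<le> x" using card_mono[OF _ sub] by simp
  qed
  finally show ?thesis .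
qed

text \<open>Without such a prime, \<open>2 ^ (y - 1) \<le> Lcm {1..y} \<le> y ^ x\<close> with
  \<open>y = 8 * x * s\<close>, which is too small since \<open>y \<le> 2 ^ (2 * s + 3)\<close>.
  Compared with Bertrand's postulate a logarithmic factor \<open>s\<close> is lost; the exponent 102
  has room for it.\<close>

lemma exists_prime_between:
  assumes x: "1 \<le> x" "x \<le> 2 ^ s" and s: "1 \<le> s"
  obtains p :: nat where "prime p" "x < p" "p \<le> 8 * x * s"
proof -
  define y where "y = 8 * x * s"
  have y1: "1 \<le> y" unfolding y_def using x s by simp
  have "\<exists>p. prime p \<and> x < p \<and> p \<le> y"
  proof (rule ccontr)
    assume no: "\<not> (\<exists>p. prime p \<and> x < p \<and> p \<le> y)"
    have none: "p \<le> x" if "prime p" "p \<le> y" for p :: nat using that no not_le by blast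
    have "2 ^ (y - 1) \<le> Lcm {1..Suc (y - 1)}" by (rule Lcm_lower)
    also have "Suc (y - 1) = y" using y1 by simp
    also have "Lcm {1..y} \<le> y ^ x" by (rule Lcm_upper[OF none y1])
    also have "y \<le> 2 ^ (2 * s + 3)"
    proof -
      have "s \<le> 2 ^ s" using less_exp[of s] by (rule less_imp_le)
      then have "x * s \<le> 2 ^ s * 2 ^ s" using x(2) by (intro mult_le_mono)
      then have "8 * (x * s) \<le> 8 * (2 ^ s * 2 ^ s)" by (rule mult_le_mono2)
      moreover have "(2 :: nat) ^ (2 * s + 3) = 2 ^ s * 2 ^ s * 2 ^ 3" by (simp only: power_add mult_2)
      ultimately show ?thesis unfolding y_def by (simp add: mult_ac)
    qed
    then have "y ^ x \<le> (2 ^ (2 * s + 3)) ^ x" by (rule power_mono) simp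
    also have "\<dots> = 2 ^ ((2 * s + 3) * x)" by (simp add: power_mult)
    finally have "(2 :: nat) ^ (y - 1) \<le> 2 ^ ((2 * s + 3) * x)" .
    then have "y - 1 \<le> (2 * s + 3) * x" by (simp only: power_increasing_iff[of 2] one_less_numeral_iff semiring_norm)
    moreover have "(2 * s + 3) * x + 1 < y"
    proof -
      have "1 * 1 \<le> s * x" using s x by (intro mult_le_mono) auto
      moreover have "1 * x \<le> s * x" using s by (rule mult_le_mono1)
      moreover have "(2 * s + 3) * x = 2 * (s * x) + 3 * x" by (simp add: algebra_simps)
      moreover have "y = 8 * (s * x)" unfolding y_def by simp
      ultimately show ?thesis by linarith
    qed
    ultimately show False by linarith
  qed
  then show thesis using that unfolding y_def by blast
qed

section \<open>The gadget for even cycles\<close>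

text \<open>Turns the edge counts delivered by \<open>dense_expander\<close> into a minimum
  degree.\<close>

lemma card_other_ends_ge:
  assumes fin: "finite W" and two: "\<And>e. e \<in> S \<Longrightarrow> card e = 2"
  shows "card {e \<in> S. e \<subseteq> W \<and> e \<inter> {v} \<noteq> {}} \<le> card {w \<in> W. {v, w} \<in> S}"
proof -
  have sub: "{e \<in> S. e \<subseteq> W \<and> e \<inter> {v} \<noteq> {}} \<subseteq> (\<lambda>w. {v, w}) ` {w \<in> W. {v, w} \<in> S}"
  proof
    fix e assume e: "e \<in> {e \<in> S. e \<subseteq> W \<and> e \<inter> {v} \<noteq> {}}"
    then obtain a b where ab: "e = {a, b}" using two[of e] by (auto simp: card_2_iff)
    then have "\<exists>w. e = {v, w}" using e by auto
    then obtain w where w: "e = {v, w}" ..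
    then have "w \<in> {w \<in> W. {v, w} \<in> S}" using e by auto
    then show "e \<in> (\<lambda>w. {v, w}) ` {w \<in> W. {v, w} \<in> S}" using w by blast
  qed
  have f: "finite {w \<in> W. {v, w} \<in> S}" using fin by simp
  show ?thesis using surj_card_le[OF f sub] .
qed

text \<open>A graph with large minimum degree contains more paths with three edges from a fixed vertex than
  there are possible end vertices; two such paths with the same end form a hexagon, since there
  are no quadrilaterals.\<close>

lemma hexagon_in_quadrilateral_free:
  fixes S D :: "'a set set" and side :: "'a \<Rightarrow> bool" and \<rho> :: real
  assumes SD: "S \<subseteq> D" and side: "\<And>u w. {u, w} \<in> D \<Longrightarrow> side u \<noteq> side w"
    and quad: "\<And>u u' a b. {u, a} \<in> D \<Longrightarrow> {u, b} \<in> D \<Longrightarrow> {u', a} \<in> D \<Longrightarrow> {u', b} \<in> D \<Longrightarrow> u = u' \<or> a = b"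
    and W: "finite W" "v \<in> W" and n: "\<And>s. card {w \<in> W. side w = s} \<le> n"
    and deg: "\<And>w. w \<in> W \<Longrightarrow> \<rho> \<le> real (card {u \<in> W. {w, u} \<in> S})"
    and \<rho>: "2 \<le> \<rho>" "4 * real n < \<rho> ^ 3"
  obtains a b c a' b' where "{v, a} \<in> S" "{a, b} \<in> S" "{b, c} \<in> S" "{v, a'} \<in> S" "{a', b'} \<in> S" "{b', c} \<in> S"
    "a \<noteq> a'" "b \<noteq> b'" "b \<noteq> v" "b' \<noteq> v" "c \<noteq> a" "c \<noteq> a'" "{v, a, b, c, a', b'} \<subseteq> W"
proof -
  define N where "N w = {u \<in> W. {w, u} \<in> S}" for w
  define T where "T = (SIGMA a:N v. SIGMA b:N a - {v}. N b - {a})"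
  have fN: "finite (N w)" for w unfolding N_def using W by simp
  have NW: "N w \<subseteq> W" for w unfolding N_def by auto
  have side': "side u \<noteq> side w" if "{u, w} \<in> S" for u w using side that SD by blast
  have dN: "\<rho> \<le> real (card (N w))" if "w \<in> W" for w using deg[OF that] unfolding N_def .
  have dN1: "\<rho> / 2 \<le> real (card (N w - {z}))" if w: "w \<in> W" for w z
  proof -
    have "card (N w) - 1 \<le> card (N w - {z})" using diff_card_le_card_Diff[of "{z}" "N w"] by simp
    then have "real (card (N w)) - 1 \<le> real (card (N w - {z}))" by linarith
    then show ?thesis using dN[OF w] \<rho>(1) by linarith
  qed
  have "real n < real (card T)"
  proof -
    have inner: "\<rho> / 2 * (\<rho> / 2) \<le> real (card (SIGMA b:N a - {v}. N b - {a}))" if a: "a \<in> N v" for a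
    proof -
      have "\<rho> / 2 * (\<rho> / 2) \<le> real (card (N a - {v})) * (\<rho> / 2)"
        using dN1[of a v] a NW \<rho>(1) by (intro mult_right_mono) auto
      also have "\<dots> = (\<Sum>b\<in>N a - {v}. \<rho> / 2)" by simp
      also have "\<dots> \<le> (\<Sum>b\<in>N a - {v}. real (card (N b - {a})))"
        by (rule sum_mono) (use dN1 NW in blast)
      also have "\<dots> = real (card (SIGMA b:N a - {v}. N b - {a}))"
        using fN by (subst card_SigmaI) auto
      finally show ?thesis .
    qed
    have "\<rho> ^ 3 / 4 = \<rho> * (\<rho> / 2 * (\<rho> / 2))" by (simp add: power3_eq_cube)
    also have "\<dots> \<le> real (card (N v)) * (\<rho> / 2 * (\<rho> / 2))"
      using dN[OF W(2)] \<rho>(1) by (intro mult_right_mono) auto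
    also have "\<dots> = (\<Sum>a\<in>N v. \<rho> / 2 * (\<rho> / 2))" by simp
    also have "\<dots> \<le> (\<Sum>a\<in>N v. real (card (SIGMA b:N a - {v}. N b - {a})))"
      by (rule sum_mono) (rule inner)
    also have "\<dots> = real (card T)" unfolding T_def using fN by (subst card_SigmaI) auto
    finally show ?thesis using \<rho>(2) by linarith
  qed
  then have nT: "n < card T" by simp
  have TE: "{v, a} \<in> S" "{a, b} \<in> S" "{b, c} \<in> S" "b \<noteq> v" "c \<noteq> a" "a \<in> W" "b \<in> W" "c \<in> W"
    if "(a, b, c) \<in> T" for a b c
    using that unfolding T_def N_def by auto
  let ?end = "\<lambda>z. snd (snd z)"
  have img: "?end ` T \<subseteq> {w \<in> W. side w = (\<not> side v)}"
  proof
    fix c assume "c \<in> ?end ` T"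
    then obtain a b where "(a, b, c) \<in> T" by force
    note t = TE[OF this]
    have "side c = (\<not> side v)" using side'[OF t(1)] side'[OF t(2)] side'[OF t(3)] by auto
    then show "c \<in> {w \<in> W. side w = (\<not> side v)}" using t(8) by simp
  qed
  have "\<not> inj_on ?end T"
  proof
    assume "inj_on ?end T"
    then have "card T = card (?end ` T)" by (simp add: card_image)
    also have "\<dots> \<le> card {w \<in> W. side w = (\<not> side v)}" by (rule card_mono[OF _ img]) (use W in simp)
    also have "\<dots> \<le> n" by (rule n)
    finally show False using nT by simp
  qed
  then obtain z z' where z: "z \<in> T" "z' \<in> T" "?end z = ?end z'" "z \<noteq> z'" unfolding inj_on_def by blast
  define a b c a' b' where "a = fst z" and "b = fst (snd z)" and "c = snd (snd z)" and "a' = fst z'" and "b' = fst (snd z')"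
  then have zz: "z = (a, b, c)" "z' = (a', b', c)" using z(3) by (metis prod.collapse)+
  have t1: "(a, b, c) \<in> T" and t2: "(a', b', c) \<in> T" and ne: "(a, b) \<noteq> (a', b')" using z zz by auto
  note t = TE[OF t1] and t' = TE[OF t2]
  \<comment> \<open>Two paths that agree in one inner vertex would leave a quadrilateral.\<close>
  have aa: "a \<noteq> a'"
  proof
    assume eq: "a = a'"
    then have "b \<noteq> b'" using ne by simp
    moreover have "{b, a} \<in> D" "{b', a} \<in> D" "{b, c} \<in> D" "{b', c} \<in> D"
      using t t' eq SD by (auto simp: insert_commute)
    ultimately have "a = c" using quad[of b a c b'] by blast
    then show False using t(5) by simp
  qed
  have bb: "b \<noteq> b'"
  proof
    assume eq: "b = b'"
    have "{b, a} \<in> D" "{b, a'} \<in> D" "{v, a} \<in> D" "{v, a'} \<in> D"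
      using t t' eq SD by (auto simp: insert_commute)
    then have "b = v" using quad[of b a a' v] aa by blast
    then show False using t(4) by simp
  qed
  show thesis
    by (rule that[of a b c a' b']) (use t t' aa bb W(2) in auto)
qed

definition incidence_verts :: "nat \<Rightarrow> (bool \<times> nat \<times> nat) set" where
  "incidence_verts p = UNIV \<times> {..<p} \<times> {..<p}"

text \<open>The vertices marked \<open>True\<close> are the points, and those marked \<open>False\<close> the non-vertical lines, of the
  affine plane over the integers modulo \<open>p\<close>.\<close>

definition incidence_edges :: "nat \<Rightarrow> (bool \<times> nat \<times> nat) set set" where
  "incidence_edges p = {{(True, x, (a * x + b) mod p), (False, a, b)} | x a b. x < p \<and> a < p \<and> b < p}"

lemma incidence_edge_iff:
  "{(True, x, y), (False, a, b)} \<in> incidence_edges p \<longleftrightarrow> x < p \<and> a < p \<and> b < p \<and> y = (a * x + b) mod p"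
  unfolding incidence_edges_def by (auto simp: doubleton_eq_iff)

lemma incidence_sides: "{u, w} \<in> incidence_edges p \<Longrightarrow> fst u \<noteq> fst w"
  unfolding incidence_edges_def by (auto simp: doubleton_eq_iff)

lemma prime_dvd_small_diff:
  fixes a b :: nat
  assumes "int p dvd int a - int b" "a < p" "b < p"
  shows "a = b"
proof -
  have "int a mod int p = int b mod int p" using assms(1) by (simp add: mod_eq_dvd_iff)
  then show ?thesis using assms(2,3) by simp
qed

text \<open>Subtracting the line equations at both points gives that \<open>p\<close> divides (a -
  a')(x - x'), and primality decides which factor vanishes.\<close>

lemma incidence_two_points_two_lines:
  assumes p: "prime p"
    and e: "{(True, x, y), (False, a, b)} \<in> incidence_edges p" "{(True, x, y), (False, a', b')} \<in> incidence_edges p"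
      "{(True, x', y'), (False, a, b)} \<in> incidence_edges p" "{(True, x', y'), (False, a', b')} \<in> incidence_edges p"
  shows "(x = x' \<and> y = y') \<or> (a = a' \<and> b = b')"
proof -
  have l: "x < p" "x' < p" "a < p" "a' < p" "b < p" "b' < p" using e unfolding incidence_edge_iff by auto
  have y: "y = (a * x + b) mod p" "y = (a' * x + b') mod p" "y' = (a * x' + b) mod p" "y' = (a' * x' + b') mod p"
    using e unfolding incidence_edge_iff by auto
  have "int ((a * x + b) mod p) = int ((a' * x + b') mod p)" using y by simp
  then have 1: "int p dvd (int a * int x + int b) - (int a' * int x + int b')"
    by (simp add: zmod_int mod_eq_dvd_iff)
  have "int ((a * x' + b) mod p) = int ((a' * x' + b') mod p)" using y by simp
  then have 2: "int p dvd (int a * int x' + int b) - (int a' * int x' + int b')"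
    by (simp add: zmod_int mod_eq_dvd_iff)
  have "int p dvd ((int a * int x + int b) - (int a' * int x + int b')) - ((int a * int x' + int b) - (int a' * int x' + int b'))"
    by (rule dvd_diff[OF 1 2])
  also have "\<dots> = (int a - int a') * (int x - int x')" by (simp add: algebra_simps)
  finally have "int p dvd (int a - int a') * (int x - int x')" .
  then have "int p dvd int a - int a' \<or> int p dvd int x - int x'" using p by (simp add: prime_dvd_mult_iff)
  then show ?thesis
  proof
    assume "int p dvd int a - int a'"
    then have aa: "a = a'" by (rule prime_dvd_small_diff) (use l in auto)
    then have "int p dvd int b - int b'" using 1 by simp
    then have "b = b'" by (rule prime_dvd_small_diff) (use l in auto)
    then show ?thesis using aa by simp
  next
    assume "int p dvd int x - int x'"
    then have "x = x'" by (rule prime_dvd_small_diff) (use l in auto)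
    then show ?thesis using y by simp
  qed
qed

lemma incidence_quad:
  assumes p: "prime p"
    and e: "{u, a} \<in> incidence_edges p" "{u, b} \<in> incidence_edges p" "{u', a} \<in> incidence_edges p" "{u', b} \<in> incidence_edges p"
  shows "u = u' \<or> a = b"
proof -
  obtain su u1 u2 where u: "u = (su, u1, u2)" by (cases u) auto
  obtain su' u1' u2' where u': "u' = (su', u1', u2')" by (cases u') auto
  obtain sa a1 a2 where a: "a = (sa, a1, a2)" by (cases a) auto
  obtain sb b1 b2 where b: "b = (sb, b1, b2)" by (cases b) auto
  have s: "sa = (\<not> su)" "sb = (\<not> su)" "su' = su"
    using incidence_sides[OF e(1)] incidence_sides[OF e(2)] incidence_sides[OF e(3)] u u' a b by auto
  show ?thesis
  proof (cases su)
    case True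
    then show ?thesis
      using incidence_two_points_two_lines[OF p, of u1 u2 a1 a2 b1 b2 u1' u2'] e u u' a b s by auto
  next
    case False
    then show ?thesis
      using incidence_two_points_two_lines[OF p, of a1 a2 u1 u2 u1' u2' b1 b2] e u u' a b s
      by (auto simp: insert_commute)
  qed
qed

lemma incidence_edges_image:
  "incidence_edges p = (\<lambda>(x, a, b). {(True, x, (a * x + b) mod p), (False, a, b)}) ` ({..<p} \<times> {..<p} \<times> {..<p})"
  unfolding incidence_edges_def by (auto simp: image_iff)

lemma card_incidence_edges: "card (incidence_edges p) = p ^ 3"
proof -
  have "inj_on (\<lambda>(x, a, b). {(True, x, (a * x + b) mod p), (False, a, b)}) ({..<p} \<times> {..<p} \<times> {..<p})"
    by (auto simp: inj_on_def doubleton_eq_iff)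
  then show ?thesis unfolding incidence_edges_image
    by (simp add: card_image card_cartesian_product power3_eq_cube)
qed

lemma card_incidence_verts: "card (incidence_verts p) = 2 * p\<^sup>2"
  unfolding incidence_verts_def by (simp add: card_cartesian_product power2_eq_square)

lemma incidence_edges_sub:
  assumes "d \<in> incidence_edges p"
  shows "d \<subseteq> incidence_verts p \<and> card d = 2"
  using assms unfolding incidence_edges_def incidence_verts_def by auto

lemma finite_incidence_edges: "finite (incidence_edges p)"
  unfolding incidence_edges_image by simp

lemma bipartite_edge_cases:
  assumes "d \<in> D" "\<And>d. d \<in> D \<Longrightarrow> card d = 2" "\<And>u w. {u, w} \<in> D \<Longrightarrow> side u \<noteq> (side w :: bool)"
  obtains u w where "d = {u, w}" "side u = s" "side w = (\<not> s)"
proof -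
  obtain u w where uw: "d = {u, w}" using assms(2)[OF assms(1)] by (auto simp: card_2_iff)
  have ne: "side u \<noteq> side w" using assms(1,3) uw by simp
  show thesis
  proof (cases "side u = s")
    case True
    then show ?thesis using that[of u w] uw ne by auto
  next
    case False
    then show ?thesis using that[of w u] uw ne by (auto simp: insert_commute)
  qed
qed

text \<open>The hexagon \<open>v a b c' b' a'\<close> contains the paths \<open>v a b\<close> and
  \<open>v a' b' c' b\<close>. By bipartiteness only \<open>v c'\<close> and \<open>b a'\<close>
  could be chords of these paths, and each would close a quadrilateral. A popular colour has p^3 / k
  edges on 2 p^2 vertices, so \<open>\<rho> = p / (2 * k)\<close>, and enough paths exist once p >
  32 k^3.\<close>

theorem even_gadget:
  assumes p: "prime p" "128 * k ^ 3 \<le> p" and k: "1 \<le> k"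
  shows "gadget (incidence_verts p) (incidence_edges p) k 2"
  unfolding gadget_def
proof (intro conjI ballI allI impI)
  show "finite (incidence_verts p)" unfolding incidence_verts_def by simp
  show "d \<subseteq> incidence_verts p" "card d = 2" if "d \<in> incidence_edges p" for d
    using incidence_edges_sub[OF that] by auto
  fix c :: "(bool \<times> nat \<times> nat) set \<Rightarrow> nat"
  let ?D = "incidence_edges p" and ?A = "incidence_verts p"
  assume c: "\<forall>d\<in>?D. c d < k"
  obtain i where i: "i < k" "card ?D \<le> k * card {d \<in> ?D. c d = i}"
  proof (rule pigeonhole_colour[of ?D k c])
    show "c j < k" if "j \<in> ?D" for j using c that by blast
  qed (use finite_incidence_edges k in simp_all)
  define S where "S = {d \<in> ?D. c d = i}"
  have SD: "S \<subseteq> ?D" unfolding S_def by auto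
  have fS: "finite S" using SD finite_incidence_edges finite_subset by blast
  have p0: "0 < p" using p(1) by (rule prime_gt_0_nat)
  define \<rho> where "\<rho> = real p / (2 * real k)"
  have k0: "0 < real k" using k by simp
  have fA: "finite ?A" unfolding incidence_verts_def by simp
  have Ane: "?A \<noteq> {}" unfolding incidence_verts_def using p0 by auto
  \<comment> \<open>With \<open>u\<close> equal to the full size the logarithmic factor is 1;
    \<open>dense_expander\<close> serves here only to find a subgraph of minimum degree
    \<open>\<rho>\<close>.\<close>
  define u where "u = real (card ?A)"
  have u0: "0 < u" unfolding u_def using fA Ane by (simp add: card_gt_0_iff)
  have dens: "\<rho> * (real (card ?A) * (1 + max 0 (log 2 (real (card ?A) / u)))) \<le> real (card S)"
  proof -
    have "real (p ^ 3) \<le> real (k * card S)" using i(2) unfolding card_incidence_edges S_def by (rule of_nat_mono)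
    then have "real p ^ 3 / real k \<le> real (card S)" using k0 by (simp add: field_simps)
    moreover have "\<rho> * (real (card ?A) * (1 + max 0 (log 2 (real (card ?A) / u)))) = real p ^ 3 / real k"
      unfolding \<rho>_def u_def[symmetric] using u0 k0
      by (simp add: u_def card_incidence_verts power2_eq_square power3_eq_cube)
    ultimately show ?thesis by simp
  qed
  have en: "id e \<subseteq> ?A \<and> id e \<noteq> {}" if "e \<in> S" for e
    using incidence_edges_sub[of e p] that SD by auto
  have \<rho>0: "0 \<le> \<rho>" unfolding \<rho>_def by simp
  obtain W where W: "W \<subseteq> ?A" "W \<noteq> {}"
    "\<And>X. X \<subseteq> W \<Longrightarrow> \<rho> * real (card X) \<le> real (card {e \<in> S. id e \<subseteq> W \<and> id e \<inter> X \<noteq> {}})"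
  proof (rule dense_expander[OF fS fA Ane _ u0 \<rho>0 dens])
    show "id e \<subseteq> ?A \<and> id e \<noteq> {}" if "e \<in> S" for e by (rule en[OF that])
  qed (rule that; assumption)
  obtain v where v: "v \<in> W" using W(2) by blast
  have fW: "finite W" using W(1) fA finite_subset by blast
  have two: "card e = 2" if "e \<in> S" for e using incidence_edges_sub[of e p] that SD by auto
  have deg: "\<rho> \<le> real (card {w' \<in> W. {w, w'} \<in> S})" if w: "w \<in> W" for w
  proof -
    have "\<rho> * real (card {w}) \<le> real (card {e \<in> S. id e \<subseteq> W \<and> id e \<inter> {w} \<noteq> {}})"
      by (rule W(3)) (use w in simp)
    also have "\<dots> \<le> real (card {w' \<in> W. {w, w'} \<in> S})"
      using card_other_ends_ge[OF fW two, where v = w] by simp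
    finally show ?thesis by simp
  qed
  have half: "card {w \<in> W. fst w = s} \<le> p\<^sup>2" for s
  proof -
    have "{w \<in> W. fst w = s} \<subseteq> {s} \<times> {..<p} \<times> {..<p}" using W(1) unfolding incidence_verts_def by auto
    then have "card {w \<in> W. fst w = s} \<le> card ({s} \<times> {..<p} \<times> {..<p})" by (rule card_mono[rotated]) simp
    then show ?thesis by (simp add: card_cartesian_product power2_eq_square)
  qed
  have pk: "128 * real k ^ 3 \<le> real p" using of_nat_mono[OF p(2), where 'a = real] by simp
  have \<rho>2: "2 \<le> \<rho>"
  proof -
    have "real k \<le> real k ^ 3" using power_increasing[of 1 3 "real k"] k by simp
    then have "4 * real k \<le> real p" using pk k0 by linarith
    then show ?thesis unfolding \<rho>_def using k0 by (simp add: field_simps)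
  qed
  have \<rho>3: "4 * real (p\<^sup>2) < \<rho> ^ 3"
  proof -
    have "4 * real p ^ 2 * (8 * real k ^ 3) < real p ^ 2 * real p"
    proof -
      have "32 * real k ^ 3 < real p" using pk k0 by (smt (verit) zero_less_power)
      then have "real p ^ 2 * (32 * real k ^ 3) < real p ^ 2 * real p" using p0 by (intro mult_strict_left_mono) auto
      then show ?thesis by (simp add: mult_ac)
    qed
    then show ?thesis unfolding \<rho>_def using k0
      by (simp add: power_divide power_mult_distrib pos_less_divide_eq power3_eq_cube power2_eq_square)
  qed
  obtain a b c' a' b' where hx: "{v, a} \<in> S" "{a, b} \<in> S" "{b, c'} \<in> S" "{v, a'} \<in> S" "{a', b'} \<in> S" "{b', c'} \<in> S"
    "a \<noteq> a'" "b \<noteq> b'" "b \<noteq> v" "b' \<noteq> v" "c' \<noteq> a" "c' \<noteq> a'" "{v, a, b, c', a', b'} \<subseteq> W"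
    by (rule hexagon_in_quadrilateral_free[OF SD incidence_sides incidence_quad[OF p(1)] fW v half deg \<rho>2 \<rho>3])
  have hd: "{v, a} \<in> ?D" "{a, b} \<in> ?D" "{b, c'} \<in> ?D" "{v, a'} \<in> ?D" "{a', b'} \<in> ?D" "{b', c'} \<in> ?D"
    using hx SD by blast+
  note si = incidence_sides[OF hd(1)] incidence_sides[OF hd(2)] incidence_sides[OF hd(3)]
    incidence_sides[OF hd(4)] incidence_sides[OF hd(5)] incidence_sides[OF hd(6)]
  define s where "s = fst v"
  have sd: "fst v = s" "fst a = (\<not> s)" "fst b = s" "fst a' = (\<not> s)" "fst b' = s" "fst c' = (\<not> s)"
    using si unfolding s_def by auto
  have no1: "{v, c'} \<notin> ?D"
  proof
    assume "{v, c'} \<in> ?D"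
    then have "v = b \<or> a = c'" using incidence_quad[OF p(1), of v a c' b] hd by (simp add: insert_commute)
    then show False using hx by blast
  qed
  have no2: "{b, a'} \<notin> ?D"
  proof
    assume "{b, a'} \<in> ?D"
    then have "b = v \<or> a = a'" using incidence_quad[OF p(1), of b a a' v] hd by (simp add: insert_commute)
    then show False using hx by blast
  qed
  have d2: "card d = 2" if "d \<in> ?D" for d using incidence_edges_sub[OF that] by simp
  have ip1: "ipath ?D [v, a, b]"
    unfolding ipath_def
  proof (intro conjI equalityI subsetI)
    show "distinct [v, a, b]" using hx(9) sd by auto
    fix d assume "d \<in> {d \<in> ?D. d \<subseteq> set [v, a, b]}"
    then have d: "d \<in> ?D" "d \<subseteq> {v, a, b}" by auto
    obtain x y where xy: "d = {x, y}" "fst x = s" "fst y = (\<not> s)"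
      by (rule bipartite_edge_cases[OF d(1) d2 incidence_sides])
    have "x = v \<or> x = b" "y = a" using d(2) xy sd by auto
    then show "d \<in> pedges [v, a, b]" using xy(1) by auto
  next
    fix d assume "d \<in> pedges [v, a, b]"
    then show "d \<in> {d \<in> ?D. d \<subseteq> set [v, a, b]}" using hd by auto
  qed
  have ip2: "ipath ?D [v, a', b', c', b]"
    unfolding ipath_def
  proof (intro conjI equalityI subsetI)
    show "distinct [v, a', b', c', b]" using hx sd by auto
    fix d assume "d \<in> {d \<in> ?D. d \<subseteq> set [v, a', b', c', b]}"
    then have d: "d \<in> ?D" "d \<subseteq> {v, a', b', c', b}" by auto
    obtain x y where xy: "d = {x, y}" "fst x = s" "fst y = (\<not> s)"
      by (rule bipartite_edge_cases[OF d(1) d2 incidence_sides])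
    have "x = v \<or> x = b' \<or> x = b" "y = a' \<or> y = c'" using d(2) xy sd by auto
    moreover have "\<not> (x = v \<and> y = c')" "\<not> (x = b \<and> y = a')" using no1 no2 d(1) xy(1) by auto
    ultimately have "(x = v \<and> y = a') \<or> (x = b' \<and> y = a') \<or> (x = b' \<and> y = c') \<or> (x = b \<and> y = c')" by blast
    then show "d \<in> pedges [v, a', b', c', b]" using xy(1) by (auto simp: insert_commute)
  next
    fix d assume "d \<in> pedges [v, a', b', c', b]"
    then show "d \<in> {d \<in> ?D. d \<subseteq> set [v, a', b', c', b]}" using hd by (auto simp: insert_commute)
  qed
  have col: "\<forall>e\<in>pedges [v, a, b] \<union> pedges (v # [a', b', c'] @ [b]). c e = i"
    using hx(1-6) unfolding S_def by (auto simp: insert_commute)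
  show "\<exists>a x m y zs. length zs = Suc 2 \<and> {x, m, y} \<subseteq> ?A \<and> set zs \<subseteq> ?A \<and> ipath ?D [x, m, y] \<and>
      ipath ?D (x # zs @ [y]) \<and> (\<forall>e\<in>pedges [x, m, y] \<union> pedges (x # zs @ [y]). c e = a)"
    using hx(13) W(1) ip1 ip2 col
    by (intro exI[of _ i] exI[of _ v] exI[of _ a] exI[of _ b] exI[of _ "[a', b', c']"]) auto
qed

section \<open>The gadget for odd cycles\<close>

text \<open>\<open>\<eta>\<close> bounds the deviation of the edge counts from those of a random
  graph of density \<open>\<tau>\<close>.\<close>

locale mixing_graph =
  fixes A :: "'a set" and D :: "'a set set" and n \<tau> \<eta> :: real
  assumes finA: "finite A" and D: "\<And>d. d \<in> D \<Longrightarrow> d \<subseteq> A \<and> card d = 2" and n: "n = real (card A)"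
    and \<tau>: "0 < \<tau>" and \<eta>: "0 \<le> \<eta>"
    and mix: "\<And>X Y. X \<subseteq> A \<Longrightarrow> Y \<subseteq> A \<Longrightarrow>
       \<bar>real (card {(x, y). x \<in> X \<and> y \<in> Y \<and> {x, y} \<in> D}) - \<tau> * real (card X) * real (card Y)\<bar> \<le> \<eta> * n\<^sup>2"
    and degree: "\<And>v. real (card {u. {u, v} \<in> D}) \<le> \<tau> * n"
    and codegree: "\<And>u v. {u, v} \<in> D \<Longrightarrow> real (card {z. {z, u} \<in> D \<and> {z, v} \<in> D}) \<le> \<tau>\<^sup>2 * n"
begin

lemma edge_in: "{x, y} \<in> D \<Longrightarrow> x \<in> A \<and> y \<in> A \<and> x \<noteq> y"
  using D[of "{x, y}"] by auto

lemma finD: "finite D"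
  by (rule finite_subset[of _ "Pow A"]) (use D finA in auto)

text \<open>Ordered pairs, so that the colours add up to the quantity estimated by
  \<open>mix\<close>.\<close>

definition cpairs :: "('a set \<Rightarrow> nat) \<Rightarrow> nat \<Rightarrow> 'a set \<Rightarrow> ('a \<times> 'a) set" where
  "cpairs c i X = {(x, y). x \<in> X \<and> y \<in> X \<and> {x, y} \<in> D \<and> c {x, y} = i}"

lemma finite_cpairs: "finite X \<Longrightarrow> finite (cpairs c i X)"
  by (rule finite_subset[of _ "X \<times> X"]) (auto simp: cpairs_def)

lemma cpairs_mono: "X \<subseteq> Y \<Longrightarrow> cpairs c i X \<subseteq> cpairs c i Y"
  unfolding cpairs_def by auto

text \<open>The conclusion of \<open>gadget\<close> for \<delta> = 1 and one fixed
  colouring.\<close>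

definition copy :: "('a set \<Rightarrow> nat) \<Rightarrow> bool" where
  "copy c \<longleftrightarrow> (\<exists>a x m y zs. length zs = Suc 1 \<and> {x, m, y} \<subseteq> A \<and> set zs \<subseteq> A \<and> ipath D [x, m, y] \<and>
      ipath D (x # zs @ [y]) \<and> (\<forall>e\<in>pedges [x, m, y] \<union> pedges (x # zs @ [y]). c e = a))"

text \<open>A pentagon \<open>v m x x' m'\<close> of one colour. Only chords inside
  \<open>v m x\<close> or inside \<open>v m' x' x\<close> are harmful, so the chords
  \<open>m x'\<close> and \<open>m m'\<close> may be present.\<close>

lemma copyI:
  assumes e: "{v, m} \<in> D" "{m, x} \<in> D" "{v, m'} \<in> D" "{m', x'} \<in> D" "{x', x} \<in> D"
    and c: "c {v, m} = i" "c {m, x} = i" "c {v, m'} = i" "c {m', x'} = i" "c {x', x} = i"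
    and ne: "v \<noteq> x" "v \<noteq> x'" "{v, x} \<notin> D" "{v, x'} \<notin> D" "{m', x} \<notin> D"
  shows "copy c"
proof -
  have dm: "m' \<noteq> x" using e(3) ne(3) by auto
  have d2: "\<exists>a b. d = {a, b} \<and> a \<noteq> b" if "d \<in> D" for d using D[OF that] by (auto simp: card_2_iff)
  have ip1: "ipath D [v, m, x]"
    unfolding ipath_def
  proof (intro conjI equalityI subsetI)
    show "distinct [v, m, x]" using edge_in[OF e(1)] edge_in[OF e(2)] ne by auto
    fix d assume d: "d \<in> {d \<in> D. d \<subseteq> set [v, m, x]}"
    then obtain a b where ab: "d = {a, b}" "a \<noteq> b" using d2 by blast
    have "a \<in> {v, m, x}" "b \<in> {v, m, x}" "d \<in> D" using d ab(1) by auto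
    then have "d = {v, m} \<or> d = {m, x} \<or> d = {v, x}"
      using ab by (elim insertE emptyE) (simp_all add: doubleton_eq_iff)
    then show "d \<in> pedges [v, m, x]" using \<open>d \<in> D\<close> ne(3) by (elim disjE) simp_all
  next
    fix d assume "d \<in> pedges [v, m, x]"
    then show "d \<in> {d \<in> D. d \<subseteq> set [v, m, x]}" using e by auto
  qed
  have ip2: "ipath D [v, m', x', x]"
    unfolding ipath_def
  proof (intro conjI equalityI subsetI)
    show "distinct [v, m', x', x]" using edge_in[OF e(3)] edge_in[OF e(4)] edge_in[OF e(5)] ne dm by auto
    fix d assume d: "d \<in> {d \<in> D. d \<subseteq> set [v, m', x', x]}"
    then obtain a b where ab: "d = {a, b}" "a \<noteq> b" using d2 by blast
    have "a \<in> {v, m', x', x}" "b \<in> {v, m', x', x}" "d \<in> D" using d ab(1) by auto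
    then have "d = {v, m'} \<or> d = {m', x'} \<or> d = {x', x} \<or> d = {v, x} \<or> d = {v, x'} \<or> d = {m', x}"
      using ab by (elim insertE emptyE) (simp_all add: doubleton_eq_iff)
    then show "d \<in> pedges [v, m', x', x]" using \<open>d \<in> D\<close> ne(3-5) by (elim disjE) simp_all
  next
    fix d assume "d \<in> pedges [v, m', x', x]"
    then show "d \<in> {d \<in> D. d \<subseteq> set [v, m', x', x]}" using e by auto
  qed
  have inA: "{v, m, x} \<subseteq> A" "set [m', x'] \<subseteq> A" using edge_in e by auto
  have "\<forall>e\<in>pedges [v, m, x] \<union> pedges (v # [m', x'] @ [x]). c e = i" using c by auto
  then show ?thesis unfolding copy_def using ip1 ip2 inA
    by (intro exI[of _ i] exI[of _ v] exI[of _ m] exI[of _ x] exI[of _ "[m', x']"]) auto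
qed

lemma card_cpairs_le:
  assumes "finite X"
  shows "card (cpairs c i X) \<le> 2 * card {d \<in> D. c d = i \<and> d \<subseteq> X}"
proof -
  let ?E = "{d \<in> D. c d = i \<and> d \<subseteq> X}"
  have fE: "finite ?E" using finD by simp
  have sub: "cpairs c i X \<subseteq> (\<Union>d\<in>?E. {z. fst z \<in> d \<and> snd z \<in> d \<and> fst z \<noteq> snd z})"
    unfolding cpairs_def using edge_in by fastforce
  have two: "finite {z. fst z \<in> d \<and> snd z \<in> d \<and> fst z \<noteq> snd z} \<and> card {z. fst z \<in> d \<and> snd z \<in> d \<and> fst z \<noteq> snd z} = 2"
    if dE: "d \<in> ?E" for d
  proof -
    obtain a b where ab: "d = {a, b}" "a \<noteq> b" using D[of d] dE by (auto simp: card_2_iff)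
    have "{z. fst z \<in> d \<and> snd z \<in> d \<and> fst z \<noteq> snd z} = {(a, b), (b, a)}" using ab by auto
    then show ?thesis using ab(2) by simp
  qed
  have "card (cpairs c i X) \<le> card (\<Union>d\<in>?E. {z. fst z \<in> d \<and> snd z \<in> d \<and> fst z \<noteq> snd z})"
    by (rule card_mono[OF _ sub]) (use fE two in auto)
  also have "\<dots> \<le> (\<Sum>d\<in>?E. card {z. fst z \<in> d \<and> snd z \<in> d \<and> fst z \<noteq> snd z})" by (rule card_UN_le[OF fE])
  also have "\<dots> = (\<Sum>d\<in>?E. 2)" by (rule sum.cong) (use two in auto)
  finally show ?thesis by simp
qed

text \<open>In the second neighbourhood of \<open>v\<close> in colour \<open>i\<close>, an edge \<open>xx'\<close> of colour \<open>i\<close> completes a pentagon;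
  it fails to give a copy of the two paths only if \<open>x\<close> is adjacent to the vertex between \<open>v\<close> and \<open>x'\<close>.\<close>

lemma second_neighbourhood_sparse:
  assumes no: "\<not> copy c" and XA: "X \<subseteq> A"
    and m: "\<And>x. x \<in> X \<Longrightarrow> {v, m x} \<in> D \<and> {m x, x} \<in> D \<and> c {v, m x} = i \<and> c {m x, x} = i"
    and X: "\<And>x. x \<in> X \<Longrightarrow> x \<noteq> v \<and> {v, x} \<notin> D"
  shows "real (card (cpairs c i X)) \<le> \<tau>\<^sup>2 * n\<^sup>2"
proof -
  have fX: "finite X" using XA finA finite_subset by blast
  have n0: "0 \<le> n" using n by simp
  let ?Z = "\<lambda>y. {z. {z, y} \<in> D \<and> {z, m y} \<in> D}"
  have fZ: "finite (?Z y)" for y by (rule finite_subset[of _ A]) (use finA edge_in in auto)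
  have sub: "cpairs c i X \<subseteq> (\<Union>y\<in>X. (\<lambda>z. (z, y)) ` ?Z y)"
  proof
    fix z assume z: "z \<in> cpairs c i X"
    then obtain x x' where zx: "z = (x, x')" and xx: "x \<in> X" "x' \<in> X" "{x, x'} \<in> D" "c {x, x'} = i"
      unfolding cpairs_def by auto
    have "{m x', x} \<in> D"
    proof (rule ccontr)
      assume "{m x', x} \<notin> D"
      then have "copy c"
        using copyI[of v "m x" x "m x'" x' c i] m[OF xx(1)] m[OF xx(2)] X[OF xx(1)] X[OF xx(2)] xx(3,4)
        by (auto simp: insert_commute)
      then show False using no by simp
    qed
    then have "x \<in> ?Z x'" using xx(3) by (simp add: insert_commute)
    then show "z \<in> (\<Union>y\<in>X. (\<lambda>z. (z, y)) ` ?Z y)" using zx xx(2) by blast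
  qed
  have "card (cpairs c i X) \<le> card (\<Union>y\<in>X. (\<lambda>z. (z, y)) ` ?Z y)"
    by (rule card_mono[OF _ sub]) (use fX fZ in auto)
  also have "\<dots> \<le> (\<Sum>y\<in>X. card ((\<lambda>z. (z, y)) ` ?Z y))" by (rule card_UN_le[OF fX])
  finally have "real (card (cpairs c i X)) \<le> (\<Sum>y\<in>X. real (card ((\<lambda>z. (z, y)) ` ?Z y)))"
    using of_nat_mono[where 'a = real] by (simp flip: of_nat_sum)
  also have "\<dots> \<le> (\<Sum>y\<in>X. \<tau>\<^sup>2 * n)"
  proof (rule sum_mono)
    fix y assume y: "y \<in> X"
    have "real (card ((\<lambda>z. (z, y)) ` ?Z y)) \<le> real (card (?Z y))" using card_image_le[OF fZ] by simp
    also have "\<dots> \<le> \<tau>\<^sup>2 * n" by (rule codegree) (use m[OF y] in \<open>simp add: insert_commute\<close>)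
    finally show "real (card ((\<lambda>z. (z, y)) ` ?Z y)) \<le> \<tau>\<^sup>2 * n" .
  qed
  also have "\<dots> = real (card X) * (\<tau>\<^sup>2 * n)" by simp
  also have "\<dots> \<le> n * (\<tau>\<^sup>2 * n)"
    using card_mono[OF finA XA] n n0 by (intro mult_right_mono) auto
  finally show ?thesis by (simp add: power2_eq_square mult_ac)
qed

context
  fixes c :: "'a set \<Rightarrow> nat" and k :: nat and \<Lambda> :: real
  assumes c: "\<And>d. d \<in> D \<Longrightarrow> c d < k" and k: "1 \<le> k" and \<Lambda>: "1 \<le> \<Lambda>"
    and K1: "real k * \<tau>\<^sup>2 + \<eta> \<le> \<tau> / (2 * \<Lambda>\<^sup>2)" and K2: "\<eta> \<le> \<tau>\<^sup>2 / (32 * (real k)\<^sup>2 * \<Lambda>\<^sup>2)"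
    and K3: "\<tau> \<le> 1 / (16 * real k * \<Lambda>)" and K4: "32 * real k * \<Lambda> \<le> n"
    and no: "\<not> copy c"
begin

text \<open>Mixing provides \<open>\<tau> * s\<^sup>2 - \<eta> * n\<^sup>2\<close> pairs in a set of
  \<open>s\<close> vertices, and the eliminated colours hold at most
  \<open>k * \<tau>\<^sup>2 * n\<^sup>2\<close> of them. By \<open>K1\<close> both losses together
  are at most half of the main term as long as s >= n / \<Lambda>.\<close>

lemma many_pairs:
  assumes S: "S \<subseteq> A" "n / \<Lambda> \<le> real (card S)" and C: "C \<subseteq> {..<k}"
    and sp: "\<And>i. i \<in> C \<Longrightarrow> real (card (cpairs c i S)) \<le> \<tau>\<^sup>2 * n\<^sup>2"
  shows "\<tau> * (real (card S))\<^sup>2 / 2 \<le> (\<Sum>i\<in>{..<k} - C. real (card (cpairs c i S)))"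
proof -
  have fS: "finite S" using S finA finite_subset by blast
  have k0: "0 < real k" using k by simp
  have n0: "0 < n" using K4 mult_pos_pos[of "32 * real k" \<Lambda>] k0 \<Lambda> by linarith
  have "{(x, y). x \<in> S \<and> y \<in> S \<and> {x, y} \<in> D} = (\<Union>i\<in>{..<k}. cpairs c i S)"
    unfolding cpairs_def using c by auto
  then have "card {(x, y). x \<in> S \<and> y \<in> S \<and> {x, y} \<in> D} \<le> (\<Sum>i<k. card (cpairs c i S))"
    using card_UN_le[of "{..<k}" "\<lambda>i. cpairs c i S"] by simp
  then have "real (card {(x, y). x \<in> S \<and> y \<in> S \<and> {x, y} \<in> D}) \<le> (\<Sum>i<k. real (card (cpairs c i S)))"
    unfolding of_nat_sum[symmetric] by (rule of_nat_mono)
  also have "\<dots> = (\<Sum>i\<in>{..<k} - C. real (card (cpairs c i S))) + (\<Sum>i\<in>C. real (card (cpairs c i S)))"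
    by (rule sum.subset_diff[OF C]) simp
  also have "(\<Sum>i\<in>C. real (card (cpairs c i S))) \<le> real k * (\<tau>\<^sup>2 * n\<^sup>2)"
  proof -
    have "(\<Sum>i\<in>C. real (card (cpairs c i S))) \<le> real (card C) * (\<tau>\<^sup>2 * n\<^sup>2)"
      by (rule sum_bounded_above) (rule sp)
    also have "\<dots> \<le> real k * (\<tau>\<^sup>2 * n\<^sup>2)"
      using card_mono[OF _ C] by (intro mult_right_mono) auto
    finally show ?thesis .
  qed
  finally have 1: "real (card {(x, y). x \<in> S \<and> y \<in> S \<and> {x, y} \<in> D})
      \<le> (\<Sum>i\<in>{..<k} - C. real (card (cpairs c i S))) + real k * (\<tau>\<^sup>2 * n\<^sup>2)" by simp
  have 2: "\<tau> * (real (card S))\<^sup>2 - \<eta> * n\<^sup>2 \<le> real (card {(x, y). x \<in> S \<and> y \<in> S \<and> {x, y} \<in> D})"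
    using mix[OF S(1) S(1)] by (simp add: power2_eq_square mult.assoc)
  have sq: "(n / \<Lambda>)\<^sup>2 \<le> (real (card S))\<^sup>2" using S(2) n0 \<Lambda> by (intro power_mono) auto
  have "(real k * \<tau>\<^sup>2 + \<eta>) * n\<^sup>2 \<le> \<tau> / (2 * \<Lambda>\<^sup>2) * n\<^sup>2" using K1 by (rule mult_right_mono) simp
  also have "\<dots> = \<tau> / 2 * (n / \<Lambda>)\<^sup>2" by (simp add: power_divide)
  also have "\<dots> \<le> \<tau> / 2 * (real (card S))\<^sup>2" using sq \<tau> by (intro mult_left_mono) auto
  finally have "real k * (\<tau>\<^sup>2 * n\<^sup>2) + \<eta> * n\<^sup>2 \<le> \<tau> * (real (card S))\<^sup>2 / 2" by (simp add: algebra_simps)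
  then show ?thesis using 1 2 by linarith
qed

text \<open>Some remaining colour \<open>i\<close> has at least a 1/k share of the remaining pairs
  and thus a subgraph of large minimum degree. By mixing, the edges leaving the neighbourhood
  \<open>M\<close> of \<open>v\<close> do not fit into a small set, so the second neighbourhood is
  large; there colour \<open>i\<close> is sparse, as otherwise a copy would appear.\<close>

lemma eliminate_colour:
  assumes S: "S \<subseteq> A" "n / \<Lambda> \<le> real (card S)" and C: "C \<subseteq> {..<k}"
    and sp: "\<And>i. i \<in> C \<Longrightarrow> real (card (cpairs c i S)) \<le> \<tau>\<^sup>2 * n\<^sup>2"
  obtains i X where "i \<in> {..<k} - C" "X \<subseteq> S" "real (card S) / (32 * real k) \<le> real (card X)"
    "real (card (cpairs c i X)) \<le> \<tau>\<^sup>2 * n\<^sup>2"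
proof -
  have fS: "finite S" using S finA finite_subset by blast
  have k0: "0 < real k" using k by simp
  have n0: "0 < n" using K4 mult_pos_pos[of "32 * real k" \<Lambda>] k0 \<Lambda> by linarith
  define s where "s = real (card S)"
  have s0: "0 < s" unfolding s_def using S(2) divide_pos_pos[OF n0, of \<Lambda>] \<Lambda> by linarith
  have Sne: "S \<noteq> {}" using s0 unfolding s_def by auto
  have "\<exists>i\<in>{..<k} - C. \<tau> * s\<^sup>2 / (2 * real k) \<le> real (card (cpairs c i S))"
  proof (rule ccontr)
    assume "\<not> ?thesis"
    then have less: "real (card (cpairs c i S)) < \<tau> * s\<^sup>2 / (2 * real k)" if "i \<in> {..<k} - C" for i
      using that by (meson not_le)
    have tot: "\<tau> * s\<^sup>2 / 2 \<le> (\<Sum>i\<in>{..<k} - C. real (card (cpairs c i S)))"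
      unfolding s_def by (rule many_pairs[OF S C sp])
    have pos: "0 < \<tau> * s\<^sup>2 / 2" using \<tau> s0 by simp
    have ne: "{..<k} - C \<noteq> {}"
    proof
      assume empty: "{..<k} - C = {}"
      show False using tot pos unfolding empty by simp
    qed
    have "(\<Sum>i\<in>{..<k} - C. real (card (cpairs c i S))) < (\<Sum>i\<in>{..<k} - C. \<tau> * s\<^sup>2 / (2 * real k))"
      by (rule sum_strict_mono) (use less ne in auto)
    also have "\<dots> = real (card ({..<k} - C)) * (\<tau> * s\<^sup>2 / (2 * real k))" by simp
    also have "\<dots> \<le> real k * (\<tau> * s\<^sup>2 / (2 * real k))"
    proof (rule mult_right_mono)
      show "real (card ({..<k} - C)) \<le> real k" using card_mono[of "{..<k}" "{..<k} - C"] by simp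
    qed (use \<tau> k0 in simp)
    also have "\<dots> = \<tau> * s\<^sup>2 / 2" using k0 by simp
    finally show False using tot by linarith
  qed
  then obtain i where i: "i \<in> {..<k} - C" "\<tau> * s\<^sup>2 / (2 * real k) \<le> real (card (cpairs c i S))" by blast
  define E where "E = {d \<in> D. c d = i \<and> d \<subseteq> S}"
  have fE: "finite E" unfolding E_def using finD by simp
  \<comment> \<open>Edges per vertex: half of the \<open>\<tau> * s\<^sup>2 / (2 * k)\<close>
    ordered pairs, divided by \<open>s\<close>.\<close>
  define \<rho> where "\<rho> = \<tau> * s / (4 * real k)"
  have \<rho>0: "0 < \<rho>" unfolding \<rho>_def using \<tau> s0 k0 by simp
  have dens: "\<rho> * (real (card S) * (1 + max 0 (log 2 (real (card S) / s)))) \<le> real (card E)"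
  proof -
    have half: "x / 2 \<le> y" if "x \<le> 2 * y" for x y :: real using that by simp
    have le2: "\<tau> * s\<^sup>2 / (2 * real k) \<le> 2 * real (card E)"
      using i(2) card_cpairs_le[OF fS, of c i] unfolding E_def by linarith
    have eq: "\<rho> * (real (card S) * (1 + max 0 (log 2 (real (card S) / s)))) = (\<tau> * s\<^sup>2 / (2 * real k)) / 2"
      unfolding \<rho>_def s_def[symmetric] using s0 by (simp add: power2_eq_square)
    show ?thesis unfolding eq by (rule half[OF le2])
  qed
  have two: "card e = 2" "e \<subseteq> S" "e \<in> D" "c e = i" if "e \<in> E" for e using that D unfolding E_def by auto
  obtain W where W: "W \<subseteq> S" "W \<noteq> {}"
    "\<And>X. X \<subseteq> W \<Longrightarrow> \<rho> * real (card X) \<le> real (card {e \<in> E. id e \<subseteq> W \<and> id e \<inter> X \<noteq> {}})"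
  proof (rule dense_expander[OF fE fS Sne _ s0 _ dens])
    show "id e \<subseteq> S \<and> id e \<noteq> {}" if "e \<in> E" for e using two[OF that] by auto
    show "0 \<le> \<rho>" using \<rho>0 by simp
  qed (rule that; assumption)
  have fW: "finite W" using W(1) fS finite_subset by blast
  define N where "N w = {u \<in> W. {w, u} \<in> E}" for w
  have fN: "finite (N w)" for w unfolding N_def using fW by simp
  have deg: "\<rho> \<le> real (card (N w))" if w: "w \<in> W" for w
  proof -
    have "\<rho> * real (card {w}) \<le> real (card {e \<in> E. id e \<subseteq> W \<and> id e \<inter> {w} \<noteq> {}})"
      by (rule W(3)) (use w in simp)
    also have "\<dots> \<le> real (card (N w))" unfolding N_def
      using card_other_ends_ge[OF fW two(1), where v = w] by simp
    finally show ?thesis by simp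
  qed
  obtain v where v: "v \<in> W" using W(2) by blast
  define M where "M = N v"
  define Y where "Y = (\<Union>m\<in>M. N m)"
  have MW: "M \<subseteq> W" "Y \<subseteq> W" unfolding M_def Y_def N_def by auto
  have fMY: "finite M" "finite Y" using MW fW finite_subset by blast+
  have WA: "W \<subseteq> A" using W(1) S(1) by blast
  have cM: "\<rho> \<le> real (card M)" unfolding M_def by (rule deg[OF v])
  have M0: "0 < real (card M)" using cM \<rho>0 by linarith
  have "real (card M) * \<rho> \<le> real (card {(x, y). x \<in> M \<and> y \<in> Y \<and> {x, y} \<in> D})"
  proof -
    have "real (card M) * \<rho> = (\<Sum>x\<in>M. \<rho>)" by simp
    also have "\<dots> \<le> (\<Sum>x\<in>M. real (card (N x)))" by (rule sum_mono) (use deg MW in auto)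
    also have "\<dots> = real (card (SIGMA x:M. N x))" using fMY fN by (subst card_SigmaI) auto
    also have "\<dots> \<le> real (card {(x, y). x \<in> M \<and> y \<in> Y \<and> {x, y} \<in> D})"
    proof (rule of_nat_mono, rule card_mono)
      show "finite {(x, y). x \<in> M \<and> y \<in> Y \<and> {x, y} \<in> D}"
        by (rule finite_subset[of _ "M \<times> Y"]) (use fMY in auto)
      show "(SIGMA x:M. N x) \<subseteq> {(x, y). x \<in> M \<and> y \<in> Y \<and> {x, y} \<in> D}"
        unfolding Y_def using two(3) by (auto simp: N_def)
    qed
    finally show ?thesis .
  qed
  also have "\<dots> \<le> \<tau> * real (card M) * real (card Y) + \<eta> * n\<^sup>2"
    using mix[of M Y] MW WA by force
  finally have ineq: "real (card M) * \<rho> \<le> \<tau> * real (card M) * real (card Y) + \<eta> * n\<^sup>2" .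
  \<comment> \<open>By \<open>K2\<close> the mixing error costs half of the main term: the second
    neighbourhood has \<open>s / (8 * k)\<close> instead of \<open>s / (4 * k)\<close>
    vertices.\<close>
  have "\<eta> * n\<^sup>2 \<le> real (card M) * (\<tau> * (s / (8 * real k)))"
  proof -
    have "\<eta> * n\<^sup>2 \<le> \<tau>\<^sup>2 / (32 * (real k)\<^sup>2 * \<Lambda>\<^sup>2) * n\<^sup>2" using K2 by (rule mult_right_mono) simp
    also have "\<dots> = \<tau>\<^sup>2 / (32 * (real k)\<^sup>2) * (n / \<Lambda>)\<^sup>2" by (simp add: power_divide)
    also have "\<dots> \<le> \<tau>\<^sup>2 / (32 * (real k)\<^sup>2) * s\<^sup>2"
      unfolding s_def using S(2) n0 \<Lambda> by (intro mult_left_mono power_mono) auto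
    also have "\<dots> = \<rho> * (\<tau> * (s / (8 * real k)))" unfolding \<rho>_def by (simp add: power2_eq_square)
    also have "\<dots> \<le> real (card M) * (\<tau> * (s / (8 * real k)))"
      using cM \<tau> s0 k0 by (intro mult_right_mono) auto
    finally show ?thesis .
  qed
  then have "real (card M) * \<rho> \<le> real (card M) * (\<tau> * real (card Y) + \<tau> * (s / (8 * real k)))"
    using ineq by (simp add: algebra_simps)
  then have "\<rho> \<le> \<tau> * real (card Y) + \<tau> * (s / (8 * real k))" using M0 by simp
  then have "\<tau> * (s / (4 * real k)) \<le> \<tau> * (real (card Y) + s / (8 * real k))"
    unfolding \<rho>_def by (simp add: algebra_simps)
  then have "s / (4 * real k) \<le> real (card Y) + s / (8 * real k)"
    by (simp only: mult_le_cancel_left_pos[OF \<tau>])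
  moreover have "s / (4 * real k) = s / (8 * real k) + s / (8 * real k)" using k0 by (simp add: field_simps)
  ultimately have cY: "s / (8 * real k) \<le> real (card Y)" by linarith
  \<comment> \<open>Removing \<open>v\<close> and its neighbours excludes the chords at
    \<open>v\<close>. In units of \<open>s / (32 * k)\<close> this costs at most 2 for the
    neighbours and 1 for \<open>v\<close>, out of 4.\<close>
  define X where "X = Y - insert v {u. {u, v} \<in> D}"
  have XS: "X \<subseteq> S" "X \<subseteq> A" unfolding X_def using MW W(1) WA by auto
  have cX: "s / (32 * real k) \<le> real (card X)"
  proof -
    have finv: "finite {u. {u, v} \<in> D}" by (rule finite_subset[of _ A]) (use finA edge_in in auto)
    have "card Y - card (insert v {u. {u, v} \<in> D}) \<le> card X"
      unfolding X_def by (rule diff_card_le_card_Diff) (use finv in simp)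
    moreover have "card (insert v {u. {u, v} \<in> D}) \<le> Suc (card {u. {u, v} \<in> D})" by (rule card_insert_le_m1) auto
    ultimately have 1: "real (card Y) - (1 + real (card {u. {u, v} \<in> D})) \<le> real (card X)" by linarith
    have ns: "n / \<Lambda> \<le> s" using S(2) unfolding s_def .
    have "\<tau> * n \<le> 1 / (16 * real k * \<Lambda>) * n" using K3 n0 by (intro mult_right_mono) auto
    also have "\<dots> = (n / \<Lambda>) / (16 * real k)" using \<Lambda> by (simp add: field_simps)
    also have "\<dots> \<le> s / (16 * real k)" using ns k0 by (intro divide_right_mono) auto
    finally have 2: "real (card {u. {u, v} \<in> D}) \<le> s / (16 * real k)" using degree[of v] by linarith
    have "32 * real k \<le> n / \<Lambda>" using K4 \<Lambda> by (simp add: field_simps)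
    then have "32 * real k \<le> s" using ns by linarith
    then have 3: "1 \<le> s / (32 * real k)" using k0 by simp
    have "s / (8 * real k) = 4 * (s / (32 * real k))" "s / (16 * real k) = 2 * (s / (32 * real k))"
      using k0 by (simp_all add: field_simps)
    then show ?thesis using 1 2 3 cY by linarith
  qed
  have "\<forall>x\<in>X. \<exists>m. m \<in> M \<and> x \<in> N m" unfolding X_def Y_def by blast
  then obtain m where m: "\<And>x. x \<in> X \<Longrightarrow> m x \<in> M \<and> x \<in> N (m x)" by metis
  have "real (card (cpairs c i X)) \<le> \<tau>\<^sup>2 * n\<^sup>2"
  proof (rule second_neighbourhood_sparse[OF no XS(2), of v m])
    show "{v, m x} \<in> D \<and> {m x, x} \<in> D \<and> c {v, m x} = i \<and> c {m x, x} = i" if x: "x \<in> X" for x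
    proof -
      have "{v, m x} \<in> E" "{m x, x} \<in> E" using m[OF x] unfolding M_def N_def by auto
      then show ?thesis using two by blast
    qed
    show "x \<noteq> v \<and> {v, x} \<notin> D" if "x \<in> X" for x using that unfolding X_def by (auto simp: insert_commute)
  qed
  then show thesis using that[OF i(1) XS(1)] cX unfolding s_def by blast
qed

text \<open>After \<open>k\<close> eliminations every colour is sparse on a set that still has n /
  \<Lambda> vertices, and \<open>many_pairs\<close> then finds pairs without a colour to put them
  in.\<close>

lemma no_copy_impossible:
  assumes \<Lambda>k: "(32 * real k) ^ k \<le> \<Lambda>"
  shows False
proof -
  have k0: "0 < real k" using k by simp
  have n0: "0 < n" using K4 mult_pos_pos[of "32 * real k" \<Lambda>] k0 \<Lambda> by linarith
  have L1: "1 \<le> 32 * real k" using k by simp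
  have big: "n / \<Lambda> \<le> n / (32 * real k) ^ j" if "j \<le> k" for j
  proof -
    have "(32 * real k) ^ j \<le> (32 * real k) ^ k" by (rule power_increasing[OF that L1])
    then have "(32 * real k) ^ j \<le> \<Lambda>" using \<Lambda>k by linarith
    then show ?thesis using n0 k0 by (intro divide_left_mono) (auto intro!: mult_pos_pos simp: \<Lambda> less_le_trans[OF zero_less_one \<Lambda>])
  qed
  have "\<exists>C S. C \<subseteq> {..<k} \<and> card C = j \<and> S \<subseteq> A \<and> n / (32 * real k) ^ j \<le> real (card S) \<and>
      (\<forall>i\<in>C. real (card (cpairs c i S)) \<le> \<tau>\<^sup>2 * n\<^sup>2)" if "j \<le> k" for j
    using that
  proof (induction j)
    case 0
    then show ?case by (intro exI[of _ "{}"] exI[of _ A]) (use n in auto)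
  next
    case (Suc j)
    then obtain C S where IH: "C \<subseteq> {..<k}" "card C = j" "S \<subseteq> A" "n / (32 * real k) ^ j \<le> real (card S)"
      "\<forall>i\<in>C. real (card (cpairs c i S)) \<le> \<tau>\<^sup>2 * n\<^sup>2" by auto
    have "n / \<Lambda> \<le> real (card S)" using big[of j] IH(4) Suc.prems by linarith
    then obtain i X where iX: "i \<in> {..<k} - C" "X \<subseteq> S" "real (card S) / (32 * real k) \<le> real (card X)"
      "real (card (cpairs c i X)) \<le> \<tau>\<^sup>2 * n\<^sup>2"
      using eliminate_colour[OF IH(3) _ IH(1)] IH(5) by blast
    have fX: "finite S" using IH(3) finA finite_subset by blast
    show ?case
    proof (intro exI[of _ "insert i C"] exI[of _ X] conjI ballI)
      show "insert i C \<subseteq> {..<k}" using iX(1) IH(1) by auto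
      show "card (insert i C) = Suc j" using iX(1) IH(1,2) finite_subset[OF IH(1)] by auto
      show "X \<subseteq> A" using iX(2) IH(3) by blast
      have "n / (32 * real k) ^ Suc j = n / (32 * real k) ^ j / (32 * real k)" by simp
      also have "\<dots> \<le> real (card S) / (32 * real k)" using IH(4) k0 by (intro divide_right_mono) auto
      finally show "n / (32 * real k) ^ Suc j \<le> real (card X)" using iX(3) by linarith
      fix l assume l: "l \<in> insert i C"
      show "real (card (cpairs c l X)) \<le> \<tau>\<^sup>2 * n\<^sup>2"
      proof (cases "l = i")
        case False
        then have "real (card (cpairs c l S)) \<le> \<tau>\<^sup>2 * n\<^sup>2" using l IH(5) by simp
        moreover have "card (cpairs c l X) \<le> card (cpairs c l S)"
          by (rule card_mono[OF finite_cpairs[OF fX] cpairs_mono[OF iX(2)]])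
        ultimately show ?thesis by linarith
      qed (use iX(4) in simp)
    qed
  qed
  from this[of k] obtain C S where CS: "C \<subseteq> {..<k}" "card C = k" "S \<subseteq> A" "n / (32 * real k) ^ k \<le> real (card S)"
      "\<forall>i\<in>C. real (card (cpairs c i S)) \<le> \<tau>\<^sup>2 * n\<^sup>2" by auto
  have C: "C = {..<k}" using CS(1,2) card_subset_eq[of "{..<k}" C] by simp
  have nS: "n / \<Lambda> \<le> real (card S)" using big[of k] CS(4) by simp
  have "\<tau> * (real (card S))\<^sup>2 / 2 \<le> (\<Sum>i\<in>{..<k} - C. real (card (cpairs c i S)))"
    by (rule many_pairs[OF CS(3) nS CS(1)]) (use CS(5) in blast)
  then have le0: "\<tau> * (real (card S))\<^sup>2 \<le> 0" unfolding C by simp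
  have "0 < n / \<Lambda>" using n0 \<Lambda> by simp
  then have "0 < real (card S)" using nS by linarith
  then have "0 < \<tau> * (real (card S))\<^sup>2" using \<tau> by simp
  then show False using le0 by linarith
qed

end

lemma mixing_gadget:
  assumes k: "1 \<le> k"
    and K1: "real k * \<tau>\<^sup>2 + \<eta> \<le> \<tau> / (2 * ((32 * real k) ^ k)\<^sup>2)"
    and K2: "\<eta> \<le> \<tau>\<^sup>2 / (32 * (real k)\<^sup>2 * ((32 * real k) ^ k)\<^sup>2)"
    and K3: "\<tau> \<le> 1 / (16 * real k * (32 * real k) ^ k)" and K4: "32 * real k * (32 * real k) ^ k \<le> n"
  shows "gadget A D k 1"
  unfolding gadget_def
proof (intro conjI allI impI)
  fix c :: "'a set \<Rightarrow> nat" assume c: "\<forall>d\<in>D. c d < k"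
  have "copy c"
  proof (rule ccontr)
    assume "\<not> copy c"
    moreover have "1 \<le> (32 * real k) ^ k" by (rule one_le_power) (use k in simp)
    ultimately show False
      by (intro no_copy_impossible[OF _ k _ K1 K2 K3 K4 _ order_refl, of c]) (use c in auto)
  qed
  then show "\<exists>a x m y zs. length zs = Suc 1 \<and> {x, m, y} \<subseteq> A \<and> set zs \<subseteq> A \<and> ipath D [x, m, y] \<and>
      ipath D (x # zs @ [y]) \<and> (\<forall>e\<in>pedges [x, m, y] \<union> pedges (x # zs @ [y]). c e = a)"
    unfolding copy_def .
qed (use finA D in auto)

end

section \<open>A pseudorandom graph on pairs of residues\<close>

text \<open>For \<open>a \<noteq> a'\<close> the residues belonging to \<open>(a, b)\<close>
  and \<open>(a', b')\<close> determine \<open>(c, d)\<close>, so the relation behaves like a pairwise independent one.\<close>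

definition torus :: "nat \<Rightarrow> (int \<times> int) set" where
  "torus Q = {0..<int Q} \<times> {0..<int Q}"

text \<open>A thickened point-line incidence: for \<open>u = (a, b)\<close> and
  \<open>v = (c, d)\<close> the residue of \<open>a * c - b - d\<close> has to fall into an interval
  of length \<open>w\<close>, which gives density w / Q and a symmetric relation.\<close>

definition trel :: "nat \<Rightarrow> nat \<Rightarrow> int \<times> int \<Rightarrow> int \<times> int \<Rightarrow> bool" where
  "trel Q w u v \<longleftrightarrow> (fst u * fst v - snd u - snd v) mod int Q < int w"

text \<open>Equal first coordinates are left out since \<open>card_trel_two\<close> gives no
  codegree bound for them; this also excludes loops.\<close>

definition tedges :: "nat \<Rightarrow> nat \<Rightarrow> (int \<times> int) set set" where
  "tedges Q w = {{u, v} | u v. u \<in> torus Q \<and> v \<in> torus Q \<and> fst u \<noteq> fst v \<and> trel Q w u v}"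

lemma trel_sym: "trel Q w u v \<longleftrightarrow> trel Q w v u"
  unfolding trel_def by (simp add: mult.commute algebra_simps)

lemma tedges_iff: "{u, v} \<in> tedges Q w \<longleftrightarrow> u \<in> torus Q \<and> v \<in> torus Q \<and> fst u \<noteq> fst v \<and> trel Q w u v"
proof
  assume "{u, v} \<in> tedges Q w"
  then obtain u' v' where uv: "{u, v} = {u', v'}" "u' \<in> torus Q" "v' \<in> torus Q" "fst u' \<noteq> fst v'" "trel Q w u' v'"
    unfolding tedges_def by blast
  have "trel Q w v' u'" using uv(5) trel_sym by blast
  moreover have "(u = u' \<and> v = v') \<or> (u = v' \<and> v = u')" using uv(1) by (simp add: doubleton_eq_iff)
  ultimately show "u \<in> torus Q \<and> v \<in> torus Q \<and> fst u \<noteq> fst v \<and> trel Q w u v" using uv by auto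
next
  assume "u \<in> torus Q \<and> v \<in> torus Q \<and> fst u \<noteq> fst v \<and> trel Q w u v"
  then show "{u, v} \<in> tedges Q w" unfolding tedges_def by blast
qed

lemma finite_torus [simp]: "finite (torus Q)"
  unfolding torus_def by simp

lemma card_torus: "card (torus Q) = Q\<^sup>2"
  unfolding torus_def by (simp add: card_cartesian_product power2_eq_square)

lemma int_dvd_small_eq:
  fixes a b :: int
  assumes "int Q dvd a - b" "a \<in> {0..<int Q}" "b \<in> {0..<int Q}"
  shows "a = b"
  using assms by (metis atLeastLessThan_iff mod_eq_dvd_iff mod_pos_pos_trivial)

text \<open>For each \<open>c\<close> the map from d to (a c - b - d) mod Q is an involution of the
  residues, so each of the \<open>Q\<close> values of \<open>c\<close> contributes
  \<open>w\<close>.\<close>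

lemma card_trel:
  assumes Q: "0 < Q" "w \<le> Q" and u: "u \<in> torus Q"
  shows "card {v \<in> torus Q. trel Q w u v} = w * Q"
proof -
  obtain a b where ab: "u = (a, b)" by (cases u)
  have row: "card {d \<in> {0..<int Q}. (a * c - b - d) mod int Q < int w} = w" for c
  proof -
    let ?h = "\<lambda>d. (a * c - b - d) mod int Q"
    have "bij_betw ?h {d \<in> {0..<int Q}. ?h d < int w} {0..<int w}"
    proof (rule bij_betwI[where g = ?h])
      show "?h \<in> {d \<in> {0..<int Q}. ?h d < int w} \<rightarrow> {0..<int w}" using Q by auto
      have inv: "?h (?h d) = d" if "d \<in> {0..<int Q}" for d
      proof -
        have "?h (?h d) = (a * c - b - (a * c - b - d)) mod int Q" by (rule mod_diff_right_eq)
        then show ?thesis using that by simp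
      qed
      show "?h \<in> {0..<int w} \<rightarrow> {d \<in> {0..<int Q}. ?h d < int w}"
      proof
        fix d assume d: "d \<in> {0..<int w}"
        then have "d \<in> {0..<int Q}" using Q by auto
        then show "?h d \<in> {d \<in> {0..<int Q}. ?h d < int w}" using inv[of d] d Q by auto
      qed
      show "?h (?h d) = d" if "d \<in> {d \<in> {0..<int Q}. ?h d < int w}" for d using inv that by blast
      show "?h (?h d) = d" if "d \<in> {0..<int w}" for d by (rule inv) (use that Q in auto)
    qed
    then have "card {d \<in> {0..<int Q}. ?h d < int w} = card {0..<int w}" by (rule bij_betw_same_card)
    then show ?thesis by simp
  qed
  have "{v \<in> torus Q. trel Q w u v} = (SIGMA c:{0..<int Q}. {d \<in> {0..<int Q}. (a * c - b - d) mod int Q < int w})"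
    unfolding torus_def trel_def ab by auto
  then have "card {v \<in> torus Q. trel Q w u v} = (\<Sum>c\<in>{0..<int Q}. card {d \<in> {0..<int Q}. (a * c - b - d) mod int Q < int w})"
    by (simp only:, intro card_SigmaI finite_atLeastLessThan_int ballI finite_subset[OF Collect_restrict])
  then show ?thesis unfolding row by (simp add: mult.commute)
qed

text \<open>Two residues determine \<open>(c, d)\<close>: their difference gives
  \<open>(a - a') * c\<close>, and \<open>a - a'\<close> is invertible modulo the prime. At most
  \<open>w\<^sup>2\<close> pairs of residues are small.\<close>

lemma card_trel_two:
  assumes Q: "prime Q" and u: "u \<in> torus Q" "u' \<in> torus Q" "fst u \<noteq> fst u'"
  shows "card {v \<in> torus Q. trel Q w u v \<and> trel Q w u' v} \<le> w\<^sup>2"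
proof -
  obtain a b where ab: "u = (a, b)" by (cases u)
  obtain a' b' where ab': "u' = (a', b')" by (cases u')
  have Q0: "0 < Q" using Q by (rule prime_gt_0_nat)
  let ?h = "\<lambda>v. ((a * fst v - b - snd v) mod int Q, (a' * fst v - b' - snd v) mod int Q)"
  let ?V = "{v \<in> torus Q. trel Q w u v \<and> trel Q w u' v}"
  have inj: "inj_on ?h ?V"
  proof (rule inj_onI)
    fix v v' assume v: "v \<in> ?V" "v' \<in> ?V" and eq: "?h v = ?h v'"
    obtain c d where cd: "v = (c, d)" by (cases v)
    obtain c' d' where cd': "v' = (c', d')" by (cases v')
    have r: "c \<in> {0..<int Q}" "d \<in> {0..<int Q}" "c' \<in> {0..<int Q}" "d' \<in> {0..<int Q}"
      "a \<in> {0..<int Q}" "a' \<in> {0..<int Q}"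
      using v u unfolding cd cd' ab ab' torus_def by auto
    have 1: "int Q dvd (a * c - b - d) - (a * c' - b - d')"
      using eq unfolding cd cd' by (simp add: mod_eq_dvd_iff)
    have 2: "int Q dvd (a' * c - b' - d) - (a' * c' - b' - d')"
      using eq unfolding cd cd' by (simp add: mod_eq_dvd_iff)
    have "int Q dvd ((a * c - b - d) - (a * c' - b - d')) - ((a' * c - b' - d) - (a' * c' - b' - d'))"
      by (rule dvd_diff[OF 1 2])
    also have "\<dots> = (a - a') * (c - c')" by (simp add: algebra_simps)
    finally have "int Q dvd (a - a') * (c - c')" .
    then have "int Q dvd a - a' \<or> int Q dvd c - c'" using Q by (simp add: prime_dvd_mult_iff)
    moreover have "\<not> int Q dvd a - a'" using int_dvd_small_eq[OF _ r(5,6)] u(3) ab ab' by auto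
    ultimately have "int Q dvd c - c'" by blast
    then have cc: "c = c'" using int_dvd_small_eq r by blast
    have "int Q dvd d' - d" using 1 cc by simp
    then have "d' = d" using int_dvd_small_eq r by blast
    then show "v = v'" using cc cd cd' by simp
  qed
  have "?h ` ?V \<subseteq> {0..<int w} \<times> {0..<int w}"
    using Q0 unfolding trel_def ab ab' by auto
  then have "card ?V \<le> card ({0..<int w} \<times> {0..<int w})" by (intro card_inj_on_le[OF inj]) auto
  then show ?thesis by (simp add: card_cartesian_product power2_eq_square)
qed

lemma sum_degree_swap:
  fixes R :: "'a \<Rightarrow> 'b \<Rightarrow> bool"
  assumes "finite X" "finite Y"
  shows "(\<Sum>y\<in>Y. real (card {x \<in> X. R x y})) = (\<Sum>x\<in>X. real (card {y \<in> Y. R x y}))"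
proof -
  have "(\<Sum>y\<in>Y. card {x \<in> X. R x y}) = (\<Sum>x\<in>X. card {y \<in> Y. R x y})"
    using sum_card_swap[OF assms(2,1), of "\<lambda>y x. R x y"] .
  from arg_cong[OF this, of real] show ?thesis by (simp only: of_nat_sum)
qed

lemma square_sum_le:
  fixes z :: "'b \<Rightarrow> real"
  assumes "finite Y"
  shows "(\<Sum>y\<in>Y. z y)\<^sup>2 \<le> (\<Sum>y\<in>Y. (z y)\<^sup>2) * real (card Y)"
proof (cases "Y = {}")
  case False
  define N where "N = real (card Y)"
  define s where "s = (\<Sum>y\<in>Y. z y)"
  define q where "q = (\<Sum>y\<in>Y. (z y)\<^sup>2)"
  have N: "0 < N" unfolding N_def using False assms by (simp add: card_gt_0_iff)
  have "0 \<le> (\<Sum>y\<in>Y. (N * z y - s)\<^sup>2)" by (rule sum_nonneg) simp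
  also have "\<dots> = (\<Sum>y\<in>Y. N\<^sup>2 * (z y)\<^sup>2 - (2 * N * s) * z y + s\<^sup>2)"
    by (rule sum.cong) (auto simp: power2_eq_square algebra_simps)
  also have "\<dots> = N\<^sup>2 * q - (2 * N * s) * s + N * s\<^sup>2"
    unfolding q_def N_def by (simp add: sum.distrib sum_subtractf sum_distrib_left[symmetric] s_def)
  also have "\<dots> = N * (q * N - s\<^sup>2)" by (simp add: power2_eq_square algebra_simps)
  finally have "0 \<le> q * N - s\<^sup>2" using N by (simp add: zero_le_mult_iff)
  then show ?thesis unfolding q_def N_def s_def by simp
qed simp

text \<open>Second moment: pairs with different first coordinates contribute at most as much as
  independent ones, which cancels against the square of the mean. Each \<open>x\<close> has at most
  \<open>Q\<close> partners with its own first coordinate, contributing at most \<open>w * Q\<close>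
  each; they make up the right-hand side.\<close>

lemma trel_variance:
  assumes Q: "prime Q" "w \<le> Q" and X: "X \<subseteq> torus Q"
  shows "(\<Sum>y\<in>torus Q. (real (card {x \<in> X. trel Q w x y}) - real (card X) * real w / real Q)\<^sup>2)
     \<le> real (card X) * real w * real Q ^ 2"
proof -
  let ?A = "torus Q" and ?d = "\<lambda>y. real (card {x \<in> X. trel Q w x y})"
  have Q0: "0 < Q" using Q(1) by (rule prime_gt_0_nat)
  have fX: "finite X" using X finite_subset by (metis finite_torus)
  have deg: "real (card {y \<in> ?A. trel Q w x y}) = real w * real Q" if "x \<in> X" for x
    using card_trel[OF Q0 Q(2), of x] that X by auto
  have s1: "(\<Sum>y\<in>?A. ?d y) = real (card X) * (real w * real Q)"
    by (subst sum_degree_swap[OF fX finite_torus]) (use deg in simp)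
  have s2: "(\<Sum>y\<in>?A. (?d y)\<^sup>2) \<le> (real (card X))\<^sup>2 * (real w)\<^sup>2 + real (card X) * real w * real Q ^ 2"
  proof -
    have sq: "(?d y)\<^sup>2 = real (card {z \<in> X \<times> X. trel Q w (fst z) y \<and> trel Q w (snd z) y})" for y
    proof -
      have "{z \<in> X \<times> X. trel Q w (fst z) y \<and> trel Q w (snd z) y} = {x \<in> X. trel Q w x y} \<times> {x \<in> X. trel Q w x y}" by auto
      then show ?thesis by (simp add: card_cartesian_product power2_eq_square)
    qed
    have "(\<Sum>y\<in>?A. (?d y)\<^sup>2) = (\<Sum>z\<in>X \<times> X. real (card {y \<in> ?A. trel Q w (fst z) y \<and> trel Q w (snd z) y}))"
      unfolding sq by (rule sum_degree_swap) (use fX in auto)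
    also have "\<dots> = (\<Sum>x\<in>X. \<Sum>x'\<in>X. real (card {y \<in> ?A. trel Q w x y \<and> trel Q w x' y}))"
      by (simp add: sum.cartesian_product case_prod_beta)
    also have "\<dots> \<le> (\<Sum>x\<in>X. real (card X) * (real w)\<^sup>2 + real Q * (real w * real Q))"
    proof (rule sum_mono)
      fix x assume x: "x \<in> X"
      have "(\<Sum>x'\<in>X. real (card {y \<in> ?A. trel Q w x y \<and> trel Q w x' y}))
          \<le> (\<Sum>x'\<in>X. (real w)\<^sup>2 + (if fst x' = fst x then real w * real Q else 0))"
      proof (rule sum_mono)
        fix x' assume x': "x' \<in> X"
        show "real (card {y \<in> ?A. trel Q w x y \<and> trel Q w x' y}) \<le> (real w)\<^sup>2 + (if fst x' = fst x then real w * real Q else 0)"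
        proof (cases "fst x' = fst x")
          case True
          have "card {y \<in> ?A. trel Q w x y \<and> trel Q w x' y} \<le> card {y \<in> ?A. trel Q w x y}"
            by (rule card_mono) auto
          then have le: "real (card {y \<in> ?A. trel Q w x y \<and> trel Q w x' y}) \<le> real w * real Q" using deg[OF x] by linarith
          have nn: "0 \<le> (real w)\<^sup>2" by simp
          show ?thesis unfolding if_P[OF True] using le nn by linarith
        next
          case False
          have "card {y \<in> ?A. trel Q w x y \<and> trel Q w x' y} \<le> w\<^sup>2"
            by (rule card_trel_two[OF Q(1)]) (use x x' X False in auto)
          then have "real (card {y \<in> ?A. trel Q w x y \<and> trel Q w x' y}) \<le> real (w\<^sup>2)" by (rule of_nat_mono)
          then show ?thesis using False by simp
        qed
      qed
      also have "\<dots> = real (card X) * (real w)\<^sup>2 + real (card {x' \<in> X. fst x' = fst x}) * (real w * real Q)"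
        using fX by (simp add: sum.distrib sum.If_cases Int_def)
      also have "\<dots> \<le> real (card X) * (real w)\<^sup>2 + real Q * (real w * real Q)"
      proof -
        have "{x' \<in> X. fst x' = fst x} \<subseteq> {fst x} \<times> {0..<int Q}" using X unfolding torus_def by auto
        then have "card {x' \<in> X. fst x' = fst x} \<le> card ({fst x} \<times> {0..<int Q})" by (rule card_mono[rotated]) simp
        then have "real (card {x' \<in> X. fst x' = fst x}) \<le> real Q" by (simp add: card_cartesian_product)
        then show ?thesis by (intro add_left_mono mult_right_mono) auto
      qed
      finally show "(\<Sum>x'\<in>X. real (card {y \<in> ?A. trel Q w x y \<and> trel Q w x' y}))
          \<le> real (card X) * (real w)\<^sup>2 + real Q * (real w * real Q)" .
    qed
    also have "\<dots> = (real (card X))\<^sup>2 * (real w)\<^sup>2 + real (card X) * real w * real Q ^ 2"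
      by (simp add: algebra_simps power2_eq_square)
    finally show ?thesis .
  qed
  define t where "t = real (card X) * real w / real Q"
  have tQ: "t * real Q = real (card X) * real w" unfolding t_def using Q0 by simp
  have "(\<Sum>y\<in>?A. (?d y - t)\<^sup>2) = (\<Sum>y\<in>?A. (?d y)\<^sup>2 - (2 * t) * ?d y + t\<^sup>2)"
    by (rule sum.cong) (auto simp: power2_eq_square algebra_simps)
  also have "\<dots> = (\<Sum>y\<in>?A. (?d y)\<^sup>2) - 2 * t * (\<Sum>y\<in>?A. ?d y) + real (card ?A) * t\<^sup>2"
    by (simp add: sum.distrib sum_subtractf sum_distrib_left)
  also have "\<dots> = (\<Sum>y\<in>?A. (?d y)\<^sup>2) - 2 * t * (real (card X) * (real w * real Q)) + (t * real Q)\<^sup>2"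
    unfolding s1 card_torus by (simp add: power_mult_distrib mult.commute)
  also have "2 * t * (real (card X) * (real w * real Q)) = 2 * (t * real Q) * (real (card X) * real w)" by simp
  also have "(\<Sum>y\<in>?A. (?d y)\<^sup>2) - 2 * (t * real Q) * (real (card X) * real w) + (t * real Q)\<^sup>2
      = (\<Sum>y\<in>?A. (?d y)\<^sup>2) - (real (card X))\<^sup>2 * (real w)\<^sup>2"
    unfolding tQ by (simp add: power2_eq_square)
  also have "\<dots> \<le> real (card X) * real w * real Q ^ 2" using s2 by linarith
  finally show ?thesis unfolding t_def .
qed

text \<open>Cauchy-Schwarz applied to the deviations over \<open>Y\<close>, which are extended to
  the whole torus; both cardinalities are estimated by Q^2.\<close>

lemma trel_mixing:
  assumes Q: "prime Q" "w \<le> Q" and X: "X \<subseteq> torus Q" and Y: "Y \<subseteq> torus Q"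
  shows "\<bar>real (card {(x, y). x \<in> X \<and> y \<in> Y \<and> trel Q w x y}) - real w / real Q * real (card X) * real (card Y)\<bar>
     \<le> real Q ^ 3 * sqrt (real w)"
proof -
  let ?d = "\<lambda>y. real (card {x \<in> X. trel Q w x y})"
  let ?t = "real (card X) * real w / real Q"
  have fin: "finite X" "finite Y" using X Y finite_subset by (metis finite_torus)+
  have cX: "real (card X) \<le> real Q ^ 2" "real (card Y) \<le> real Q ^ 2"
    using of_nat_mono[OF card_mono[OF finite_torus X], where 'a = real]
      of_nat_mono[OF card_mono[OF finite_torus Y], where 'a = real] unfolding card_torus by simp_all
  have "{(x, y). x \<in> X \<and> y \<in> Y \<and> trel Q w x y} = (\<lambda>(y, x). (x, y)) ` (SIGMA y:Y. {x \<in> X. trel Q w x y})" by auto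
  then have "card {(x, y). x \<in> X \<and> y \<in> Y \<and> trel Q w x y} = card (SIGMA y:Y. {x \<in> X. trel Q w x y})"
    by (simp add: card_image inj_on_def)
  then have e: "real (card {(x, y). x \<in> X \<and> y \<in> Y \<and> trel Q w x y}) = (\<Sum>y\<in>Y. ?d y)"
    using fin by (simp add: card_SigmaI)
  have "(\<Sum>y\<in>Y. ?d y) - real w / real Q * real (card X) * real (card Y) = (\<Sum>y\<in>Y. ?d y - ?t)"
    by (simp add: sum_subtractf mult_ac)
  moreover have "\<bar>\<Sum>y\<in>Y. ?d y - ?t\<bar> \<le> real Q ^ 3 * sqrt (real w)"
  proof -
    have "(\<Sum>y\<in>Y. ?d y - ?t)\<^sup>2 \<le> (\<Sum>y\<in>Y. (?d y - ?t)\<^sup>2) * real (card Y)"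
      by (rule square_sum_le[OF fin(2)])
    also have "\<dots> \<le> (\<Sum>y\<in>torus Q. (?d y - ?t)\<^sup>2) * real (card Y)"
      by (intro mult_right_mono sum_mono2) (use Y in auto)
    also have "\<dots> \<le> (real (card X) * real w * real Q ^ 2) * real (card Y)"
      by (intro mult_right_mono trel_variance[OF Q X]) auto
    also have "\<dots> \<le> (real Q ^ 2 * real w * real Q ^ 2) * real Q ^ 2"
      using cX by (intro mult_mono) auto
    also have "\<dots> = (real Q ^ 3 * sqrt (real w))\<^sup>2"
      by (simp add: power_mult_distrib power2_eq_square power3_eq_cube)
    finally have sq: "(\<Sum>y\<in>Y. ?d y - ?t)\<^sup>2 \<le> (real Q ^ 3 * sqrt (real w))\<^sup>2" .
    have nn: "0 \<le> real Q ^ 3 * sqrt (real w)" by simp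
    show ?thesis using abs_le_square_iff[THEN iffD2, OF sq] unfolding abs_of_nonneg[OF nn] .
  qed
  ultimately show ?thesis unfolding e by simp
qed

text \<open>Leaving out equal first coordinates changes the count by at most Q^3. Together with the
  error of \<open>trel\<close> this is at most 2 Q^3 sqrt Q, written as a multiple of the squared
  number of vertices.\<close>

lemma tedges_mixing:
  assumes Q: "prime Q" "w \<le> Q" and X: "X \<subseteq> torus Q" and Y: "Y \<subseteq> torus Q"
  shows "\<bar>real (card {(x, y). x \<in> X \<and> y \<in> Y \<and> {x, y} \<in> tedges Q w}) - real w / real Q * real (card X) * real (card Y)\<bar>
     \<le> 2 / sqrt (real Q) * (real Q ^ 2)\<^sup>2"
proof -
  have Q0: "0 < Q" using Q(1) by (rule prime_gt_0_nat)
  have fin: "finite X" "finite Y" using X Y finite_subset by (metis finite_torus)+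
  let ?R = "{(x, y). x \<in> X \<and> y \<in> Y \<and> trel Q w x y}"
  let ?D = "{(x, y). x \<in> X \<and> y \<in> Y \<and> {x, y} \<in> tedges Q w}"
  let ?B = "SIGMA x:X. {y \<in> Y. fst y = fst x}"
  have fR: "finite ?R" by (rule finite_subset[of _ "X \<times> Y"]) (use fin in auto)
  have DR: "?D \<subseteq> ?R" unfolding tedges_iff by auto
  have RD: "?R \<subseteq> ?D \<union> ?B" unfolding tedges_iff using X Y by auto
  have "card ?B \<le> Q ^ 3"
  proof -
    have row: "card {y \<in> Y. fst y = fst x} \<le> Q" for x
    proof -
      have "{y \<in> Y. fst y = fst x} \<subseteq> {fst x} \<times> {0..<int Q}" using Y unfolding torus_def by auto
      then have "card {y \<in> Y. fst y = fst x} \<le> card ({fst x} \<times> {0..<int Q})" by (rule card_mono[rotated]) simp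
      then show ?thesis by (simp add: card_cartesian_product)
    qed
    have "card ?B = (\<Sum>x\<in>X. card {y \<in> Y. fst y = fst x})" using fin by (simp add: card_SigmaI)
    also have "\<dots> \<le> (\<Sum>x\<in>X. Q)" by (rule sum_mono) (rule row)
    also have "\<dots> = card X * Q" by simp
    also have "\<dots> \<le> Q\<^sup>2 * Q" using card_mono[OF finite_torus X] unfolding card_torus by (rule mult_right_mono) simp
    finally show ?thesis by (simp add: power2_eq_square power3_eq_cube)
  qed
  moreover have "card ?R \<le> card (?D \<union> ?B)"
    by (rule card_mono[OF _ RD]) (use fR DR fin finite_subset in \<open>auto\<close>)
  moreover have "card (?D \<union> ?B) \<le> card ?D + card ?B" by (rule card_Un_le)
  moreover have "card ?D \<le> card ?R" by (rule card_mono[OF fR DR])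
  ultimately have R: "card ?D \<le> card ?R" "card ?R \<le> card ?D + Q ^ 3" by linarith+
  then have c: "real (card ?D) \<le> real (card ?R)" "real (card ?R) \<le> real (card ?D) + real Q ^ 3"
    using of_nat_mono[OF R(1), where 'a = real] of_nat_mono[OF R(2), where 'a = real] by simp_all
  have err: "real Q ^ 3 * sqrt (real w) + real Q ^ 3 \<le> 2 / sqrt (real Q) * (real Q ^ 2)\<^sup>2"
  proof -
    have s: "0 < sqrt (real Q)" "sqrt (real Q) * sqrt (real Q) = real Q" "1 \<le> sqrt (real Q)" "sqrt (real w) \<le> sqrt (real Q)"
      using Q0 Q(2) by auto
    have "real Q ^ 3 * sqrt (real w) \<le> real Q ^ 3 * sqrt (real Q)" using s by (intro mult_left_mono) auto
    moreover have "real Q ^ 3 * 1 \<le> real Q ^ 3 * sqrt (real Q)" using s by (intro mult_left_mono) auto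
    moreover have "2 / sqrt (real Q) * (real Q ^ 2)\<^sup>2 = 2 * (real Q ^ 3 * sqrt (real Q))"
    proof -
      have "(real Q ^ 2)\<^sup>2 = real Q ^ 3 * sqrt (real Q) * sqrt (real Q)"
        using s(2) by (simp add: mult.assoc power2_eq_square power3_eq_cube)
      then show ?thesis using s(1) by simp
    qed
    ultimately show ?thesis by linarith
  qed
  have "real w / real Q * real (card X) * real (card Y) - real Q ^ 3 * sqrt (real w) \<le> real (card ?R)"
    "real (card ?R) \<le> real w / real Q * real (card X) * real (card Y) + real Q ^ 3 * sqrt (real w)"
    using trel_mixing[OF Q X Y] by (simp_all add: abs_le_iff)
  moreover have "0 \<le> real Q ^ 3" by simp
  ultimately show ?thesis using c err unfolding abs_le_iff by linarith
qed

lemma mixing_graph_torus: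
  assumes Q: "prime Q" "w \<le> Q" "0 < w"
  shows "mixing_graph (torus Q) (tedges Q w) (real Q ^ 2) (real w / real Q) (2 / sqrt (real Q))"
proof
  have Q0: "0 < Q" using Q(1) by (rule prime_gt_0_nat)
  show "finite (torus Q)" by simp
  show "d \<subseteq> torus Q \<and> card d = 2" if "d \<in> tedges Q w" for d
    using that unfolding tedges_def by (auto simp: card_2_iff)
  show "real Q ^ 2 = real (card (torus Q))" unfolding card_torus by simp
  show "0 < real w / real Q" using Q(3) Q0 by simp
  show "0 \<le> 2 / sqrt (real Q)" by simp
  show "\<bar>real (card {(x, y). x \<in> X \<and> y \<in> Y \<and> {x, y} \<in> tedges Q w}) - real w / real Q * real (card X) * real (card Y)\<bar>
     \<le> 2 / sqrt (real Q) * (real Q ^ 2)\<^sup>2" if "X \<subseteq> torus Q" "Y \<subseteq> torus Q" for X Y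
    by (rule tedges_mixing[OF Q(1,2) that])
  show "real (card {u. {u, v} \<in> tedges Q w}) \<le> real w / real Q * real Q ^ 2" for v
  proof (cases "v \<in> torus Q")
    case True
    have "card {u. {u, v} \<in> tedges Q w} \<le> card {u \<in> torus Q. trel Q w v u}"
      by (rule card_mono) (auto simp: tedges_iff trel_sym)
    also have "\<dots> = w * Q" by (rule card_trel[OF Q0 Q(2) True])
    finally have "real (card {u. {u, v} \<in> tedges Q w}) \<le> real (w * Q)" by (rule of_nat_mono)
    then show ?thesis using Q0 by (simp add: power2_eq_square)
  next
    case False
    then have none: "{u. {u, v} \<in> tedges Q w} = {}" unfolding tedges_iff by auto
    show ?thesis unfolding none by simp
  qed
  show "real (card {z. {z, u} \<in> tedges Q w \<and> {z, v} \<in> tedges Q w}) \<le> (real w / real Q)\<^sup>2 * real Q ^ 2"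
    if uv: "{u, v} \<in> tedges Q w" for u v
  proof -
    have "card {z. {z, u} \<in> tedges Q w \<and> {z, v} \<in> tedges Q w} \<le> card {z \<in> torus Q. trel Q w u z \<and> trel Q w v z}"
      by (rule card_mono) (auto simp: tedges_iff trel_sym)
    also have "\<dots> \<le> w\<^sup>2" by (rule card_trel_two[OF Q(1)]) (use uv in \<open>auto simp: tedges_iff\<close>)
    finally have "real (card {z. {z, u} \<in> tedges Q w \<and> {z, v} \<in> tedges Q w}) \<le> real (w\<^sup>2)" by (rule of_nat_mono)
    then show ?thesis using Q0 by (simp add: power_divide)
  qed
qed

lemma card_tedges_le: "card (tedges Q w) \<le> Q ^ 4"
proof -
  have "tedges Q w \<subseteq> (\<lambda>(u, v). {u, v}) ` (torus Q \<times> torus Q)" unfolding tedges_def by auto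
  then have "card (tedges Q w) \<le> card (torus Q \<times> torus Q)" by (rule surj_card_le[rotated]) simp
  then show ?thesis by (simp add: card_cartesian_product card_torus flip: power_add)
qed

section \<open>Choice of the parameters\<close>

text \<open>The condition on \<open>G\<close> is circular, but \<open>host_sparsity\<close> depends
  on \<open>G\<close> only through a fifth power, so a multiple of \<open>h\<close> suffices for the
  exponential to win. The exponents count how often the density and \<open>r\<close> enter: 1 + 2 +
  5 = 8 and 4 + 2 + 6 = 12.\<close>

lemma host_bound:
  assumes k: "1 \<le> k" and h: "1 \<le> h" "k * r \<le> 2 ^ h"
  defines "G \<equiv> 200 * h"
  shows "2000 * host_sparsity k G r \<le> 2 ^ (G - 1)"
    and "host_density k G * host_factor k G r \<le> 2 ^ 215 * (k ^ 8 * h ^ 8 * r ^ 12)"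
proof -
  define \<mu> where "\<mu> = host_density k G"
  have \<mu>: "\<mu> = 240000 * k * h" unfolding \<mu>_def host_density_def G_def by simp
  have kh: "1 \<le> k * h" using k h by simp
  have B: "host_sparsity k G r \<le> 3 * 72 ^ 5 * 240001 ^ 5 * (k ^ 5 * h ^ 5 * r ^ 6)"
  proof -
    have "\<mu> + 1 \<le> 240001 * (k * h)" unfolding \<mu> using kh by (simp add: mult.assoc)
    then have "72 * (\<mu> + 1) * r \<le> 72 * (240001 * (k * h)) * r" by (intro mult_le_mono) auto
    then have "(72 * (\<mu> + 1) * r) ^ 5 \<le> (72 * (240001 * (k * h)) * r) ^ 5" by (rule power_mono) simp
    then have "host_sparsity k G r \<le> 3 * r * (72 * (240001 * (k * h)) * r) ^ 5"
      unfolding host_sparsity_def \<mu>_def by (rule mult_le_mono2)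
    also have "\<dots> = 3 * 72 ^ 5 * 240001 ^ 5 * (k ^ 5 * h ^ 5 * (r * r ^ 5))"
      by (simp only: power_mult_distrib mult_ac)
    also have "r * r ^ 5 = r ^ 6" by (simp flip: power_Suc)
    finally show ?thesis .
  qed
  have "2000 * host_sparsity k G r \<le> 2000 * (3 * 72 ^ 5 * 240001 ^ 5 * (k ^ 5 * h ^ 5 * r ^ 6))"
    using B by (rule mult_le_mono2)
  also have "\<dots> = (2000 * (3 * 72 ^ 5 * 240001 ^ 5)) * ((k ^ 5 * r ^ 6) * h ^ 5)" by (simp only: mult_ac)
  also have "\<dots> \<le> 2 ^ 138 * (2 ^ (6 * h) * 2 ^ (5 * h))"
  proof (intro mult_le_mono)
    show "2000 * (3 * 72 ^ 5 * 240001 ^ 5) \<le> (2 :: nat) ^ 138" by simp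
    have "k ^ 5 \<le> k ^ 6" by (rule power_increasing) (use k in auto)
    then have "k ^ 5 * r ^ 6 \<le> k ^ 6 * r ^ 6" by (rule mult_le_mono1)
    also have "\<dots> = (k * r) ^ 6" by (rule power_mult_distrib[symmetric])
    also have "\<dots> \<le> (2 ^ h) ^ 6" by (rule power_mono[OF h(2)]) simp
    finally show "k ^ 5 * r ^ 6 \<le> 2 ^ (6 * h)" by (simp add: mult.commute flip: power_mult)
    have "h \<le> 2 ^ h" by (rule less_imp_le) (rule less_exp)
    then have "h ^ 5 \<le> (2 ^ h) ^ 5" by (rule power_mono) simp
    then show "h ^ 5 \<le> 2 ^ (5 * h)" by (simp add: mult.commute flip: power_mult)
  qed
  also have "\<dots> = 2 ^ (138 + (6 * h + 5 * h))" by (simp only: power_add)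
  also have "\<dots> \<le> 2 ^ (G - 1)" by (rule power_increasing) (use h G_def in auto)
  finally show "2000 * host_sparsity k G r \<le> 2 ^ (G - 1)" .
  have "\<mu> * host_factor k G r = \<mu> * (2000 * ((32 * \<mu> * r\<^sup>2)\<^sup>2 * r\<^sup>2) * host_sparsity k G r)"
    unfolding host_factor_def host_growth_def \<mu>_def by (simp only: mult_ac)
  also have "\<dots> \<le> \<mu> * (2000 * ((32 * \<mu> * r\<^sup>2)\<^sup>2 * r\<^sup>2) * (3 * 72 ^ 5 * 240001 ^ 5 * (k ^ 5 * h ^ 5 * r ^ 6)))"
    using B by (intro mult_le_mono2)
  also have "\<dots> = (240000 * 2000 * 32\<^sup>2 * 240000\<^sup>2 * 3 * 72 ^ 5 * 240001 ^ 5) * (k ^ 8 * h ^ 8 * r ^ 12)"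
  proof -
    have "\<mu> * (2000 * ((32 * \<mu> * r\<^sup>2)\<^sup>2 * r\<^sup>2) * (3 * 72 ^ 5 * 240001 ^ 5 * (k ^ 5 * h ^ 5 * r ^ 6)))
      = (240000 * 2000 * 32\<^sup>2 * 240000\<^sup>2 * 3 * 72 ^ 5 * 240001 ^ 5)
        * ((k * k\<^sup>2 * k ^ 5) * (h * h\<^sup>2 * h ^ 5) * ((r\<^sup>2)\<^sup>2 * r\<^sup>2 * r ^ 6))"
      unfolding \<mu> power_mult_distrib by (simp only: mult_ac)
    moreover have "k * k\<^sup>2 * k ^ 5 = k ^ 8" "h * h\<^sup>2 * h ^ 5 = h ^ 8" "(r\<^sup>2)\<^sup>2 * r\<^sup>2 * r ^ 6 = r ^ 12"
      by (simp_all flip: power_Suc power_add power_mult)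
    ultimately show ?thesis by simp
  qed
  also have "\<dots> \<le> 2 ^ 215 * (k ^ 8 * h ^ 8 * r ^ 12)" by (rule mult_le_mono1) simp
  finally show "host_density k G * host_factor k G r \<le> 2 ^ 215 * (k ^ 8 * h ^ 8 * r ^ 12)" unfolding \<mu>_def .
qed

lemma ind_size_ramsey_cycle_gadget:
  assumes gad: "gadget A D k \<delta>" and k: "1 \<le> k" and \<delta>: "\<delta> = 1 \<or> \<delta> = 2"
    and h: "1 \<le> h" "k * card A \<le> 2 ^ h"
  obtains n0 where "\<And>n. n0 \<le> n \<Longrightarrow> \<delta> dvd n \<Longrightarrow>
    ind_size_ramsey k (cycle_graph n) \<le> enat (2 ^ 215 * (k ^ 8 * h ^ 8 * card A ^ 12) * card D * n)"
proof -
  have G: "1 \<le> 200 * h" using h by simp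
  obtain n0 where n0: "\<And>n. n0 \<le> n \<Longrightarrow> \<delta> dvd n \<Longrightarrow>
    ind_size_ramsey k (cycle_graph n) \<le> enat (host_density k (200 * h) * host_factor k (200 * h) (card A) * card D * n)"
    using ind_size_ramsey_cycle_le[OF gad k \<delta> G host_bound(1)[OF k h]] by blast
  show thesis
  proof (rule that[of n0])
    fix n assume "n0 \<le> n" "\<delta> dvd n"
    note n0[OF this]
    also have "enat (host_density k (200 * h) * host_factor k (200 * h) (card A) * card D * n)
        \<le> enat (2 ^ 215 * (k ^ 8 * h ^ 8 * card A ^ 12) * card D * n)"
      unfolding enat_ord_simps by (intro mult_le_mono1 host_bound(2)[OF k h])
    finally show "ind_size_ramsey k (cycle_graph n) \<le> enat (2 ^ 215 * (k ^ 8 * h ^ 8 * card A ^ 12) * card D * n)" .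
  qed
qed

text \<open>Serves to trade powers of the logarithm \<open>t\<close> of \<open>k\<close> for powers
  of \<open>k\<close>, at a rate of three to one.\<close>

lemma cube_le_power: "1 \<le> t \<Longrightarrow> t ^ 3 \<le> (8 :: nat) * 2 ^ (t - 1)"
proof (induction t rule: dec_induct)
  case (step t)
  show ?case
  proof (cases "t < 4")
    case True
    then consider "t = 1" | "t = 2" | "t = 3" using step(1) by linarith
    then show ?thesis by cases (simp_all add: power3_eq_cube)
  next
    case False
    then have t4: "4 \<le> t" by simp
    have a: "4 * t\<^sup>2 \<le> t ^ 3" using mult_right_mono[OF t4, of "t\<^sup>2"] by (simp add: power2_eq_square power3_eq_cube)
    have b: "4 * t \<le> t\<^sup>2" using mult_right_mono[OF t4, of t] by (simp add: power2_eq_square)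
    have "Suc t ^ 3 = t ^ 3 + 3 * t\<^sup>2 + 3 * t + 1" by (simp add: power2_eq_square power3_eq_cube algebra_simps)
    then have "Suc t ^ 3 \<le> 2 * t ^ 3" using a b t4 by linarith
    also have "\<dots> \<le> 2 * (8 * 2 ^ (t - 1))" using step by simp
    also have "\<dots> = 8 * 2 ^ (Suc t - 1)" using step(1) by (cases t) auto
    finally show ?thesis .
  qed
qed simp

text \<open>Here r = 2 p^2, there are p^3 edges, and p is of order k^3 t with t about log k. Up to
  constants k^8 t^8 r^12 p^3 becomes k^8 t^8 p^27, that is k^89 t^35, and t^35 costs another k^12.
  This is k^101, rounded up to the stated exponent.\<close>

lemma even_cycles:
  assumes k: "1 \<le> k"
  obtains n0 where "\<And>n. n0 \<le> n \<Longrightarrow> even n \<Longrightarrow>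
    ind_size_ramsey k (cycle_graph n) \<le> enat (2 ^ 215 * 38 ^ 8 * 2 ^ 12 * 13312 ^ 27 * 8 ^ 12 * k ^ 102 * n)"
proof -
  obtain s where s: "2 ^ s \<le> k" "k < 2 ^ (s + 1)" using ex_power_ivl1[OF _ k, of 2] by auto
  define t where "t = s + 1"
  have t1: "1 \<le> t" unfolding t_def by simp
  have kt: "k \<le> 2 ^ t" using s(2) unfolding t_def by simp
  have t3: "t ^ 3 \<le> 8 * k"
    using cube_le_power[OF t1] s(1) unfolding t_def by simp
  have "128 * k ^ 3 \<le> 2 ^ (3 * t + 7)"
  proof -
    have "k ^ 3 \<le> (2 ^ t) ^ 3" by (rule power_mono[OF kt]) simp
    then have "128 * k ^ 3 \<le> 128 * (2 ^ t) ^ 3" by (rule mult_le_mono2)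
    also have "\<dots> = 2 ^ (3 * t + 7)" by (simp add: power_add mult.commute flip: power_mult)
    finally show ?thesis .
  qed
  moreover have "1 \<le> 128 * k ^ 3" using k by simp
  ultimately obtain p where p: "prime p" "128 * k ^ 3 < p" "p \<le> 8 * (128 * k ^ 3) * (3 * t + 7)"
    using exists_prime_between[of "128 * k ^ 3" "3 * t + 7"] by auto
  have "3 * t + 7 \<le> 13 * t" using t1 by simp
  then have "8 * (128 * k ^ 3) * (3 * t + 7) \<le> 8 * (128 * k ^ 3) * (13 * t)" by (rule mult_le_mono2)
  also have "\<dots> = 13312 * (k ^ 3 * t)" by simp
  finally have pb: "p \<le> 13312 * (k ^ 3 * t)" using p(3) by (rule order_trans[rotated])
  have gad: "gadget (incidence_verts p) (incidence_edges p) k 2"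
    by (rule even_gadget[OF p(1) _ k]) (use p(2) in simp)
  have tt: "t \<le> 2 ^ t" by (rule less_imp_le) (rule less_exp)
  have p2: "p \<le> 2 ^ (14 + 4 * t)"
  proof -
    have "k ^ 3 * t \<le> (2 ^ t) ^ 3 * 2 ^ t" by (intro mult_le_mono power_mono kt tt) auto
    also have "\<dots> = 2 ^ (4 * t)"
    proof -
      have "4 * t = t * 3 + t" by simp
      then show ?thesis by (simp only: power_add power_mult)
    qed
    finally have "13312 * (k ^ 3 * t) \<le> 2 ^ 14 * 2 ^ (4 * t)" by (intro mult_le_mono) auto
    then show ?thesis using pb unfolding power_add by linarith
  qed
  \<comment> \<open>The exponent is t + 1 + 2 (14 + 4t) = 9t + 29, at most 38t.\<close>
  have h: "k * card (incidence_verts p) \<le> 2 ^ (38 * t)"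
  proof -
    have "k * (2 * p\<^sup>2) \<le> 2 ^ t * (2 ^ 1 * (2 ^ (14 + 4 * t))\<^sup>2)"
      by (intro mult_le_mono power_mono kt p2) auto
    also have "\<dots> = 2 ^ (t + (1 + (14 + 4 * t) * 2))" by (simp only: power_add power_mult)
    also have "\<dots> \<le> 2 ^ (38 * t)" by (rule power_increasing) (use t1 in auto)
    finally show ?thesis unfolding card_incidence_verts .
  qed
  have h1: "1 \<le> 38 * t" using t1 by simp
  obtain n0 where n0: "\<And>n. n0 \<le> n \<Longrightarrow> 2 dvd n \<Longrightarrow>
    ind_size_ramsey k (cycle_graph n) \<le> enat (2 ^ 215 * (k ^ 8 * (38 * t) ^ 8 * card (incidence_verts p) ^ 12) * card (incidence_edges p) * n)"
    using ind_size_ramsey_cycle_gadget[OF gad k _ h1 h] by blast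
  have bound: "2 ^ 215 * (k ^ 8 * (38 * t) ^ 8 * card (incidence_verts p) ^ 12) * card (incidence_edges p)
      \<le> 2 ^ 215 * 38 ^ 8 * 2 ^ 12 * 13312 ^ 27 * 8 ^ 12 * k ^ 102"
  proof -
    have p27: "(p\<^sup>2) ^ 12 * p ^ 3 = p ^ 27" by (simp flip: power_add power_mult)
    have "2 ^ 215 * (k ^ 8 * (38 * t) ^ 8 * (2 * p\<^sup>2) ^ 12) * p ^ 3
        = (2 ^ 215 * 38 ^ 8 * 2 ^ 12) * (k ^ 8 * t ^ 8 * ((p\<^sup>2) ^ 12 * p ^ 3))"
      unfolding power_mult_distrib by (simp only: mult_ac)
    also have "\<dots> = (2 ^ 215 * 38 ^ 8 * 2 ^ 12) * (k ^ 8 * t ^ 8 * p ^ 27)" unfolding p27 ..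
    also have "\<dots> \<le> (2 ^ 215 * 38 ^ 8 * 2 ^ 12) * (k ^ 8 * t ^ 8 * (13312 * (k ^ 3 * t)) ^ 27)"
      by (intro mult_le_mono2 power_mono pb) auto
    also have "\<dots> = (2 ^ 215 * 38 ^ 8 * 2 ^ 12 * 13312 ^ 27) * ((k ^ 8 * (k ^ 3) ^ 27) * (t ^ 8 * t ^ 27))"
      unfolding power_mult_distrib by (simp only: mult_ac)
    also have "\<dots> \<le> (2 ^ 215 * 38 ^ 8 * 2 ^ 12 * 13312 ^ 27) * ((k ^ 8 * (k ^ 3) ^ 27) * (8 ^ 12 * k ^ 12))"
    proof (intro mult_le_mono2)
      have "t ^ 8 * t ^ 27 = t ^ 35" by (simp flip: power_add)
      also have "\<dots> \<le> t ^ 36" by (rule power_increasing) (use t1 in auto)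
      also have "\<dots> = (t ^ 3) ^ 12" by (simp flip: power_mult)
      also have "\<dots> \<le> (8 * k) ^ 12" by (rule power_mono[OF t3]) simp
      also have "\<dots> = 8 ^ 12 * k ^ 12" by (rule power_mult_distrib)
      finally show "t ^ 8 * t ^ 27 \<le> 8 ^ 12 * k ^ 12" .
    qed
    also have "\<dots> = (2 ^ 215 * 38 ^ 8 * 2 ^ 12 * 13312 ^ 27 * 8 ^ 12) * (k ^ 8 * (k ^ 3) ^ 27 * k ^ 12)"
      by (simp only: mult_ac)
    also have "k ^ 8 * (k ^ 3) ^ 27 * k ^ 12 = k ^ 101" by (simp flip: power_add power_mult)
    also have "(2 ^ 215 * 38 ^ 8 * 2 ^ 12 * 13312 ^ 27 * 8 ^ 12) * k ^ 101 \<le> (2 ^ 215 * 38 ^ 8 * 2 ^ 12 * 13312 ^ 27 * 8 ^ 12) * k ^ 102"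
      by (intro mult_le_mono2 power_increasing) (use k in auto)
    finally show ?thesis unfolding card_incidence_verts card_incidence_edges .
  qed
  show thesis
  proof (rule that[of n0])
    fix n assume n: "n0 \<le> n" "even n"
    note n0[OF n(1)]
    also have "enat (2 ^ 215 * (k ^ 8 * (38 * t) ^ 8 * card (incidence_verts p) ^ 12) * card (incidence_edges p) * n)
        \<le> enat (2 ^ 215 * 38 ^ 8 * 2 ^ 12 * 13312 ^ 27 * 8 ^ 12 * k ^ 102 * n)"
      unfolding enat_ord_simps using bound by (rule mult_le_mono1)
    finally show "ind_size_ramsey k (cycle_graph n) \<le> enat (2 ^ 215 * 38 ^ 8 * 2 ^ 12 * 13312 ^ 27 * 8 ^ 12 * k ^ 102 * n)"
      using n by simp
  qed
qed

text \<open>The density w / Q lies between 1 / (2T) and 1 / T for T = 4 k Y, where Y is the square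
  of the total shrinking factor (32 k)^k. At the smallest density \<open>K2\<close> asks for an
  error of at most 2 / (4096 k^4 Y^3); as the error is 2 / sqrt Q, \<open>X\<close> is the square of
  this denominator.\<close>

lemma odd_gadget:
  fixes k :: nat
  assumes k: "1 \<le> k"
  defines "Y \<equiv> ((32 * k) ^ k)\<^sup>2"
  defines "X \<equiv> (4096 * k ^ 4 * Y ^ 3)\<^sup>2"
  obtains Q w where "gadget (torus Q) (tedges Q w) k 1" "Q \<le> 8 * X\<^sup>2"
proof -
  define L where "L = (32 * k) ^ k"
  have L: "32 \<le> L"
  proof -
    have "(32 * k) ^ 1 \<le> (32 * k) ^ k" by (rule power_increasing) (use k in auto)
    then show ?thesis unfolding L_def using k by simp
  qed
  have Y: "Y = L\<^sup>2" unfolding Y_def L_def ..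
  have Y1: "1 \<le> Y" unfolding Y using L by simp
  have X1: "1 \<le> X" unfolding X_def using k Y1 by simp
  \<comment> \<open>The logarithm is bounded by \<open>X\<close> itself: squaring the size only
    changes the constant in the final exponent.\<close>
  obtain Q where Q: "prime Q" "X < Q" "Q \<le> 8 * X * X"
    using exists_prime_between[OF X1 less_imp_le[OF less_exp] X1] by blast
  have Q0: "0 < Q" using Q(1) by (rule prime_gt_0_nat)
  define T where "T = 4 * k * Y"
  have T1: "1 \<le> T" unfolding T_def using k Y1 by simp
  define w where "w = Q div T"
  have TX: "4096 * k ^ 4 * Y ^ 3 \<le> X"
  proof -
    have "1 * (4096 * k ^ 4 * Y ^ 3) \<le> (4096 * k ^ 4 * Y ^ 3) * (4096 * k ^ 4 * Y ^ 3)"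
      by (rule mult_le_mono1) (use k Y1 in simp)
    then show ?thesis unfolding X_def power2_eq_square by simp
  qed
  have kk: "k \<le> k ^ 4" using power_increasing[of 1 4 k] k by simp
  have YY: "Y \<le> Y ^ 3" using power_increasing[of 1 3 Y] Y1 by simp
  have "2 * T \<le> 4096 * k ^ 4 * Y ^ 3"
  proof -
    have "2 * T = 8 * k * Y" unfolding T_def by simp
    also have "\<dots> \<le> 4096 * k ^ 4 * Y ^ 3" by (intro mult_le_mono kk YY) auto
    finally show ?thesis .
  qed
  then have TQ: "2 * T \<le> Q" using TX Q(2) by linarith
  have wQ: "w * T \<le> Q" unfolding w_def by simp
  have wQ2: "Q \<le> 2 * (w * T)"
  proof -
    have "Q = w * T + Q mod T" unfolding w_def by simp
    moreover have "Q mod T < T" using T1 by simp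
    ultimately show ?thesis using TQ by linarith
  qed
  have w0: "0 < w" using wQ2 Q0 by (cases w) auto
  have wle: "w \<le> Q" unfolding w_def by (rule div_le_dividend)
  interpret mixing_graph "torus Q" "tedges Q w" "real Q ^ 2" "real w / real Q" "2 / sqrt (real Q)"
    by (rule mixing_graph_torus[OF Q(1) wle w0])
  define \<tau> where "\<tau> = real w / real Q"
  define \<eta> where "\<eta> = 2 / sqrt (real Q)"
  define y where "y = real Y"
  define l where "l = real L"
  have y: "y = l\<^sup>2" unfolding y_def l_def Y by simp
  have l32: "32 \<le> l" unfolding l_def using L by simp
  have y0: "1 \<le> y" unfolding y_def using Y1 by simp
  have k0: "1 \<le> real k" using k by simp
  have rT: "real T = 4 * real k * y" unfolding T_def y_def by simp
  have T0: "0 < real T" using T1 by simp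
  have Qr: "0 < real Q" using Q0 by simp
  have t1: "\<tau> \<le> 1 / real T"
  proof -
    have "real w * real T \<le> real Q" using of_nat_mono[OF wQ, where 'a = real] by simp
    then show ?thesis unfolding \<tau>_def using T0 Qr by (simp add: field_simps)
  qed
  have t2: "1 / (2 * real T) \<le> \<tau>"
  proof -
    have "real Q \<le> 2 * (real w * real T)" using of_nat_mono[OF wQ2, where 'a = real] by simp
    then show ?thesis unfolding \<tau>_def using T0 Qr by (simp add: field_simps)
  qed
  have t0: "0 < \<tau>" unfolding \<tau>_def using w0 Q0 by simp
  have "1 / real T \<le> 1" using T1 by simp
  then have tle1: "\<tau> \<le> 1" using t1 by linarith
  have e0: "\<eta> \<le> 2 / (4096 * real k ^ 4 * y ^ 3)"
  proof -
    have "(4096 * real k ^ 4 * y ^ 3)\<^sup>2 \<le> real Q"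
    proof -
      have "real X \<le> real Q" using Q(2) by simp
      then show ?thesis unfolding X_def y_def by simp
    qed
    then have "4096 * real k ^ 4 * y ^ 3 \<le> sqrt (real Q)" by (rule real_le_rsqrt)
    moreover have "0 < 4096 * real k ^ 4 * y ^ 3" using k0 y0 by simp
    ultimately show ?thesis unfolding \<eta>_def using Qr k0 y0 k by (intro divide_left_mono mult_pos_pos) auto
  qed
  have K2: "\<eta> \<le> \<tau>\<^sup>2 / (32 * (real k)\<^sup>2 * l\<^sup>2)"
  proof -
    have "2 / (4096 * real k ^ 4 * y ^ 3) = (1 / (2 * real T))\<^sup>2 / (32 * (real k)\<^sup>2 * y)"
      unfolding rT using k0 y0 by (simp add: power2_eq_square power3_eq_cube power4_eq_xxxx divide_simps)
    also have "\<dots> \<le> \<tau>\<^sup>2 / (32 * (real k)\<^sup>2 * y)"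
      using t2 T0 k0 y0 by (intro divide_right_mono power_mono) auto
    finally show ?thesis using e0 unfolding y by linarith
  qed
  have K1: "real k * \<tau>\<^sup>2 + \<eta> \<le> \<tau> / (2 * l\<^sup>2)"
  proof -
    have "real k * \<tau>\<^sup>2 = real k * \<tau> * \<tau>" by (simp add: power2_eq_square)
    also have "\<dots> \<le> real k * \<tau> * (1 / real T)" using t1 t0 k0 by (intro mult_left_mono) auto
    also have "\<dots> = \<tau> / (4 * y)" unfolding rT using k0 y0 by (simp add: divide_simps)
    finally have 1: "real k * \<tau>\<^sup>2 \<le> \<tau> / (4 * y)" .
    have "\<tau>\<^sup>2 / (32 * (real k)\<^sup>2 * l\<^sup>2) \<le> \<tau> / (4 * y)"
    proof (rule frac_le)
      show "\<tau>\<^sup>2 \<le> \<tau>" using tle1 t0 by (simp add: power2_eq_square mult_left_le)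
      have "1 \<le> (real k)\<^sup>2" using k0 by simp
      then have "4 * 1 * y \<le> 32 * (real k)\<^sup>2 * y" using y0 by (intro mult_right_mono mult_mono) auto
      then show "4 * y \<le> 32 * (real k)\<^sup>2 * l\<^sup>2" unfolding y by simp
    qed (use t0 y0 in auto)
    then have "real k * \<tau>\<^sup>2 + \<eta> \<le> \<tau> / (4 * y) + \<tau> / (4 * y)" using 1 K2 by linarith
    also have "\<dots> = \<tau> / (2 * l\<^sup>2)" unfolding y[symmetric] using y0 by (simp add: field_simps)
    finally show ?thesis .
  qed
  have K3: "\<tau> \<le> 1 / (16 * real k * l)"
  proof -
    have "16 * real k * l \<le> real T"
    proof -
      have "16 * real k * l = 4 * real k * (4 * l)" by simp
      also have "\<dots> \<le> 4 * real k * (l * l)" using l32 k0 by (intro mult_left_mono mult_right_mono) auto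
      finally show ?thesis unfolding rT y by (simp add: power2_eq_square)
    qed
    then have "1 / real T \<le> 1 / (16 * real k * l)"
      by (intro divide_left_mono mult_pos_pos) (use T0 k0 l32 in auto)
    then show ?thesis using t1 by linarith
  qed
  have K4: "32 * real k * l \<le> real Q ^ 2"
  proof -
    have "L * 1 \<le> L * L" by (rule mult_le_mono2) (use L in linarith)
    then have "L \<le> Y" unfolding Y power2_eq_square by simp
    then have "L \<le> Y ^ 3" using YY by linarith
    then have "32 * k * L \<le> 4096 * k ^ 4 * Y ^ 3" by (intro mult_le_mono kk) auto
    then have "32 * k * L \<le> Q" using TX Q(2) by linarith
    also have "Q \<le> Q ^ 2" using Q0 by (simp add: power2_eq_square)
    finally have "real (32 * k * L) \<le> real (Q ^ 2)" by (rule of_nat_mono)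
    then show ?thesis unfolding l_def by simp
  qed
  have lk: "l = (32 * real k) ^ k" unfolding l_def L_def by simp
  have "gadget (torus Q) (tedges Q w) k 1"
    by (rule mixing_gadget[OF k K1[unfolded \<tau>_def \<eta>_def lk] K2[unfolded \<tau>_def \<eta>_def lk]
        K3[unfolded \<tau>_def lk] K4[unfolded lk]])
  then show thesis by (rule that) (use Q(3) in \<open>simp add: power2_eq_square\<close>)
qed

lemma power_exponent_mono:
  fixes k :: nat
  assumes "2 \<le> k" "a \<le> b"
  shows "k ^ a \<le> k ^ b"
  using assms by (intro power_increasing) auto

lemma two_power_le:
  fixes k :: nat
  assumes "2 \<le> k"
  shows "2 ^ a \<le> k ^ a"
  using assms by (intro power_mono) auto

text \<open>For \<open>k \<ge> 2\<close> every constant is at most a power of \<open>k\<close>, so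
  only exponents are tracked. They add up to 311 + 4984 k, which \<open>5140 * k\<close> covers from
  k = 2 on. As \<delta> = 1, every large \<open>n\<close> is reached.\<close>

lemma odd_cycles:
  assumes k: "2 \<le> k"
  obtains n0 where "\<And>n. n0 \<le> n \<Longrightarrow> ind_size_ramsey k (cycle_graph n) \<le> enat (k ^ (5140 * k) * n)"
proof -
  define Y where "Y = ((32 * k) ^ k)\<^sup>2"
  define X where "X = (4096 * k ^ 4 * Y ^ 3)\<^sup>2"
  have k1: "1 \<le> k" using k by simp
  obtain Q w where Q: "gadget (torus Q) (tedges Q w) k 1" "Q \<le> 8 * X\<^sup>2"
    using odd_gadget[OF k1] unfolding X_def Y_def by blast
  have two5: "32 \<le> k ^ 5" using two_power_le[OF k, of 5] by simp
  have two12: "4096 \<le> k ^ 12" using two_power_le[OF k, of 12] by simp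
  have Yb: "Y \<le> k ^ (12 * k)"
  proof -
    have "32 * k \<le> k ^ 5 * k" using two5 by (rule mult_le_mono1)
    then have "32 * k \<le> k ^ 6" by (simp add: power_numeral_reduce mult_ac)
    then have "((32 * k) ^ k)\<^sup>2 \<le> ((k ^ 6) ^ k)\<^sup>2" by (intro power_mono) auto
    also have "\<dots> = k ^ (12 * k)"
    proof -
      have "12 * k = 6 * k * 2" by simp
      then show ?thesis by (simp only: power_mult)
    qed
    finally show ?thesis unfolding Y_def .
  qed
  have Xb: "X \<le> k ^ (88 * k)"
  proof -
    have "4096 * k ^ 4 * Y ^ 3 \<le> k ^ 12 * k ^ 4 * (k ^ (12 * k)) ^ 3"
      by (intro mult_le_mono power_mono two12 Yb) auto
    also have "\<dots> = k ^ (12 + 4 + 12 * k * 3)" by (simp only: power_add power_mult)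
    also have "\<dots> \<le> k ^ (44 * k)" by (rule power_exponent_mono[OF k]) (use k in simp)
    finally have "X \<le> (k ^ (44 * k))\<^sup>2" unfolding X_def by (rule power_mono) simp
    also have "\<dots> = k ^ (44 * k * 2)" by (simp only: power_mult)
    finally show ?thesis by simp
  qed
  have Qb: "Q \<le> k ^ (178 * k)"
  proof -
    have "8 * X\<^sup>2 \<le> k ^ 3 * (k ^ (88 * k))\<^sup>2"
      using two_power_le[OF k, of 3] by (intro mult_le_mono power_mono Xb) auto
    also have "\<dots> = k ^ (3 + 88 * k * 2)" by (simp only: power_add power_mult)
    also have "\<dots> \<le> k ^ (178 * k)" by (rule power_exponent_mono[OF k]) (use k in simp)
    finally show ?thesis using Q(2) by linarith
  qed
  have rb: "card (torus Q) \<le> k ^ (356 * k)"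
  proof -
    have "Q\<^sup>2 \<le> (k ^ (178 * k))\<^sup>2" by (rule power_mono[OF Qb]) simp
    also have "\<dots> = k ^ (178 * k * 2)" by (simp only: power_mult)
    finally show ?thesis unfolding card_torus by simp
  qed
  have Db: "card (tedges Q w) \<le> k ^ (712 * k)"
  proof -
    have "card (tedges Q w) \<le> Q ^ 4" by (rule card_tedges_le)
    also have "\<dots> \<le> (k ^ (178 * k)) ^ 4" by (rule power_mono[OF Qb]) simp
    also have "\<dots> = k ^ (178 * k * 4)" by (simp only: power_mult)
    finally show ?thesis by simp
  qed
  define h where "h = 357 * k * k"
  have h1: "1 \<le> h" unfolding h_def using k by simp
  have hb: "k * card (torus Q) \<le> 2 ^ h"
  proof -
    have "k * card (torus Q) \<le> k ^ 1 * k ^ (356 * k)" using rb by simp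
    also have "\<dots> = k ^ (1 + 356 * k)" by (simp only: power_add)
    also have "\<dots> \<le> k ^ (357 * k)" by (rule power_exponent_mono[OF k]) (use k in simp)
    also have "\<dots> \<le> (2 ^ k) ^ (357 * k)" by (intro power_mono less_imp_le less_exp) (use k in auto)
    also have "\<dots> = 2 ^ (k * (357 * k))" by (simp only: power_mult)
    also have "k * (357 * k) = h" unfolding h_def by simp
    finally show ?thesis .
  qed
  obtain n0 where n0: "\<And>n. n0 \<le> n \<Longrightarrow> 1 dvd n \<Longrightarrow>
    ind_size_ramsey k (cycle_graph n) \<le> enat (2 ^ 215 * (k ^ 8 * h ^ 8 * card (torus Q) ^ 12) * card (tedges Q w) * n)"
    using ind_size_ramsey_cycle_gadget[OF Q(1) k1 _ h1 hb] by blast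
  have bound: "2 ^ 215 * (k ^ 8 * h ^ 8 * card (torus Q) ^ 12) * card (tedges Q w) \<le> k ^ (5140 * k)"
  proof -
    have "h \<le> k ^ 11"
    proof -
      have "357 \<le> k ^ 9" using two_power_le[OF k, of 9] by simp
      then have "h \<le> k ^ 9 * k ^ 1 * k ^ 1" unfolding h_def by (intro mult_le_mono) auto
      also have "\<dots> = k ^ (9 + 1 + 1)" by (simp only: power_add)
      finally show ?thesis by simp
    qed
    then have "2 ^ 215 * (k ^ 8 * h ^ 8 * card (torus Q) ^ 12) * card (tedges Q w)
        \<le> k ^ 215 * (k ^ 8 * (k ^ 11) ^ 8 * (k ^ (356 * k)) ^ 12) * k ^ (712 * k)"
      by (intro mult_le_mono power_mono rb Db two_power_le[OF k]) auto
    also have "\<dots> = k ^ (215 + (8 + 11 * 8 + 356 * k * 12) + 712 * k)" by (simp only: power_add power_mult)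
    also have "\<dots> \<le> k ^ (5140 * k)" by (rule power_exponent_mono[OF k]) (use k in simp)
    finally show ?thesis .
  qed
  show thesis
  proof (rule that[of n0])
    fix n assume "n0 \<le> n"
    note n0[OF this one_dvd]
    also have "enat (2 ^ 215 * (k ^ 8 * h ^ 8 * card (torus Q) ^ 12) * card (tedges Q w) * n) \<le> enat (k ^ (5140 * k) * n)"
      unfolding enat_ord_simps using bound by (rule mult_le_mono1)
    finally show "ind_size_ramsey k (cycle_graph n) \<le> enat (k ^ (5140 * k) * n)" .
  qed
qed

text \<open>For \<open>k = 1\<close> the exponential bound is exactly n, without room for a constant
  factor; the cycle serves as its own host.\<close>

lemma one_colour_cycles:
  assumes n: "3 \<le> n"
  shows "ind_size_ramsey 1 (cycle_graph n) \<le> enat n"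
proof (rule ind_size_ramsey_le)
  have img: "edges (cycle_graph n) = (\<lambda>i. {i, Suc i mod n}) ` {..<n}" unfolding cycle_graph_def by auto
  show "card (edges (cycle_graph n)) \<le> n" unfolding img using card_image_le[of "{..<n}"] by simp
  show "simple_graph (cycle_graph n)"
    unfolding simple_graph_def
  proof (intro conjI ballI)
    show "finite (verts (cycle_graph n))" unfolding cycle_graph_def by simp
    fix e assume "e \<in> edges (cycle_graph n)"
    then obtain i where i: "i < n" "e = {i, Suc i mod n}" unfolding img by auto
    then show "e \<subseteq> verts (cycle_graph n)" unfolding cycle_graph_def using n by auto
    have "i \<noteq> Suc i mod n"
    proof (cases "Suc i = n")
      case True
      then show ?thesis using n by auto
    next
      case False
      then show ?thesis using i(1) by simp
    qed
    then show "card e = 2" using i(2) by simp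
  qed
  show "induced_ramsey 1 (cycle_graph n) (cycle_graph n)"
    unfolding induced_ramsey_def
  proof
    fix c assume c: "c \<in> edges (cycle_graph n) \<rightarrow> {..<1 :: nat}"
    have e: "e \<subseteq> verts (cycle_graph n)" if "e \<in> edges (cycle_graph n)" for e
      using that n unfolding cycle_graph_def by auto
    have same: "induced_subgraph (cycle_graph n) (verts (cycle_graph n)) = cycle_graph n"
      unfolding induced_subgraph_def using e by (auto intro!: prod_eqI)
    have "graph_iso (cycle_graph n) (cycle_graph n)"
      unfolding graph_iso_def by (intro exI[of _ id]) auto
    then show "\<exists>S\<subseteq>verts (cycle_graph n). \<exists>a<1. graph_iso (induced_subgraph (cycle_graph n) S) (cycle_graph n) \<and>
        (\<forall>e\<in>edges (induced_subgraph (cycle_graph n) S). c e = a)"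
      using c same by (intro exI[of _ "verts (cycle_graph n)"]) auto
  qed
qed

theorem theorem1p1:
  "\<exists>C::real. C > 0 \<and> (\<forall>k::nat. k \<ge> 1 \<longrightarrow> (\<exists>n0::nat. \<forall>n\<ge>n0.
     (even n \<longrightarrow> ereal_of_enat (ind_size_ramsey k (cycle_graph n))
                  \<le> ereal (C * real k ^ 102 * real n)) \<and>
     (odd n \<longrightarrow> ereal_of_enat (ind_size_ramsey k (cycle_graph n))
                  \<le> ereal (exp (C * real k * ln (real k)) * real n))))"
proof -
  define c :: nat where "c = 2 ^ 215 * 38 ^ 8 * 2 ^ 12 * 13312 ^ 27 * 8 ^ 12"
  \<comment> \<open>The same constant is a factor in the even case and part of an exponent in the
    odd case; the sum dominates both requirements.\<close>
  define C where "C = real c + 5140"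
  have toE: "ereal_of_enat x \<le> ereal y" if "x \<le> enat m" "real m \<le> y" for x m y
  proof -
    have "ereal_of_enat x \<le> ereal_of_enat (enat m)" using that(1) by (simp only: ereal_of_enat_le_iff)
    also have "\<dots> = ereal (real m)" by simp
    also have "\<dots> \<le> ereal y" using that(2) by simp
    finally show ?thesis .
  qed
  have "\<exists>n0::nat. \<forall>n\<ge>n0.
     (even n \<longrightarrow> ereal_of_enat (ind_size_ramsey k (cycle_graph n)) \<le> ereal (C * real k ^ 102 * real n)) \<and>
     (odd n \<longrightarrow> ereal_of_enat (ind_size_ramsey k (cycle_graph n)) \<le> ereal (exp (C * real k * ln (real k)) * real n))"
    if k: "1 \<le> k" for k
  proof -
    obtain n1 where n1: "\<And>n. n1 \<le> n \<Longrightarrow> even n \<Longrightarrow> ind_size_ramsey k (cycle_graph n) \<le> enat (c * k ^ 102 * n)"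
      using even_cycles[OF k] unfolding c_def by blast
    have "\<exists>n2. \<forall>n\<ge>n2. ereal_of_enat (ind_size_ramsey k (cycle_graph n)) \<le> ereal (exp (C * real k * ln (real k)) * real n)"
    proof (cases "k = 1")
      case True
      show ?thesis
      proof (intro exI allI impI)
        fix n :: nat assume "3 \<le> n"
        then show "ereal_of_enat (ind_size_ramsey k (cycle_graph n)) \<le> ereal (exp (C * real k * ln (real k)) * real n)"
          unfolding True by (intro toE[OF one_colour_cycles]) auto
      qed
    next
      case False
      then have k2: "2 \<le> k" using k by simp
      obtain n2 where n2: "\<And>n. n2 \<le> n \<Longrightarrow> ind_size_ramsey k (cycle_graph n) \<le> enat (k ^ (5140 * k) * n)"
        using odd_cycles[OF k2] by blast
      have le: "real (k ^ (5140 * k)) \<le> exp (C * real k * ln (real k))"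
      proof -
        have k0: "0 < real k" using k by simp
        have "exp (real (5140 * k) * ln (real k)) = exp (ln (real k)) ^ (5140 * k)" by (rule exp_of_nat_mult)
        then have "real (k ^ (5140 * k)) = exp (real (5140 * k) * ln (real k))" using k0 by simp
        also have "\<dots> \<le> exp (C * real k * ln (real k))"
        proof -
          have "real (5140 * k) \<le> C * real k" unfolding C_def by (simp add: algebra_simps)
          then show ?thesis using k2 by (simp add: mult_right_mono)
        qed
        finally show ?thesis .
      qed
      show ?thesis
      proof (intro exI allI impI)
        fix n assume n: "n2 \<le> n"
        show "ereal_of_enat (ind_size_ramsey k (cycle_graph n)) \<le> ereal (exp (C * real k * ln (real k)) * real n)"
          by (rule toE[OF n2[OF n]]) (use le in \<open>simp add: mult_right_mono\<close>)
      qed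
    qed
    then obtain n2 where n2: "\<And>n. n2 \<le> n \<Longrightarrow> ereal_of_enat (ind_size_ramsey k (cycle_graph n)) \<le> ereal (exp (C * real k * ln (real k)) * real n)"
      by blast
    have ev: "ereal_of_enat (ind_size_ramsey k (cycle_graph n)) \<le> ereal (C * real k ^ 102 * real n)" if n: "n1 \<le> n" "even n" for n
    proof (rule toE[OF n1[OF n]])
      have "real (c * k ^ 102 * n) = real c * real k ^ 102 * real n" by simp
      also have "\<dots> \<le> C * real k ^ 102 * real n" unfolding C_def by (intro mult_right_mono) auto
      finally show "real (c * k ^ 102 * n) \<le> C * real k ^ 102 * real n" .
    qed
    show ?thesis by (intro exI[of _ "max n1 n2"]) (use ev n2 in auto)
  qed
  moreover have "0 < C" unfolding C_def by simp
  ultimately show ?thesis by blast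
qed

end
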